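(* Let $m,n,l\ge 0$ be integers with $n\ne 0$, with $m$ or $l$ nonzero, and with $|\underline d|:=m+n+l\le 4$. The indecomposable (Belitskii) canonical forms of linear systems $(A,B,C)$ of size $\underline d=(m,n,l)$ are as follows, where the parameters $\lambda,\mu,\nu$ take pairwise different values in $\mathbb{C}$ and $J_q(\lambda)$ is the $q\times q$ upper triangular Jordan block with eigenvalue $\lambda$. **$|\underline d|=2$.** Size $(1,1,0)$: $A=[\lambda],\ B=[1]$. Size $(0,1,1)$: $A=[\lambda],\ C=[1]$. **$|\underline d|=3$.** Size $(1,1,1)$: $A=[\lambda],\ B=[1],\ C=[1]$. Size $(1,2,0)$: (i) $A=J_2(\lambda),\ B=\begin{bmatrix}0\\1\end{bmatrix}$; (ii) $A=J_2(\lambda),\ B=\begin{bmatrix}1\\0\end{bmatrix}$; (iii) $A=\mathrm{diag}(\lambda,\mu),\ B=\begin{bmatrix}1\\1\end{bmatrix}$. Size $(0,2,1)$: (i) $A=J_2(\lambda),\ C=[1\ \ 0]$; (ii) $A=J_2(\lambda),\ C=[0\ \ 1]$; (iii) $A=\mathrm{diag}(\lambda,\mu),\ C=[1\ \ 1]$. **$|\underline d|=4$.** Size $(1,2,1)$: (i) $A=J_2(\lambda),\ B=\begin{bmatrix}0\\1\end{bmatrix},\ C=[1\ \ \mu]$; (ii) $A=J_2(\lambda),\ B=\begin{bmatrix}0\\1\end{bmatrix},\ C=[0\ \ 1]$; (iii) $A=J_2(\lambda),\ B=\begin{bmatrix}1\\0\end{bmatrix},\ C=[1\ \ 0]$; (iv)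 $A=J_2(\lambda),\ B=\begin{bmatrix}1\\0\end{bmatrix},\ C=[0\ \ 1]$; (v) $A=\mathrm{diag}(\lambda,\mu),\ B=\begin{bmatrix}1\\1\end{bmatrix},\ C=[1\ \ \nu]$; (vi) $A=\mathrm{diag}(\lambda,\mu),\ B=\begin{bmatrix}1\\1\end{bmatrix},\ C=[0\ \ 1]$; (vii) $A=\mathrm{diag}(\lambda,\mu),\ B=\begin{bmatrix}0\\1\end{bmatrix},\ C=[1\ \ 1]$; (viii) $A=\mathrm{diag}(\lambda,\mu),\ B=\begin{bmatrix}1\\0\end{bmatrix},\ C=[1\ \ 1]$. Size $(1,3,0)$: (i) $A=J_3(\lambda),\ B=[0\ 0\ 1]^T$; (ii) $A=J_3(\lambda),\ B=[0\ 1\ 0]^T$; (iii) $A=J_3(\lambda),\ B=[1\ 0\ 0]^T$; (iv) $A=J_2(\lambda)\oplus[\mu],\ B=[0\ 1\ 1]^T$; (v) $A=J_2(\lambda)\oplus[\mu],\ B=[1\ 0\ 1]^T$; (vi) $A=\mathrm{diag}(\lambda,\mu,\nu),\ B=[1\ 1\ 1]^T$. Size $(0,3,1)$: (i) $A=J_3(\lambda),\ C=[1\ 0\ 0]$; (ii) $A=J_3(\lambda),\ C=[0\ 1\ 0]$; (iii) $A=J_3(\lambda),\ C=[0\ 0\ 1]$; (iv) $A=J_2(\lambda)\oplus[\mu],\ C=[1\ 0\ 1]$; (v) $A=J_2(\lambda)\oplus[\mu],\ C=[0\ 1\ 1]$; (vi) $A=\mathrm{diag}(\lambda,\mu,\nu),\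 C=[1\ 1\ 1]$. Size $(0,2,2)$: $A=J_2(\lambda),\ C=I_2$. Size $(2,2,0)$: $A=J_2(\lambda),\ B=I_2$.
   Context: A (time-invariant) linear system of size $(m,n,l)$ is a triple of complex matrices $(A,B,C)$ with $A\in\mathbb{C}^{n\times n}$, $B\in\mathbb{C}^{n\times m}$, $C\in\mathbb{C}^{l\times n}$, where $m,n,l\ge 0$. If $m=0$ (resp. $l=0$) then $B$ (resp. $C$) is empty and is omitted from the notation. Two systems $(A,B,C)$ and $(A',B',C')$ of the same size are equivalent if there exist nonsingular matrices $X\in\mathbb{C}^{m\times m}$, $Y\in\mathbb{C}^{n\times n}$, $Z\in\mathbb{C}^{l\times l}$ such that $A'=YAY^{-1}$, $B'=YBX^{-1}$, $C'=ZCY^{-1}$. A system is indecomposable if it cannot be written (up to equivalence) as a direct sum of two non-trivial systems, where the direct sum of $(A_1,B_1,C_1)$ and $(A_2,B_2,C_2)$ is $(A_1\oplus A_2,\ B_1\oplus B_2,\ C_1\oplus C_2)$ with $\oplus$ the block-diagonal sum (blocks with zero rows or zero columns are allowed). The canonical form of a system is the one produced by Belitskii's algorithm: first $A$ is reduced to its Jordan normal form $A'$, then $B$ is reduced to a form $B'$ using only the transformations stabilizing $A'$, then $C$ is reduced using only the transformations stabilizing $A'$ and $B'$; at each stage the blocks are repartitioned and the transformation group is restricted to the stabilizer of the already reduced blocks, and the process stops after finitely many steps. Two systems yield the same canonical form if and only if they are equivalent.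
   Formalization: In size (1,2,1), the parameter μ in C=[1 μ] of (i) and ν in C=[1 ν] of (v) may be any complex number: requiring them to differ from the eigenvalues of A omits true canonical forms, e.g. A=J_2(0), B=[0 1]^T, C=[1 0]. Jordan blocks are ordered by any linear order on C. *)

theory Defs
  imports
    Complex_Main
    "Jordan_Normal_Form.Jordan_Normal_Form"
    "Jordan_Normal_Form.Gauss_Jordan_Elimination"
begin

text \<open>Linear systems. Matrices of the library remember both dimensions even if one of them is
  \<open>0\<close>, so an omitted matrix is a matrix with no rows or no columns.\<close>

type_synonym linsys = "complex mat \<times> complex mat \<times> complex mat"

definition systems :: "nat \<Rightarrow> nat \<Rightarrow> nat \<Rightarrow> linsys set" where
  "systems m n l = carrier_mat n n \<times> carrier_mat n m \<times> carrier_mat l n"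

text \<open>A transformation is a triple \<open>(X, Y, Z)\<close> of nonsingular matrices.\<close>

type_synonym trafo = "complex mat \<times> complex mat \<times> complex mat"

definition GL :: "nat \<Rightarrow> complex mat set" where
  "GL k = {X \<in> carrier_mat k k. invertible_mat X}"

definition trafos :: "nat \<Rightarrow> nat \<Rightarrow> nat \<Rightarrow> trafo set" where
  "trafos m n l = GL m \<times> GL n \<times> GL l"

definition inv_mat :: "complex mat \<Rightarrow> complex mat" where
  "inv_mat X = the (mat_inverse X)"

fun act :: "trafo \<Rightarrow> linsys \<Rightarrow> linsys" where
  "act (X, Y, Z) (A, B, C) = (Y * A * inv_mat Y, Y * B * inv_mat X, Z * C * inv_mat Y)"

definition equivalent :: "nat \<Rightarrow> nat \<Rightarrow> nat \<Rightarrow> linsys \<Rightarrow> linsys \<Rightarrow> bool" where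
  "equivalent m n l S S' \<longleftrightarrow>
     S \<in> systems m n l \<and> S' \<in> systems m n l \<and> (\<exists>g \<in> trafos m n l. S' = act g S)"

definition block_sum :: "complex mat \<Rightarrow> complex mat \<Rightarrow> complex mat" where
  "block_sum P Q =
     four_block_mat P (0\<^sub>m (dim_row P) (dim_col Q)) (0\<^sub>m (dim_row Q) (dim_col P)) Q"

fun direct_sum :: "linsys \<Rightarrow> linsys \<Rightarrow> linsys" where
  "direct_sum (A1, B1, C1) (A2, B2, C2) = (block_sum A1 A2, block_sum B1 B2, block_sum C1 C2)"

definition indecomposable :: "nat \<Rightarrow> nat \<Rightarrow> nat \<Rightarrow> linsys \<Rightarrow> bool" where
  "indecomposable m n l S \<longleftrightarrow>
     \<not> (\<exists>m1 n1 l1 m2 n2 l2 S1 S2.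
          S1 \<in> systems m1 n1 l1 \<and> (m1, n1, l1) \<noteq> (0, 0, 0) \<and>
          S2 \<in> systems m2 n2 l2 \<and> (m2, n2, l2) \<noteq> (0, 0, 0) \<and>
          equivalent m n l S (direct_sum S1 S2))"

text \<open>
  Jordan data, listed as (size, eigenvalue): larger blocks first, and blocks of the same size by
  eigenvalue with respect to a linear order \<open>R\<close> of the complex numbers. Without such an order
  the Jordan normal form is only determined up to a permutation of the blocks.
\<close>

definition jordan_data :: "complex rel \<Rightarrow> (nat \<times> complex) list \<Rightarrow> bool" where
  "jordan_data R nas \<longleftrightarrow>
     0 \<notin> fst ` set nas \<and>
     sorted_wrt (\<lambda>(p, a) (q, b). q < p \<or> q = p \<and> (a, b) \<in> R) nas"

text \<open>
  An order of the basis in which the matrices commuting with the Jordan matrix become upper block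
  triangular: eigenvalue by eigenvalue, first the first vectors of all Jordan chains, then the
  second ones, and so on. In this order the Jordan matrix becomes a Weyr matrix. If the
  eigenvalues of the Jordan blocks are pairwise different, it is the given order \<open>0, 1, 2, \<dots>\<close>
  and the two matrices coincide.
\<close>

definition weyr_order :: "(nat \<times> complex) list \<Rightarrow> nat list" where
  "weyr_order nas =
     [sum_list (map fst (take b nas)) + t.
        a \<leftarrow> remdups (map snd nas), t \<leftarrow> [0..<sum_list (map fst nas)], b \<leftarrow> [0..<length nas],
        snd (nas ! b) = a \<and> t < fst (nas ! b)]"

definition block_of :: "nat list \<Rightarrow> nat list \<Rightarrow> complex mat \<Rightarrow> complex mat" where
  "block_of rs cs M = mat (length rs) (length cs) (\<lambda>(i, j). M $$ (rs ! i, cs ! j))"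

definition weyr_matrix :: "(nat \<times> complex) list \<Rightarrow> complex mat" where
  "weyr_matrix nas = block_of (weyr_order nas) (weyr_order nas) (jordan_matrix nas)"

text \<open>
  The strips into which a group \<open>G\<close> of matrices cuts the index list \<open>ix\<close>: there is a cut after
  the first \<open>k\<close> indices iff the span of these \<open>k\<close> basis vectors is invariant under \<open>G\<close>.
  At each stage of Belitskii's algorithm the remaining group consists of the nonsingular upper
  block triangular matrices from a matrix algebra whose diagonal blocks run over full matrix
  algebras (some of them being identified), and this recovers exactly that block partition.
\<close>

definition flag_invariant :: "nat list \<Rightarrow> complex mat set \<Rightarrow> nat \<Rightarrow> bool" where
  "flag_invariant ix G k \<longleftrightarrow>
     (\<forall>g \<in> G. \<forall>i j. j < k \<and> k \<le> i \<and> i < length ix \<longrightarrow> g $$ (ix ! i, ix ! j) = 0)"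

definition strips :: "nat list \<Rightarrow> complex mat set \<Rightarrow> nat list list" where
  "strips ix G =
     (let ks = filter (flag_invariant ix G) [0..<Suc (length ix)]
      in map (\<lambda>(a, b). drop a (take b ix)) (zip ks (tl ks)))"

text \<open>
  The blocks of \<open>B\<close> and then those of \<open>C\<close>, in the order of Belitskii's algorithm: lower
  horizontal strips first, and each strip from left to right. This order makes the transformed
  block depend only on the block itself and on blocks that have already been reduced. The list
  \<open>ix\<close> is the order of the basis of the state space.
\<close>

definition blocks :: "nat \<Rightarrow> nat \<Rightarrow> nat list \<Rightarrow> trafo set \<Rightarrow> (linsys \<Rightarrow> complex mat) list" where
  "blocks m l ix G =
     (let XS = strips [0..<m] ((\<lambda>(X, Y, Z). X) ` G);
          YS = strips ix ((\<lambda>(X, Y, Z). Y) ` G);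
          ZS = strips [0..<l] ((\<lambda>(X, Y, Z). Z) ` G)
      in [(\<lambda>(A, B, C). block_of r c B). r \<leftarrow> rev YS, c \<leftarrow> XS] @
         [(\<lambda>(A, B, C). block_of r c C). r \<leftarrow> rev ZS, c \<leftarrow> YS])"

text \<open>
  Reduced blocks. The block that is being reduced is transformed in one of three ways: arbitrary
  matrices can be added to it (then it is made zero), or it is transformed by equivalence
  (then it becomes \<open>[0 I; 0 0]\<close>), or by similarity (then it becomes a Weyr matrix). Trying
  these forms one after the other on the set \<open>Q\<close> of all attainable blocks selects the
  appropriate one.
\<close>

definition zero_form :: "complex mat \<Rightarrow> bool" where
  "zero_form N \<longleftrightarrow> N = 0\<^sub>m (dim_row N) (dim_col N)"

definition rank_form :: "complex mat \<Rightarrow> bool" where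
  "rank_form N \<longleftrightarrow>
     (\<exists>r p q. N = four_block_mat (0\<^sub>m r p) (1\<^sub>m r) (0\<^sub>m q p) (0\<^sub>m q r))"

definition weyr_form :: "complex rel \<Rightarrow> complex mat \<Rightarrow> bool" where
  "weyr_form R N \<longleftrightarrow> (\<exists>nas. jordan_data R nas \<and> N = weyr_matrix nas)"

definition reduced_block :: "complex rel \<Rightarrow> complex mat set \<Rightarrow> complex mat \<Rightarrow> bool" where
  "reduced_block R Q N \<longleftrightarrow>
     N \<in> Q \<and>
     (if \<exists>N' \<in> Q. zero_form N' then zero_form N
      else if \<exists>N' \<in> Q. rank_form N' then rank_form N
      else weyr_form R N)"

definition stabilizer :: "trafo set \<Rightarrow> (linsys \<Rightarrow> complex mat) \<Rightarrow> linsys \<Rightarrow> trafo set" where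
  "stabilizer G \<beta> M = {g \<in> G. \<beta> (act g M) = \<beta> M}"

text \<open>
  One step reduces the first block that is not fixed by the remaining group \<open>G\<close> and replaces
  \<open>G\<close> by the stabilizer of the reduced block; the algorithm stops when \<open>G\<close> fixes all blocks.
\<close>

inductive belitskii_run ::
    "complex rel \<Rightarrow> nat \<Rightarrow> nat \<Rightarrow> nat list \<Rightarrow> trafo set \<Rightarrow> linsys \<Rightarrow> linsys \<Rightarrow> bool"
  for R :: "complex rel" and m l :: nat and ix :: "nat list" where
  stop: "find (\<lambda>\<beta>. stabilizer G \<beta> M \<noteq> G) (blocks m l ix G) = None \<Longrightarrow>
     belitskii_run R m l ix G M M"
| step: "find (\<lambda>\<beta>. stabilizer G \<beta> M \<noteq> G) (blocks m l ix G) = Some \<beta> \<Longrightarrow>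
     g \<in> G \<Longrightarrow> reduced_block R ((\<lambda>h. \<beta> (act h M)) ` G) (\<beta> (act g M)) \<Longrightarrow>
     belitskii_run R m l ix (stabilizer G \<beta> (act g M)) (act g M) N \<Longrightarrow>
     belitskii_run R m l ix G M N"

definition belitskii_form ::
    "nat \<Rightarrow> nat \<Rightarrow> nat \<Rightarrow> complex rel \<Rightarrow> linsys \<Rightarrow> linsys \<Rightarrow> bool" where
  "belitskii_form m n l R S N \<longleftrightarrow>
     (\<exists>g \<in> trafos m n l. \<exists>nas.
        jordan_data R nas \<and> fst (act g S) = jordan_matrix nas \<and>
        belitskii_run R m l (weyr_order nas)
          (stabilizer (trafos m n l) fst (act g S)) (act g S) N)"

definition canonical_form :: "nat \<Rightarrow> nat \<Rightarrow> nat \<Rightarrow> complex rel \<Rightarrow> linsys \<Rightarrow> linsys" where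
  "canonical_form m n l R S = (THE N. belitskii_form m n l R S N)"

text \<open>
  The order of the eigenvalues is not fixed in advance: \<open>diag(a, b)\<close> and \<open>diag(b, a)\<close> both
  occur, each with respect to suitable orders \<open>R\<close>. For a fixed \<open>R\<close>, equivalent systems have
  the same canonical form.
\<close>

definition indecomposable_canonical_forms :: "nat \<Rightarrow> nat \<Rightarrow> nat \<Rightarrow> linsys set" where
  "indecomposable_canonical_forms m n l =
     {canonical_form m n l R S | R S.
        linear_order R \<and> S \<in> systems m n l \<and> indecomposable m n l S}"

definition column :: "complex list \<Rightarrow> complex mat" where
  "column xs = mat_of_cols_list (length xs) [xs]"

definition row_mat :: "complex list \<Rightarrow> complex mat" where
  "row_mat xs = mat_of_rows_list (length xs) [xs]"

definition diagonal :: "complex list \<Rightarrow> complex mat" where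
  "diagonal xs = mat_diag (length xs) (\<lambda>i. xs ! i)"

abbreviation J :: "nat \<Rightarrow> complex \<Rightarrow> complex mat" where
  "J q a \<equiv> jordan_block q a"

text \<open>
  Different parameters are required to take different values exactly if both are eigenvalues of
  \<open>A\<close>. The parameter in \<open>C = [1 b]\<close> or \<open>C = [1 c]\<close> in size \<open>(1, 2, 1)\<close> is an arbitrary
  complex number: with \<open>A = J 2 a\<close> and \<open>B = [0 1]\<^sup>T\<close>, also \<open>C = [1 a]\<close> is indecomposable and in
  canonical form.
\<close>

inductive listed_form :: "nat \<Rightarrow> nat \<Rightarrow> nat \<Rightarrow> linsys \<Rightarrow> bool" where
  "listed_form 1 1 0 (diagonal [a], column [1], 0\<^sub>m 0 1)"
| "listed_form 0 1 1 (diagonal [a], 0\<^sub>m 1 0, row_mat [1])"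

| "listed_form 1 1 1 (diagonal [a], column [1], row_mat [1])"

| "listed_form 1 2 0 (J 2 a, column [0, 1], 0\<^sub>m 0 2)"
| "listed_form 1 2 0 (J 2 a, column [1, 0], 0\<^sub>m 0 2)"
| "a \<noteq> b \<Longrightarrow> listed_form 1 2 0 (diagonal [a, b], column [1, 1], 0\<^sub>m 0 2)"

| "listed_form 0 2 1 (J 2 a, 0\<^sub>m 2 0, row_mat [1, 0])"
| "listed_form 0 2 1 (J 2 a, 0\<^sub>m 2 0, row_mat [0, 1])"
| "a \<noteq> b \<Longrightarrow> listed_form 0 2 1 (diagonal [a, b], 0\<^sub>m 2 0, row_mat [1, 1])"

| "listed_form 1 2 1 (J 2 a, column [0, 1], row_mat [1, b])"
| "listed_form 1 2 1 (J 2 a, column [0, 1], row_mat [0, 1])"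
| "listed_form 1 2 1 (J 2 a, column [1, 0], row_mat [1, 0])"
| "listed_form 1 2 1 (J 2 a, column [1, 0], row_mat [0, 1])"
| "a \<noteq> b \<Longrightarrow> listed_form 1 2 1 (diagonal [a, b], column [1, 1], row_mat [1, c])"
| "a \<noteq> b \<Longrightarrow> listed_form 1 2 1 (diagonal [a, b], column [1, 1], row_mat [0, 1])"
| "a \<noteq> b \<Longrightarrow> listed_form 1 2 1 (diagonal [a, b], column [0, 1], row_mat [1, 1])"
| "a \<noteq> b \<Longrightarrow> listed_form 1 2 1 (diagonal [a, b], column [1, 0], row_mat [1, 1])"

| "listed_form 1 3 0 (J 3 a, column [0, 0, 1], 0\<^sub>m 0 3)"
| "listed_form 1 3 0 (J 3 a, column [0, 1, 0], 0\<^sub>m 0 3)"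
| "listed_form 1 3 0 (J 3 a, column [1, 0, 0], 0\<^sub>m 0 3)"
| "a \<noteq> b \<Longrightarrow> listed_form 1 3 0 (block_sum (J 2 a) (diagonal [b]), column [0, 1, 1], 0\<^sub>m 0 3)"
| "a \<noteq> b \<Longrightarrow> listed_form 1 3 0 (block_sum (J 2 a) (diagonal [b]), column [1, 0, 1], 0\<^sub>m 0 3)"
| "a \<noteq> b \<Longrightarrow> a \<noteq> c \<Longrightarrow> b \<noteq> c \<Longrightarrow>
     listed_form 1 3 0 (diagonal [a, b, c], column [1, 1, 1], 0\<^sub>m 0 3)"

| "listed_form 0 3 1 (J 3 a, 0\<^sub>m 3 0, row_mat [1, 0, 0])"
| "listed_form 0 3 1 (J 3 a, 0\<^sub>m 3 0, row_mat [0, 1, 0])"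
| "listed_form 0 3 1 (J 3 a, 0\<^sub>m 3 0, row_mat [0, 0, 1])"
| "a \<noteq> b \<Longrightarrow> listed_form 0 3 1 (block_sum (J 2 a) (diagonal [b]), 0\<^sub>m 3 0, row_mat [1, 0, 1])"
| "a \<noteq> b \<Longrightarrow> listed_form 0 3 1 (block_sum (J 2 a) (diagonal [b]), 0\<^sub>m 3 0, row_mat [0, 1, 1])"
| "a \<noteq> b \<Longrightarrow> a \<noteq> c \<Longrightarrow> b \<noteq> c \<Longrightarrow>
     listed_form 0 3 1 (diagonal [a, b, c], 0\<^sub>m 3 0, row_mat [1, 1, 1])"

| "listed_form 0 2 2 (J 2 a, 0\<^sub>m 2 0, 1\<^sub>m 2)"

| "listed_form 2 2 0 (J 2 a, 1\<^sub>m 2, 0\<^sub>m 0 2)"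

end

theory Submission
  imports Defs "Jordan_Normal_Form.Jordan_Normal_Form_Existence"
    "Jordan_Normal_Form.Jordan_Normal_Form_Uniqueness"
begin

text \<open>
  A decomposition of a system is the same as a nontrivial idempotent endomorphism \<open>(P, Q, T)\<close>
  with \<open>QA = AQ\<close>, \<open>QB = BP\<close>, \<open>TC = CQ\<close>, because idempotent matrices are diagonalizable. For a
  listed form such an idempotent is \<open>0\<close> or \<open>1\<close>; conversely, a system with Jordan matrix \<open>A\<close>
  either admits an explicit nontrivial idempotent or is carried to a listed form by an explicit
  matrix commuting with \<open>A\<close>.

  In a listed form the Jordan blocks of \<open>A\<close> have pairwise different eigenvalues, so the matrices
  commuting with \<open>A\<close> are upper triangular. If the transformation group is triangular, Belitskii's
  algorithm runs through the entries of \<open>B\<close> and \<open>C\<close> in a fixed order, and an entry of the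
  transformed system depends only on that entry and the preceding ones. Hence the remaining group
  is always the stabilizer of the first entries, for every system in the orbit, and each run ends
  in a system \<open>N\<close> of the orbit as soon as every entry of \<open>N\<close> is \<open>0\<close>, or is fixed by
  the stabilizer of the preceding ones, or is \<open>1\<close> and cannot be made \<open>0\<close>. Only the sizes
  \<open>(2, 2, 0)\<close> and \<open>(0, 2, 2)\<close> need one reduction of a larger block before the group is triangular.
\<close>

section \<open>The action of the transformation group\<close>

text \<open>\<open>canonical_form\<close> is a definite description, and a \<open>step\<close> may
  use any \<open>g\<close> that produces a reduced block. So a listed form must be shown to be the
  result of every run on its orbit; existence and uniqueness are proved together, as an equivalence
  with right-hand side \<open>N' = N\<close>. The order \<open>R\<close> matters through the Jordan
  data: sorted by \<open>R\<close> they are unique, which removes the freedom in the first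
  reduction. The two inclusions of the theorem treat \<open>R\<close> differently. For an
  indecomposable system \<open>R\<close> is given, and the listed form that is found has its
  eigenvalues in that order; for a listed form an order has to be built that agrees with its
  eigenvalues. To make 31 forms manageable, inverses are removed from the action
  (\<open>Y * B = B' * X\<close> instead of \<open>B' = Y * B * inv_mat X\<close>), and matrix
  equations become equations between entries over index ranges of length at most 3.\<close>

lemma GL_carrier: "X \<in> GL k \<Longrightarrow> X \<in> carrier_mat k k"
  by (simp add: GL_def)

lemma GL_I:
  assumes "X \<in> carrier_mat k k" "Y \<in> carrier_mat k k" "X * Y = 1\<^sub>m k"
  shows "X \<in> GL k"
proof -
  have "Y * X = 1\<^sub>m k"
    using mat_mult_left_right_inverse[OF assms] .
  then show ?thesis
    using assms unfolding GL_def invertible_mat_def inverts_mat_def square_mat.simps by auto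
qed

lemma inv_mat:
  assumes "X \<in> GL k"
  shows "inv_mat X \<in> GL k" "X * inv_mat X = 1\<^sub>m k" "inv_mat X * X = 1\<^sub>m k"
proof -
  have X: "X \<in> carrier_mat k k"
    using assms by (rule GL_carrier)
  obtain Y where Y: "X * Y = 1\<^sub>m k" "Y * X = 1\<^sub>m (dim_row Y)"
    using assms X unfolding GL_def invertible_mat_def inverts_mat_def by auto
  have "dim_col Y = k"
    using arg_cong[OF Y(1), of dim_col] by simp
  moreover have "dim_row Y = k"
    using arg_cong[OF Y(2), of dim_col] X by simp
  ultimately have Yc: "Y \<in> carrier_mat k k" and YX: "Y * X = 1\<^sub>m k"
    using Y(2) by auto
  \<comment> \<open>\<open>inv_mat\<close> unpacks an option value; being a unit of the matrix ring
    is what guarantees that \<open>mat_inverse X\<close> is not \<open>None\<close>.\<close>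
  have "X \<in> Units (ring_mat TYPE(complex) k ())"
    unfolding Units_def ring_mat_simps using X Yc Y(1) YX by auto
  then have "mat_inverse X \<noteq> None"
    using mat_inverse(1)[OF X, where b = "()"] by blast
  then obtain W where W: "mat_inverse X = Some W"
    by blast
  have inv: "inv_mat X = W"
    by (simp add: inv_mat_def W)
  from mat_inverse(2)[OF X W] have "X * W = 1\<^sub>m k" "W * X = 1\<^sub>m k" "W \<in> carrier_mat k k"
    by auto
  then show "inv_mat X \<in> GL k" "X * inv_mat X = 1\<^sub>m k" "inv_mat X * X = 1\<^sub>m k"
    unfolding inv using GL_I X by auto
qed

lemma inv_mat_carrier: "X \<in> GL k \<Longrightarrow> inv_mat X \<in> carrier_mat k k"
  using inv_mat(1) GL_carrier by blast

lemma GL_one: "1\<^sub>m k \<in> GL k"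
  by (rule GL_I[of _ _ "1\<^sub>m k"]) auto

lemma GL_mult:
  assumes "X \<in> GL k" "Y \<in> GL k"
  shows "X * Y \<in> GL k"
proof -
  have c: "X \<in> carrier_mat k k" "Y \<in> carrier_mat k k" "inv_mat X \<in> carrier_mat k k"
    "inv_mat Y \<in> carrier_mat k k"
    using assms GL_carrier inv_mat_carrier by auto
  have "X * Y * (inv_mat Y * inv_mat X) = X * (Y * inv_mat Y) * inv_mat X"
    using c by (simp add: assoc_mult_mat[of _ k k _ k _ k])
  also have "\<dots> = 1\<^sub>m k"
    using c inv_mat(2)[OF assms(1)] inv_mat(2)[OF assms(2)] by simp
  finally show ?thesis
    using c by (intro GL_I[of _ _ "inv_mat Y * inv_mat X"]) auto
qed

lemma GL_iff_det: "X \<in> carrier_mat k k \<Longrightarrow> X \<in> GL k \<longleftrightarrow> det X \<noteq> 0"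
proof
  assume X: "X \<in> carrier_mat k k" and "X \<in> GL k"
  then have "det X * det (inv_mat X) = 1"
    using det_mult[OF X inv_mat_carrier] inv_mat(2) by fastforce
  then show "det X \<noteq> 0"
    by auto
next
  assume X: "X \<in> carrier_mat k k" and d: "det X \<noteq> 0"
  have "X \<in> Units (ring_mat TYPE(complex) k ())"
    by (rule det_non_zero_imp_unit[OF X d])
  then obtain Y where "Y \<in> carrier_mat k k" "X * Y = 1\<^sub>m k"
    unfolding Units_def ring_mat_simps by auto
  then show "X \<in> GL k"
    using GL_I X by blast
qed

lemma eq_mult_inv_mat_iff:
  assumes "X \<in> GL k" "M \<in> carrier_mat p k" "W \<in> carrier_mat p k"
  shows "M = W * inv_mat X \<longleftrightarrow> W = M * X"
proof -
  have c: "X \<in> carrier_mat k k" "inv_mat X \<in> carrier_mat k k"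
    using assms GL_carrier inv_mat_carrier by auto
  have "W * inv_mat X * X = W" "M * X * inv_mat X = M"
    using c assms inv_mat[OF assms(1)] by (simp_all add: assoc_mult_mat[of _ p k _ k _ k])
  then show ?thesis
    by metis
qed

text \<open>Clears all inverses at once. What remains is linear in the entries of \<open>X\<close>,
  \<open>Y\<close>, \<open>Z\<close>; this is the form in which the action is computed with
  later.\<close>

lemma act_eq_iff:
  assumes "(X, Y, Z) \<in> trafos m n l" "(A, B, C) \<in> systems m n l" "(A', B', C') \<in> systems m n l"
  shows "act (X, Y, Z) (A, B, C) = (A', B', C') \<longleftrightarrow>
    Y * A = A' * Y \<and> Y * B = B' * X \<and> Z * C = C' * Y"
proof -
  have g: "X \<in> GL m" "Y \<in> GL n" "Z \<in> GL l"
    using assms by (auto simp: trafos_def)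
  have c: "X \<in> carrier_mat m m" "Y \<in> carrier_mat n n" "Z \<in> carrier_mat l l"
    using g GL_carrier by auto
  have s: "A \<in> carrier_mat n n" "B \<in> carrier_mat n m" "C \<in> carrier_mat l n"
    "A' \<in> carrier_mat n n" "B' \<in> carrier_mat n m" "C' \<in> carrier_mat l n"
    using assms by (auto simp: systems_def)
  have "A' = Y * A * inv_mat Y \<longleftrightarrow> Y * A = A' * Y"
    by (rule eq_mult_inv_mat_iff[OF g(2)]) (use c s in auto)
  moreover have "B' = Y * B * inv_mat X \<longleftrightarrow> Y * B = B' * X"
    by (rule eq_mult_inv_mat_iff[OF g(1)]) (use c s in auto)
  moreover have "C' = Z * C * inv_mat Y \<longleftrightarrow> Z * C = C' * Y"
    by (rule eq_mult_inv_mat_iff[OF g(2)]) (use c s in auto)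
  ultimately show ?thesis
    by auto
qed

lemma act_closed:
  assumes "g \<in> trafos m n l" "S \<in> systems m n l"
  shows "act g S \<in> systems m n l"
proof -
  obtain X Y Z A B C where e: "g = (X, Y, Z)" "S = (A, B, C)"
    by (metis prod_cases3)
  have "X \<in> carrier_mat m m" "Y \<in> carrier_mat n n" "Z \<in> carrier_mat l l"
    "inv_mat X \<in> carrier_mat m m" "inv_mat Y \<in> carrier_mat n n"
    "A \<in> carrier_mat n n" "B \<in> carrier_mat n m" "C \<in> carrier_mat l n"
    using assms GL_carrier inv_mat_carrier by (auto simp: trafos_def systems_def e)
  then show ?thesis
    by (auto simp: systems_def e)
qed

fun trafo_mult :: "trafo \<Rightarrow> trafo \<Rightarrow> trafo" where
  "trafo_mult (X, Y, Z) (X', Y', Z') = (X * X', Y * Y', Z * Z')"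

fun trafo_inv :: "trafo \<Rightarrow> trafo" where
  "trafo_inv (X, Y, Z) = (inv_mat X, inv_mat Y, inv_mat Z)"

definition trafo_one :: "nat \<Rightarrow> nat \<Rightarrow> nat \<Rightarrow> trafo" where
  "trafo_one m n l = (1\<^sub>m m, 1\<^sub>m n, 1\<^sub>m l)"

lemma trafo_mult_closed: "g \<in> trafos m n l \<Longrightarrow> h \<in> trafos m n l \<Longrightarrow> trafo_mult g h \<in> trafos m n l"
  by (cases g; cases h) (auto simp: trafos_def GL_mult)

lemma trafo_inv_closed: "g \<in> trafos m n l \<Longrightarrow> trafo_inv g \<in> trafos m n l"
  by (cases g) (auto simp: trafos_def inv_mat)

lemma trafo_one_closed: "trafo_one m n l \<in> trafos m n l"
  by (auto simp: trafo_one_def trafos_def GL_one)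

text \<open>Pasting of two commuting squares. One statement serves \<open>A\<close>,
  \<open>B\<close> and \<open>C\<close>, which differ only in the spaces that they connect.\<close>

lemma intertwine_mult:
  assumes "Y \<in> carrier_mat p p" "Y' \<in> carrier_mat p p" "X \<in> carrier_mat q q" "X' \<in> carrier_mat q q"
    "B \<in> carrier_mat p q" "B' \<in> carrier_mat p q" "B'' \<in> carrier_mat p q"
    "Y' * B = B' * X'" "Y * B' = B'' * X"
  shows "(Y * Y') * B = B'' * (X * X')"
proof -
  have "(Y * Y') * B = Y * (Y' * B)"
    using assms(1-7) by (simp add: assoc_mult_mat[of _ p p _ p _ q])
  also have "\<dots> = (Y * B') * X'"
    unfolding assms(8) using assms(1-7) by (simp add: assoc_mult_mat[of _ p p _ q _ q])
  also have "\<dots> = B'' * (X * X')"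
    unfolding assms(9) using assms(1-7) by (simp add: assoc_mult_mat[of _ p q _ q _ q])
  finally show ?thesis .
qed

lemma act_mult:
  assumes "g \<in> trafos m n l" "h \<in> trafos m n l" "S \<in> systems m n l"
  shows "act g (act h S) = act (trafo_mult g h) S"
proof -
  obtain X Y Z X' Y' Z' A B C where e: "g = (X, Y, Z)" "h = (X', Y', Z')" "S = (A, B, C)"
    by (metis prod_cases3)
  obtain A' B' C' where S': "act h S = (A', B', C')"
    by (metis prod_cases3)
  obtain A'' B'' C'' where S'': "act g (act h S) = (A'', B'', C'')"
    by (metis prod_cases3)
  have sys: "(A', B', C') \<in> systems m n l" "(A'', B'', C'') \<in> systems m n l"
    using act_closed assms S' S'' by metis+
  have 1: "Y' * A = A' * Y' \<and> Y' * B = B' * X' \<and> Z' * C = C' * Y'"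
    using act_eq_iff S' assms sys unfolding e by blast
  have 2: "Y * A' = A'' * Y \<and> Y * B' = B'' * X \<and> Z * C' = C'' * Y"
    using act_eq_iff S'' assms sys unfolding S' unfolding e by blast
  have c: "X \<in> carrier_mat m m" "Y \<in> carrier_mat n n" "Z \<in> carrier_mat l l"
    "X' \<in> carrier_mat m m" "Y' \<in> carrier_mat n n" "Z' \<in> carrier_mat l l"
    "A \<in> carrier_mat n n" "B \<in> carrier_mat n m" "C \<in> carrier_mat l n"
    "A' \<in> carrier_mat n n" "B' \<in> carrier_mat n m" "C' \<in> carrier_mat l n"
    "A'' \<in> carrier_mat n n" "B'' \<in> carrier_mat n m" "C'' \<in> carrier_mat l n"
    using assms sys GL_carrier by (auto simp: trafos_def systems_def e)
  have "(X * X', Y * Y', Z * Z') \<in> trafos m n l"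
    using trafo_mult_closed[OF assms(1,2)] by (simp add: e)
  moreover have "(Y * Y') * A = A'' * (Y * Y')" "(Y * Y') * B = B'' * (X * X')"
      "(Z * Z') * C = C'' * (Y * Y')"
    by (rule intertwine_mult[where B' = A'] intertwine_mult[where B' = B']
        intertwine_mult[where B' = C']; use c 1 2 in simp)+
  ultimately have "act (X * X', Y * Y', Z * Z') (A, B, C) = (A'', B'', C'')"
    using act_eq_iff[OF _ assms(3)[unfolded e] sys(2)] by blast
  then show ?thesis
    using S'' by (simp add: e)
qed

lemma act_one: "S \<in> systems m n l \<Longrightarrow> act (trafo_one m n l) S = S"
proof -
  assume "S \<in> systems m n l"
  moreover obtain A B C where "S = (A, B, C)"
    by (metis prod_cases3)
  ultimately show ?thesis
    using trafo_one_closed act_eq_iff[of "1\<^sub>m m" "1\<^sub>m n" "1\<^sub>m l" m n l A B C A B C]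
    unfolding trafo_one_def systems_def by auto
qed

lemma trafo_inv:
  "g \<in> trafos m n l \<Longrightarrow> trafo_mult (trafo_inv g) g = trafo_one m n l"
  "g \<in> trafos m n l \<Longrightarrow> trafo_mult g (trafo_inv g) = trafo_one m n l"
  by (cases g; auto simp: trafos_def inv_mat trafo_one_def)+

lemma act_inv:
  assumes "g \<in> trafos m n l" "S \<in> systems m n l"
  shows "act (trafo_inv g) (act g S) = S" "act g (act (trafo_inv g) S) = S"
  using act_mult[OF trafo_inv_closed assms(1)] act_mult[OF _ trafo_inv_closed] trafo_inv act_one assms
  by metis+

lemma equivalent_sym: "equivalent m n l S S' \<Longrightarrow> equivalent m n l S' S"
  unfolding equivalent_def using act_inv(1) trafo_inv_closed by metis

lemma equivalent_trans:
  "equivalent m n l S S' \<Longrightarrow> equivalent m n l S' S'' \<Longrightarrow> equivalent m n l S S''"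
  unfolding equivalent_def using act_mult trafo_mult_closed by metis

lemma equivalentI:
  assumes "(A, B, C) \<in> systems m n l" "(A', B', C') \<in> systems m n l"
    "X \<in> GL m" "Y \<in> GL n" "Z \<in> GL l"
    "Y * A = A' * Y" "Y * B = B' * X" "Z * C = C' * Y"
  shows "equivalent m n l (A, B, C) (A', B', C')"
proof -
  have t: "(X, Y, Z) \<in> trafos m n l"
    using assms by (simp add: trafos_def)
  then show ?thesis
    unfolding equivalent_def using assms act_eq_iff[OF t assms(1,2)] by metis
qed

text \<open>The first reduction ranges over the whole of \<open>trafos m n l\<close>, so passing to
  an equivalent system only multiplies the initial \<open>g\<close> by a fixed element.\<close>

lemma belitskii_form_cong:
  assumes "equivalent m n l S S'"
  shows "belitskii_form m n l R S N \<longleftrightarrow> belitskii_form m n l R S' N"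
proof -
  have "belitskii_form m n l R T N" if eq: "equivalent m n l T T'" and form: "belitskii_form m n l R T' N" for T T'
  proof -
    obtain h where h: "h \<in> trafos m n l" "T' = act h T" "T \<in> systems m n l"
      using eq unfolding equivalent_def by blast
    obtain g where g: "g \<in> trafos m n l" "\<exists>nas. jordan_data R nas \<and> fst (act g T') = jordan_matrix nas \<and>
        belitskii_run R m l (weyr_order nas) (stabilizer (trafos m n l) fst (act g T')) (act g T') N"
      using form unfolding belitskii_form_def by blast
    have "act g T' = act (trafo_mult g h) T"
      using g h act_mult by auto
    then show ?thesis
      unfolding belitskii_form_def using g trafo_mult_closed[OF g(1) h(1)] by metis
  qed
  then show ?thesis
    using assms equivalent_sym by blast
qed

section \<open>Jordan forms and idempotent matrices\<close>

lemma block_sum_carrier [simp]: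
  "A \<in> carrier_mat p q \<Longrightarrow> B \<in> carrier_mat r s \<Longrightarrow> block_sum A B \<in> carrier_mat (p + r) (q + s)"
  by (auto simp: block_sum_def)

lemma block_sum_dim [simp]:
  "dim_row (block_sum A B) = dim_row A + dim_row B" "dim_col (block_sum A B) = dim_col A + dim_col B"
  by (auto simp: block_sum_def)

lemma block_sum_index:
  assumes "i < dim_row A + dim_row B" "j < dim_col A + dim_col B"
  shows "block_sum A B $$ (i, j) =
    (if i < dim_row A then if j < dim_col A then A $$ (i, j) else 0
     else if j < dim_col A then 0 else B $$ (i - dim_row A, j - dim_col A))"
  using assms by (auto simp: block_sum_def)

lemma block_sum_assoc: "block_sum A (block_sum B C) = block_sum (block_sum A B) C"
  unfolding block_sum_def using assoc_four_block_mat[of A B C] by simp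

lemma block_sum_mult:
  assumes "A \<in> carrier_mat p p" "A' \<in> carrier_mat p p" "B \<in> carrier_mat q q" "B' \<in> carrier_mat q q"
  shows "block_sum A B * block_sum A' B' = block_sum (A * A') (B * B')"
  unfolding block_sum_def
  by (subst mult_four_block_mat[of _ p p _ q _ q _ _ p _ q]) (use assms in auto)

lemma block_sum_inject:
  assumes "block_sum A B = block_sum A' B'" "A \<in> carrier_mat p q" "A' \<in> carrier_mat p q"
    "B \<in> carrier_mat r s" "B' \<in> carrier_mat r s"
  shows "A = A'" "B = B'"
proof -
  have e: "block_sum A B $$ (i, j) = block_sum A' B' $$ (i, j)" for i j
    using assms(1) by simp
  show "A = A'"
  proof (rule eq_matI)
    show "A $$ (i, j) = A' $$ (i, j)" if "i < dim_row A'" "j < dim_col A'" for i j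
      using e[of i j] that assms(2-5) by (simp add: block_sum_index)
  qed (use assms in auto)
  show "B = B'"
  proof (rule eq_matI)
    show "B $$ (i, j) = B' $$ (i, j)" if "i < dim_row B'" "j < dim_col B'" for i j
      using e[of "p + i" "q + j"] that assms(2-5) by (simp add: block_sum_index)
  qed (use assms in auto)
qed

text \<open>Conjugation by the block permutation \<open>?P\<close>; its inverse \<open>?Q\<close>
  exchanges the blocks back.\<close>

lemma similar_block_sum_commute:
  assumes A: "A \<in> carrier_mat p p" and B: "B \<in> carrier_mat q q"
  shows "similar_mat (block_sum A B :: complex mat) (block_sum B A)"
proof -
  let ?P = "four_block_mat (0\<^sub>m p q) (1\<^sub>m p) (1\<^sub>m q) (0\<^sub>m q p) :: complex mat"
  let ?Q = "four_block_mat (0\<^sub>m q p) (1\<^sub>m q) (1\<^sub>m p) (0\<^sub>m p q) :: complex mat"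
  have PQ: "?P * ?Q = 1\<^sub>m (p + q)"
    by (subst mult_four_block_mat[of _ p q _ p _ q _ _ p _ q]) auto
  have QP: "?Q * ?P = 1\<^sub>m (p + q)"
    by (subst mult_four_block_mat[of _ q p _ q _ p _ _ q _ p]) (auto simp: add.commute)
  have "?P * block_sum B A = four_block_mat (0\<^sub>m p q) A B (0\<^sub>m q p)"
    unfolding block_sum_def
    by (subst mult_four_block_mat[of _ p q _ p _ q _ _ q _ p]) (use A B in auto)
  also have "\<dots> * ?Q = block_sum A B"
    unfolding block_sum_def
    by (subst mult_four_block_mat[of _ p q _ p _ q _ _ p _ q]) (use A B in auto)
  finally have "block_sum A B = ?P * block_sum B A * ?Q"
    by simp
  then show ?thesis
    using PQ QP A B
    by (intro similar_matI[of _ _ ?P ?Q "p + q"]) (auto simp: block_sum_def add.commute)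
qed

lemma similar_block_sum:
  assumes "similar_mat A A'" "similar_mat B B'"
  shows "similar_mat (block_sum A B) (block_sum A' B')"
proof -
  obtain p q where "A \<in> carrier_mat p p" "A' \<in> carrier_mat p p" "B \<in> carrier_mat q q" "B' \<in> carrier_mat q q"
    using similar_matD[OF assms(1)] similar_matD[OF assms(2)] by auto
  then show ?thesis
    using similar_mat_four_block_0_0[OF assms, of p q] by (auto simp: block_sum_def)
qed

lemma jordan_matrix_Nil: "jordan_matrix [] = 0\<^sub>m 0 0"
  by (simp add: jordan_matrix_def)

lemma jordan_matrix_Cons_block_sum:
  "jordan_matrix (x # xs) = block_sum (jordan_block (fst x) (snd x)) (jordan_matrix xs)"
  by (cases x) (simp add: jordan_matrix_Cons block_sum_def)

lemma similar_jordan_matrix_Cons: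
  assumes "similar_mat (jordan_matrix xs) (jordan_matrix ys)"
  shows "similar_mat (jordan_matrix (x # xs) :: complex mat) (jordan_matrix (x # ys))"
  unfolding jordan_matrix_Cons_block_sum
  by (intro similar_block_sum similar_mat_refl assms) (rule jordan_block_carrier)

lemma similar_jordan_matrix_swap:
  "similar_mat (jordan_matrix (x # y # zs) :: complex mat) (jordan_matrix (y # x # zs))"
  unfolding jordan_matrix_Cons_block_sum block_sum_assoc
  by (intro similar_block_sum similar_block_sum_commute similar_mat_refl)
    (rule jordan_block_carrier jordan_matrix_carrier)+

lemma similar_jordan_matrix_move:
  "similar_mat (jordan_matrix (us @ x # vs) :: complex mat) (jordan_matrix (x # us @ vs))"
proof (induction us)
  case Nil
  then show ?case
    using similar_mat_refl[OF jordan_matrix_carrier] by simp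
next
  case (Cons u us)
  then show ?case
    using similar_mat_trans[OF similar_jordan_matrix_Cons similar_jordan_matrix_swap] by simp
qed

text \<open>The head of \<open>xs\<close> is located in \<open>ys\<close> and moved to the front by
  transpositions of neighbouring blocks. Any Jordan form can thus be rearranged into the order
  demanded by \<open>jordan_data\<close>.\<close>

lemma similar_jordan_matrix_mset:
  "mset xs = mset ys \<Longrightarrow> similar_mat (jordan_matrix xs :: complex mat) (jordan_matrix ys)"
proof (induction xs arbitrary: ys)
  case Nil
  then show ?case
    using similar_mat_refl[OF jordan_matrix_carrier] by simp
next
  case (Cons x xs)
  then have "x \<in> set ys"
    by (metis list.set_intros(1) set_mset_mset)
  then obtain us vs where ys: "ys = us @ x # vs"
    by (meson split_list)
  then have "mset xs = mset (us @ vs)"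
    using Cons.prems by simp
  then have "similar_mat (jordan_matrix (x # xs)) (jordan_matrix (x # us @ vs) :: complex mat)"
    by (intro similar_jordan_matrix_Cons Cons.IH)
  then show ?case
    unfolding ys using similar_jordan_matrix_move similar_mat_sym similar_mat_trans by blast
qed

text \<open>Insertion sort for a total preorder given as a parameter. Ties are allowed, so nothing
  is said about uniqueness.\<close>

lemma ex_sorted_wrt:
  assumes "\<And>x y. P x y \<or> P y x" "\<And>x y z. P x y \<Longrightarrow> P y z \<Longrightarrow> P x z"
  shows "\<exists>ys. mset ys = mset xs \<and> sorted_wrt P ys"
proof (induction xs)
  case Nil
  then show ?case
    by auto
next
  case (Cons x xs)
  then obtain ys where ys: "mset ys = mset xs" "sorted_wrt P ys"
    by blast
  have "\<exists>zs. mset zs = mset (x # ys) \<and> sorted_wrt P zs"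
    using ys(2)
  proof (induction ys)
    case Nil
    then show ?case
      by (intro exI[of _ "[x]"]) auto
  next
    case (Cons y ys)
    then obtain zs where zs: "mset zs = mset (x # ys)" "sorted_wrt P zs"
      by auto
    have setzs: "set zs = insert x (set ys)"
      using zs(1) by (metis list.set(2) set_mset_mset)
    show ?case
    proof (cases "P x y")
      case True
      then have "sorted_wrt P (x # y # ys)"
        using Cons.prems assms(2) by auto
      then show ?thesis
        by (intro exI[of _ "x # y # ys"]) auto
    next
      case False
      then have "sorted_wrt P (y # zs)"
        using zs(2) setzs Cons.prems assms(1) by auto
      then show ?thesis
        using zs(1) by (intro exI[of _ "y # zs"]) auto
    qed
  qed
  then show ?case
    using ys(1) by auto
qed

lemma ex_jordan_nf:
  assumes "(A :: complex mat) \<in> carrier_mat n n"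
  shows "\<exists>nas. jordan_nf A nas"
  using char_poly_factorized[OF assms] jordan_nf_exists[OF assms] by blast

text \<open>Keeps only one half of the similarity witness, as an intertwining element of
  \<open>GL n\<close>; this is the shape in which it can be fed to the action.\<close>

lemma similar_mat_intertwine:
  assumes sim: "similar_mat A B" and A: "A \<in> carrier_mat n n"
  shows "B \<in> carrier_mat n n" "\<exists>T \<in> GL n. T * A = B * T"
proof -
  obtain k S T where "A \<in> carrier_mat k k" "B \<in> carrier_mat k k" "S \<in> carrier_mat k k"
      "T \<in> carrier_mat k k" "S * T = 1\<^sub>m k" "T * S = 1\<^sub>m k" "A = S * B * T"
    using similar_matD[OF sim] by auto
  then have w: "B \<in> carrier_mat n n" "S \<in> carrier_mat n n" "T \<in> carrier_mat n n"
      "T * S = 1\<^sub>m n" "A = S * B * T"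
    using A by auto
  have "T * A = (T * S) * (B * T)"
    unfolding w(5) using w(1-3) by (simp add: assoc_mult_mat[of _ n n _ n _ n])
  then have "T * A = B * T"
    using w(1-4) by simp
  then show "B \<in> carrier_mat n n" "\<exists>T \<in> GL n. T * A = B * T"
    using GL_I w by blast+
qed

lemma ex_jordan_data:
  assumes A: "A \<in> carrier_mat n n" and R: "linear_order R"
  shows "\<exists>nas Y. jordan_data R nas \<and> sum_list (map fst nas) = n \<and> Y \<in> GL n \<and> Y * A = jordan_matrix nas * Y"
proof -
  define P :: "nat \<times> complex \<Rightarrow> nat \<times> complex \<Rightarrow> bool" where
    "P = (\<lambda>(p, a) (q, b). q < p \<or> q = p \<and> (a, b) \<in> R)"
  have R': "(a, b) \<in> R \<or> (b, a) \<in> R" "trans R" for a b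
    using R unfolding linear_order_on_def partial_order_on_def preorder_on_def total_on_def refl_on_def
    by (cases "a = b"; auto)+
  obtain nas where nas: "jordan_nf A nas"
    using ex_jordan_nf[OF A] by blast
  have "\<exists>ys. mset ys = mset nas \<and> sorted_wrt P ys"
    by (rule ex_sorted_wrt) (use R' in \<open>auto simp: P_def dest: transD\<close>)
  then obtain ys where ys: "mset ys = mset nas" "sorted_wrt P ys"
    by blast
  then have "set ys = set nas"
    by (metis set_mset_mset)
  then have jd: "jordan_data R ys"
    using nas ys(2) unfolding jordan_data_def jordan_nf_def P_def by simp
  have sim: "similar_mat A (jordan_matrix ys)"
    using similar_mat_trans[OF _ similar_jordan_matrix_mset[OF ys(1)[symmetric]]] nas
    by (simp add: jordan_nf_def)
  then obtain T where "T \<in> GL n" "T * A = jordan_matrix ys * T"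
    using similar_mat_intertwine(2)[OF sim A] by blast
  moreover have "sum_list (map fst ys) = n"
    using similar_mat_intertwine(1)[OF sim A] carrier_matD(1) jordan_matrix_dim(1) by metis
  ultimately show ?thesis
    using jd by blast
qed

section \<open>Idempotent matrices and coordinate projections\<close>

definition corner_one :: "nat \<Rightarrow> nat \<Rightarrow> complex mat" where
  "corner_one r n = mat_diag n (\<lambda>i. of_bool (i < r))"

lemma corner_one_carrier [simp]: "corner_one r n \<in> carrier_mat n n"
  by (simp add: corner_one_def)

lemma corner_one_idem: "corner_one r n * corner_one r n = corner_one r n"
  by (simp add: corner_one_def of_bool_conj[symmetric])

lemma corner_one_eq_0:
  assumes "corner_one r n = 0\<^sub>m n n" "r \<le> n" shows "r = 0"
proof (rule ccontr)
  assume "r \<noteq> 0"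
  then have "corner_one r n $$ (0, 0) = 1"
    using assms(2) by (simp add: corner_one_def mat_diag_def)
  then show False
    using assms \<open>r \<noteq> 0\<close> by simp
qed

lemma corner_one_eq_1:
  assumes "corner_one r n = 1\<^sub>m n" "r \<le> n" shows "r = n"
proof (rule ccontr)
  assume "r \<noteq> n"
  then have "corner_one r n $$ (r, r) = 0" "r < n"
    using assms(2) by (simp_all add: corner_one_def mat_diag_def)
  then show False
    using assms by simp
qed

lemma corner_one_0: "corner_one 0 n = 0\<^sub>m n n"
  by (rule eq_matI) (auto simp: corner_one_def mat_diag_def)

lemma corner_one_n: "corner_one n n = 1\<^sub>m n"
  by (rule eq_matI) (auto simp: corner_one_def mat_diag_def)

lemma diagonal_carrier [simp]: "diagonal xs \<in> carrier_mat (length xs) (length xs)"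
  by (simp add: diagonal_def)

lemma jordan_matrix_diagonal: "jordan_matrix (map (Pair 1) xs) = diagonal xs"
proof (induction xs)
  case Nil
  then show ?case
    by (simp add: jordan_matrix_Nil diagonal_def) (rule eq_matI; simp add: mat_diag_def)
next
  case (Cons x xs)
  show ?case
    unfolding list.map jordan_matrix_Cons_block_sum Cons
    by (rule eq_matI) (auto simp: block_sum_index diagonal_def mat_diag_def less_Suc_eq_0_disj split: if_splits)
qed

text \<open>The diagonal entries of the square are \<open>a * a\<close>, and in a block of size at
  least 2 the entry next to the corner is \<open>2 * a\<close>. It would have to be 1, which fails
  for \<open>a = 0\<close> and for \<open>a = 1\<close>.\<close>

lemma jordan_block_idem:
  assumes "jordan_block k a * jordan_block k a = jordan_block k (a :: complex)" "k \<noteq> 0"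
  shows "k = 1" "a = 0 \<or> a = 1"
proof -
  have e: "(jordan_block k a ^\<^sub>m 2) $$ (i, j) = jordan_block k a $$ (i, j)" for i j
    using assms(1) by (simp add: numeral_2_eq_2)
  have "a * a = a"
    using e[of 0 0] assms(2) by (simp add: jordan_block_pow power2_eq_square)
  then show a: "a = 0 \<or> a = 1"
    by auto
  show "k = 1"
  proof (rule ccontr)
    assume "k \<noteq> 1"
    then have "2 * a = 1"
      using e[of 0 1] assms(2) by (simp add: jordan_block_pow)
    then show False
      using a by auto
  qed
qed

lemma jordan_matrix_idem:
  assumes "jordan_matrix nas * jordan_matrix nas = (jordan_matrix nas :: complex mat)"
    "0 \<notin> fst ` set nas" "x \<in> set nas"
  shows "fst x = 1 \<and> snd x \<in> {0, 1}"
  using assms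
proof (induction nas)
  case Nil
  then show ?case
    by simp
next
  case (Cons y nas)
  let ?J = "jordan_block (fst y) (snd y)"
  have "block_sum (?J * ?J) (jordan_matrix nas * jordan_matrix nas) = block_sum ?J (jordan_matrix nas)"
    using Cons.prems(1) unfolding jordan_matrix_Cons_block_sum
    by (subst (asm) block_sum_mult) (rule jordan_block_carrier jordan_matrix_carrier | assumption)+
  note block_sum_inject[OF this mult_carrier_mat[OF jordan_block_carrier jordan_block_carrier]
      jordan_block_carrier mult_carrier_mat[OF jordan_matrix_carrier jordan_matrix_carrier]
      jordan_matrix_carrier]
  then show ?case
    using Cons jordan_block_idem[of "fst y" "snd y"] by auto
qed

text \<open>All Jordan blocks of an idempotent have size 1 and eigenvalue 0 or 1; listing the ones
  first yields \<open>corner_one r n\<close>, where \<open>r\<close> is the rank.\<close>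

lemma idempotent_diagonalizable:
  assumes P: "P \<in> carrier_mat n n" and idem: "P * P = (P :: complex mat)"
  shows "\<exists>r X. r \<le> n \<and> X \<in> GL n \<and> X * P = corner_one r n * X"
proof -
  obtain nas where nas: "jordan_nf P nas"
    using ex_jordan_nf[OF P] by blast
  let ?J = "jordan_matrix nas"
  obtain k S T where w: "P \<in> carrier_mat k k" "?J \<in> carrier_mat k k" "S \<in> carrier_mat k k" "T \<in> carrier_mat k k"
    "S * T = 1\<^sub>m k" "T * S = 1\<^sub>m k" "?J = S * P * T"
    using similar_matD[OF similar_mat_sym[of P ?J]] nas by (auto simp: jordan_nf_def)
  have "?J * ?J = S * (P * ((T * S) * (P * T)))"
    unfolding w(7) using w(1,3,4) by (simp add: assoc_mult_mat[of _ k k _ k _ k])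
  also have "\<dots> = S * ((P * P) * T)"
    unfolding w(6) using w(1,3,4) by (simp add: assoc_mult_mat[of _ k k _ k _ k])
  also have "\<dots> = ?J"
    unfolding idem w(7) using w(1,3,4) by (simp add: assoc_mult_mat[of _ k k _ k _ k])
  finally have J: "?J * ?J = ?J" .
  define xs where "xs = map snd nas"
  have x: "fst x = 1 \<and> snd x \<in> {0, 1}" if "x \<in> set nas" for x
    using jordan_matrix_idem[OF J _ that] nas by (simp add: jordan_nf_def)
  have nas_xs: "nas = map (Pair 1) xs"
    unfolding xs_def by (simp add: o_def) (rule map_idI[symmetric], use x in force)
  have xs01: "set xs \<subseteq> {0, 1}"
    using x by (auto simp: xs_def)
  define r s where "r = count (mset xs) 1" and "s = count (mset xs) 0"
  have mset: "mset xs = mset (replicate r 1 @ replicate s 0)"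
  proof (rule multiset_eqI)
    fix c
    show "count (mset xs) c = count (mset (replicate r 1 @ replicate s 0)) c"
      using xs01 by (cases "c \<in> {0, 1}") (auto simp: r_def s_def count_eq_zero_iff subset_iff)
  qed
  then have len: "length xs = r + s"
    by (metis length_append length_replicate size_mset)
  have n: "length xs = n"
  proof -
    have "sum_list (map fst (map (Pair 1) ys)) = length ys" for ys :: "complex list"
      by (induction ys) auto
    then have "length xs = sum_list (map fst nas)"
      by (simp only: nas_xs)
    then show ?thesis
      using carrier_matD(1)[OF w(1)] carrier_matD(1)[OF w(2)] carrier_matD(1)[OF P] by simp
  qed
  have "similar_mat ?J (jordan_matrix (map (Pair 1) (replicate r 1 @ replicate s 0)))"
    unfolding nas_xs by (rule similar_jordan_matrix_mset) (simp only: mset_map mset)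
  also have "jordan_matrix (map (Pair 1) (replicate r 1 @ replicate s 0)) = corner_one r n"
    unfolding jordan_matrix_diagonal
    by (rule eq_matI) (use len n in \<open>auto split: if_splits simp: diagonal_def corner_one_def mat_diag_def nth_append\<close>)
  finally have "similar_mat P (corner_one r n)"
    using similar_mat_trans nas unfolding jordan_nf_def by blast
  then obtain T where "T \<in> GL n" "T * P = corner_one r n * T"
    using similar_mat_intertwine(2)[OF _ P] by blast
  then show ?thesis
    using len n by (intro exI[of _ r] exI[of _ T]) auto
qed

lemma block_sum_commutes_corner:
  assumes "A \<in> carrier_mat p q" "B \<in> carrier_mat r s"
  shows "corner_one p (p + r) * block_sum A B = block_sum A B * corner_one q (q + s)"
  unfolding corner_one_def mat_diag_mult_left[OF block_sum_carrier[OF assms]]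
    mat_diag_mult_right[OF block_sum_carrier[OF assms]]
  by (rule eq_matI) (use assms in \<open>auto simp: block_sum_index\<close>)

text \<open>Comparing entries shows that \<open>M\<close> vanishes wherever exactly one of
  \<open>i < r\<close> and \<open>j < s\<close> holds, which are the two off-diagonal
  blocks.\<close>

lemma commutes_corner_block_sum:
  assumes M: "M \<in> carrier_mat n m" and r: "r \<le> n" "s \<le> m"
    and c: "corner_one r n * M = M * corner_one s m"
  shows "\<exists>M1 \<in> carrier_mat r s. \<exists>M2 \<in> carrier_mat (n - r) (m - s). M = block_sum M1 M2"
proof -
  have "of_bool (i < r) * M $$ (i, j) = M $$ (i, j) * of_bool (j < s)" if "i < n" "j < m" for i j
    using arg_cong[OF c, of "\<lambda>N. N $$ (i, j)"] that
    unfolding corner_one_def mat_diag_mult_left[OF M] mat_diag_mult_right[OF M] by simp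
  then have z: "M $$ (i, j) = 0" if "i < n" "j < m" "(i < r) \<noteq> (j < s)" for i j
    using that by (cases "i < r") fastforce+
  let ?M1 = "mat r s (\<lambda>(i, j). M $$ (i, j))"
  let ?M2 = "mat (n - r) (m - s) (\<lambda>(i, j). M $$ (i + r, j + s))"
  have "M = block_sum ?M1 ?M2"
    by (rule eq_matI) (use M r z in \<open>auto simp: block_sum_index\<close>)
  then show ?thesis
    by (metis mat_carrier)
qed

section \<open>Indecomposability and idempotent endomorphisms\<close>

text \<open>These triples are the idempotents of the endomorphism algebra of the system, regarded as
  a representation of the quiver with a loop at the state vertex, an arrow into it and an arrow out
  of it.\<close>

definition idempotent_endo :: "nat \<Rightarrow> nat \<Rightarrow> nat \<Rightarrow> linsys \<Rightarrow> trafo \<Rightarrow> bool" where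
  "idempotent_endo m n l S E \<longleftrightarrow> (case (S, E) of ((A, B, C), (P, Q, T)) \<Rightarrow>
     P \<in> carrier_mat m m \<and> Q \<in> carrier_mat n n \<and> T \<in> carrier_mat l l \<and>
     P * P = P \<and> Q * Q = Q \<and> T * T = T \<and> Q * A = A * Q \<and> Q * B = B * P \<and> T * C = C * Q)"

text \<open>Transport of an endomorphism along an isomorphism: \<open>X\<close> and \<open>Y\<close>
  carry \<open>B\<close> to \<open>B'\<close> and conjugate \<open>P\<close>, \<open>Q\<close> to
  \<open>F\<close>, \<open>E\<close>, so the square for \<open>B\<close> becomes a square for
  \<open>B'\<close>.\<close>

lemma conj_intertwine:
  assumes c: "B \<in> carrier_mat p q" "B' \<in> carrier_mat p q" "P \<in> carrier_mat q q" "Q \<in> carrier_mat p p"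
      "E \<in> carrier_mat p p" "F \<in> carrier_mat q q"
    and g: "X \<in> GL q" "Y \<in> GL p"
    and e: "Y * B = B' * X" "Q * B = B * P" "Y * Q = E * Y" "X * P = F * X"
  shows "E * B' = B' * F"
proof -
  have XY: "X \<in> carrier_mat q q" "Y \<in> carrier_mat p p"
    using g GL_carrier by auto
  have "B' * F * X = B' * (X * P)"
    unfolding e(4) using c XY by (simp add: assoc_mult_mat[of _ p q _ q _ q])
  also have "\<dots> = Y * B * P"
    unfolding e(1) using c XY by (simp add: assoc_mult_mat[of _ p q _ q _ q])
  also have "\<dots> = Y * (Q * B)"
    unfolding e(2) using c XY by (simp add: assoc_mult_mat[of _ p p _ q _ q])
  also have "\<dots> = (Y * Q) * B"
    using c XY by (simp add: assoc_mult_mat[of _ p p _ p _ q])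
  also have "\<dots> = E * (Y * B)"
    unfolding e(3) using c XY by (simp add: assoc_mult_mat[of _ p p _ p _ q])
  also have "\<dots> = E * B' * X"
    unfolding e(1) using c XY by (simp add: assoc_mult_mat[of _ p p _ q _ q])
  finally have "B' * F * X = E * B' * X" .
  moreover have "M * X * inv_mat X = M" if "M \<in> carrier_mat p q" for M
    using that XY inv_mat(2)[OF g(1)] inv_mat_carrier[OF g(1)] by (simp add: assoc_mult_mat[of M p q X q _ q])
  moreover have "B' * F \<in> carrier_mat p q" "E * B' \<in> carrier_mat p q"
    using c by auto
  ultimately show ?thesis
    by metis
qed

text \<open>\<open>P\<close>, \<open>Q\<close>, \<open>T\<close> are diagonalized independently, and
  their ranks \<open>m1\<close>, \<open>n1\<close>, \<open>l1\<close> are the size of the first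
  summand. In the new bases the endomorphism equations say that the three matrices intertwine
  coordinate projections, that is, they are block diagonal.\<close>

lemma decomposable_if_idempotent:
  assumes S: "(A, B, C) \<in> systems m n l" and E: "idempotent_endo m n l (A, B, C) (P, Q, T)"
    and ne0: "\<not> (P = 0\<^sub>m m m \<and> Q = 0\<^sub>m n n \<and> T = 0\<^sub>m l l)"
    and ne1: "\<not> (P = 1\<^sub>m m \<and> Q = 1\<^sub>m n \<and> T = 1\<^sub>m l)"
  shows "\<not> indecomposable m n l (A, B, C)"
proof -
  have s: "A \<in> carrier_mat n n" "B \<in> carrier_mat n m" "C \<in> carrier_mat l n"
    using S by (auto simp: systems_def)
  have e: "P \<in> carrier_mat m m" "Q \<in> carrier_mat n n" "T \<in> carrier_mat l l"
     "P * P = P" "Q * Q = Q" "T * T = T" "Q * A = A * Q" "Q * B = B * P" "T * C = C * Q"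
    using E by (auto simp: idempotent_endo_def)
  obtain m1 X where X: "m1 \<le> m" "X \<in> GL m" "X * P = corner_one m1 m * X"
    using idempotent_diagonalizable[OF e(1,4)] by blast
  obtain n1 Y where Y: "n1 \<le> n" "Y \<in> GL n" "Y * Q = corner_one n1 n * Y"
    using idempotent_diagonalizable[OF e(2,5)] by blast
  obtain l1 Z where Z: "l1 \<le> l" "Z \<in> GL l" "Z * T = corner_one l1 l * Z"
    using idempotent_diagonalizable[OF e(3,6)] by blast
  have t: "(X, Y, Z) \<in> trafos m n l"
    using X Y Z by (simp add: trafos_def)
  obtain A' B' C' where a: "act (X, Y, Z) (A, B, C) = (A', B', C')"
    by (metis prod_cases3)
  have S': "(A', B', C') \<in> systems m n l"
    using act_closed[OF t S] a by simp
  then have s': "A' \<in> carrier_mat n n" "B' \<in> carrier_mat n m" "C' \<in> carrier_mat l n"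
    by (auto simp: systems_def)
  have i: "Y * A = A' * Y" "Y * B = B' * X" "Z * C = C' * Y"
    using act_eq_iff[OF t S S'] a by auto
  have "corner_one n1 n * A' = A' * corner_one n1 n"
    by (rule conj_intertwine[OF s(1) s'(1) e(2) e(2) _ _ Y(2) Y(2) i(1) e(7) Y(3) Y(3)]) auto
  then obtain A1 A2 where A12: "A1 \<in> carrier_mat n1 n1" "A2 \<in> carrier_mat (n - n1) (n - n1)"
      "A' = block_sum A1 A2"
    using commutes_corner_block_sum[OF s'(1) Y(1) Y(1)] by blast
  have "corner_one n1 n * B' = B' * corner_one m1 m"
    by (rule conj_intertwine[OF s(2) s'(2) e(1) e(2) _ _ X(2) Y(2) i(2) e(8) Y(3) X(3)]) auto
  then obtain B1 B2 where B12: "B1 \<in> carrier_mat n1 m1" "B2 \<in> carrier_mat (n - n1) (m - m1)"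
      "B' = block_sum B1 B2"
    using commutes_corner_block_sum[OF s'(2) Y(1) X(1)] by blast
  have "corner_one l1 l * C' = C' * corner_one n1 n"
    by (rule conj_intertwine[OF s(3) s'(3) e(2) e(3) _ _ Y(2) Z(2) i(3) e(9) Z(3) Y(3)]) auto
  then obtain C1 C2 where C12: "C1 \<in> carrier_mat l1 n1" "C2 \<in> carrier_mat (l - l1) (n - n1)"
      "C' = block_sum C1 C2"
    using commutes_corner_block_sum[OF s'(3) Z(1) Y(1)] by blast
  \<comment> \<open>A matrix conjugate to 0 is 0, and below likewise for 1. Hence the ranks are all
    zero, or all full, only for the two endomorphisms that are excluded.\<close>
  have cancel: "W = 0\<^sub>m k k" if "U \<in> GL k" "W \<in> carrier_mat k k" "U * W = 0\<^sub>m k k * U" for U W k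
  proof -
    have c: "U \<in> carrier_mat k k" "inv_mat U \<in> carrier_mat k k"
      using that(1) GL_carrier inv_mat_carrier by auto
    have "inv_mat U * U * W = inv_mat U * (U * W)"
      using c that(2) by simp
    then show ?thesis
      unfolding that(3) using c that(2) inv_mat(3)[OF that(1)] by simp
  qed
  have cancel1: "W = 1\<^sub>m k" if "U \<in> GL k" "W \<in> carrier_mat k k" "U * W = 1\<^sub>m k * U" for U W k
  proof -
    have c: "U \<in> carrier_mat k k" "inv_mat U \<in> carrier_mat k k"
      using that(1) GL_carrier inv_mat_carrier by auto
    have "inv_mat U * U * W = inv_mat U * (U * W)"
      using c that(2) by simp
    then show ?thesis
      unfolding that(3) using c that(2) inv_mat(3)[OF that(1)] by simp
  qed
  have "(m1, n1, l1) \<noteq> (0, 0, 0)"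
    using ne0 cancel[OF X(2) e(1)] cancel[OF Y(2) e(2)] cancel[OF Z(2) e(3)] X(3) Y(3) Z(3)
    by (auto simp: corner_one_0)
  moreover have "(m - m1, n - n1, l - l1) \<noteq> (0, 0, 0)"
  proof
    assume "(m - m1, n - n1, l - l1) = (0, 0, 0)"
    then have "m1 = m" "n1 = n" "l1 = l"
      using X(1) Y(1) Z(1) by auto
    then show False
      using ne1 cancel1[OF X(2) e(1)] cancel1[OF Y(2) e(2)] cancel1[OF Z(2) e(3)] X(3) Y(3) Z(3)
      by (auto simp: corner_one_n)
  qed
  moreover have "equivalent m n l (A, B, C) (Defs.direct_sum (A1, B1, C1) (A2, B2, C2))"
    unfolding equivalent_def using S S' t a A12(3) B12(3) C12(3) by (metis Defs.direct_sum.simps)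
  moreover have "(A1, B1, C1) \<in> systems m1 n1 l1" "(A2, B2, C2) \<in> systems (m - m1) (n - n1) (l - l1)"
    using A12 B12 C12 by (auto simp: systems_def)
  ultimately show ?thesis
    unfolding indecomposable_def by blast
qed

text \<open>The projections of a direct sum onto its first summand form a nontrivial idempotent
  endomorphism; pulled back along the equivalence, it contradicts \<open>triv\<close>.\<close>

lemma indecomposableI:
  assumes S: "(A, B, C) \<in> systems m n l"
    and triv: "\<And>P Q T. idempotent_endo m n l (A, B, C) (P, Q, T) \<Longrightarrow>
      P = 0\<^sub>m m m \<and> Q = 0\<^sub>m n n \<and> T = 0\<^sub>m l l \<or> P = 1\<^sub>m m \<and> Q = 1\<^sub>m n \<and> T = 1\<^sub>m l"
  shows "indecomposable m n l (A, B, C)"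
proof (rule ccontr)
  assume "\<not> ?thesis"
  then obtain m1 n1 l1 m2 n2 l2 S1 S2 where d: "S1 \<in> systems m1 n1 l1" "(m1, n1, l1) \<noteq> (0, 0, 0)"
      "S2 \<in> systems m2 n2 l2" "(m2, n2, l2) \<noteq> (0, 0, 0)"
      "equivalent m n l (A, B, C) (Defs.direct_sum S1 S2)"
    unfolding indecomposable_def by blast
  obtain A1 B1 C1 A2 B2 C2 where S12: "S1 = (A1, B1, C1)" "S2 = (A2, B2, C2)"
    by (metis prod_cases3)
  have c1: "A1 \<in> carrier_mat n1 n1" "B1 \<in> carrier_mat n1 m1" "C1 \<in> carrier_mat l1 n1"
    "A2 \<in> carrier_mat n2 n2" "B2 \<in> carrier_mat n2 m2" "C2 \<in> carrier_mat l2 n2"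
    using d(1,3) by (auto simp: S12 systems_def)
  have S': "(block_sum A1 A2, block_sum B1 B2, block_sum C1 C2) \<in> systems m n l"
    using d(5) by (auto simp: equivalent_def S12)
  then have "dim_row (block_sum A1 A2) = n" "dim_col (block_sum B1 B2) = m" "dim_row (block_sum C1 C2) = l"
    unfolding systems_def by auto
  then have mnl: "m = m1 + m2" "n = n1 + n2" "l = l1 + l2"
    using c1 by auto
  have s: "A \<in> carrier_mat n n" "B \<in> carrier_mat n m" "C \<in> carrier_mat l n"
    using S by (auto simp: systems_def)
  obtain X Y Z where t: "(X, Y, Z) \<in> trafos m n l"
      "act (X, Y, Z) (A, B, C) = (block_sum A1 A2, block_sum B1 B2, block_sum C1 C2)"
    using d(5) unfolding equivalent_def S12 Defs.direct_sum.simps by (metis prod_cases3)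
  have i: "Y * A = block_sum A1 A2 * Y" "Y * B = block_sum B1 B2 * X" "Z * C = block_sum C1 C2 * Y"
    using act_eq_iff[OF t(1) S S'] t(2) by auto
  have g: "X \<in> GL m" "Y \<in> GL n" "Z \<in> GL l"
    using t(1) by (auto simp: trafos_def)
  define conj where "conj = (\<lambda>U E. inv_mat U * E * U)"
  have conj: "conj U E \<in> carrier_mat k k" "conj U E * conj U E = conj U (E * E)"
      "conj U E * inv_mat U = inv_mat U * E" "inv_mat U * E = conj U E * inv_mat U" "U * conj U E = E * U"
    if "U \<in> GL k" "E \<in> carrier_mat k k" for U E k
  proof -
    have c: "U \<in> carrier_mat k k" "inv_mat U \<in> carrier_mat k k"
      using that(1) GL_carrier inv_mat_carrier by auto
    show "conj U E \<in> carrier_mat k k"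
      using c that by (simp add: conj_def)
    show "conj U E * inv_mat U = inv_mat U * E"
      using c that inv_mat(2)[OF that(1)] by (simp add: conj_def assoc_mult_mat[of _ k k _ k _ k])
    then show "inv_mat U * E = conj U E * inv_mat U"
      by simp
    show "U * conj U E = E * U"
    proof -
      have "U * conj U E = (U * inv_mat U) * (E * U)"
        unfolding conj_def using c that(2) by (simp add: assoc_mult_mat[of _ k k _ k _ k])
      then show ?thesis
        using inv_mat(2)[OF that(1)] c that(2) by simp
    qed
    have "conj U E * conj U E = inv_mat U * (E * ((U * inv_mat U) * (E * U)))"
      unfolding conj_def using c that(2) by (simp add: assoc_mult_mat[of _ k k _ k _ k])
    then show "conj U E * conj U E = conj U (E * E)"
      unfolding conj_def using c that inv_mat(2)[OF that(1)]
      by (simp add: assoc_mult_mat[of _ k k _ k _ k])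
  qed
  \<comment> \<open>\<open>conj_intertwine\<close> is applied to the inverse transformation, so the
    square \<open>V * M = M' * U\<close> has to be reversed before use.\<close>
  have inter: "conj V E * M = M * conj U F"
    if "U \<in> GL q" "V \<in> GL p" "E \<in> carrier_mat p p" "F \<in> carrier_mat q q"
      "M \<in> carrier_mat p q" "M' \<in> carrier_mat p q" "V * M = M' * U" "E * M' = M' * F" for U V E F M M' p q
  proof -
    have c: "U \<in> carrier_mat q q" "inv_mat U \<in> carrier_mat q q" "V \<in> carrier_mat p p" "inv_mat V \<in> carrier_mat p p"
      using that(1,2) GL_carrier inv_mat_carrier by auto
    have "M = inv_mat V * V * M"
      using inv_mat(3)[OF that(2)] that(5) by simp
    also have "\<dots> = inv_mat V * (M' * U)"
      unfolding that(7)[symmetric] using c that(5) by (simp add: assoc_mult_mat[of _ p p _ p _ q])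
    finally have "M * inv_mat U = inv_mat V * (M' * (U * inv_mat U))"
      using c that(6) by (simp add: assoc_mult_mat[of _ p p _ q _ q] assoc_mult_mat[of _ p q _ q _ q])
    then have M: "inv_mat V * M' = M * inv_mat U"
      using inv_mat(2)[OF that(1)] that(6) by simp
    show ?thesis
      by (rule conj_intertwine[OF that(6,5,4,3) conj(1)[OF that(2,3)] conj(1)[OF that(1,4)]
            inv_mat(1)[OF that(1)] inv_mat(1)[OF that(2)] M that(8) conj(4)[OF that(2,3)]
            conj(4)[OF that(1,4)]])
  qed
  let ?P = "conj X (corner_one m1 m)" and ?Q = "conj Y (corner_one n1 n)" and ?T = "conj Z (corner_one l1 l)"
  have c2: "block_sum A1 A2 \<in> carrier_mat n n" "block_sum B1 B2 \<in> carrier_mat n m" "block_sum C1 C2 \<in> carrier_mat l n"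
    using S' by (auto simp: systems_def)
  have "?Q * A = A * ?Q" "?Q * B = B * ?P" "?T * C = C * ?Q"
    using inter[OF g(2,2) _ _ s(1) c2(1) i(1)] inter[OF g(1,2) _ _ s(2) c2(2) i(2)]
      inter[OF g(2,3) _ _ s(3) c2(3) i(3)] block_sum_commutes_corner c1 unfolding mnl
    by (metis corner_one_carrier)+
  then have "idempotent_endo m n l (A, B, C) (?P, ?Q, ?T)"
    using conj(1,2) g by (auto simp: idempotent_endo_def corner_one_idem)
  from triv[OF this] show False
  proof (elim disjE conjE)
    assume z: "?P = 0\<^sub>m m m" "?Q = 0\<^sub>m n n" "?T = 0\<^sub>m l l"
    have "E = 0\<^sub>m k k" if "U \<in> GL k" "E \<in> carrier_mat k k" "conj U E = 0\<^sub>m k k" for U E k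
    proof -
      have c: "U \<in> carrier_mat k k" "inv_mat U \<in> carrier_mat k k"
        using that(1) GL_carrier inv_mat_carrier by auto
      have "E * U * inv_mat U = U * 0\<^sub>m k k * inv_mat U"
        using conj(5)[OF that(1,2)] unfolding that(3) by simp
      then show ?thesis
        using c that(2) inv_mat(2)[OF that(1)] by (simp add: assoc_mult_mat[of _ k k _ k _ k])
    qed
    then have "corner_one m1 m = 0\<^sub>m m m" "corner_one n1 n = 0\<^sub>m n n" "corner_one l1 l = 0\<^sub>m l l"
      using g z by auto
    then show False
      using corner_one_eq_0 mnl d(2) by fastforce
  next
    assume z: "?P = 1\<^sub>m m" "?Q = 1\<^sub>m n" "?T = 1\<^sub>m l"
    have "E = 1\<^sub>m k" if "U \<in> GL k" "E \<in> carrier_mat k k" "conj U E = 1\<^sub>m k" for U E k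
    proof -
      have c: "U \<in> carrier_mat k k" "inv_mat U \<in> carrier_mat k k"
        using that(1) GL_carrier inv_mat_carrier by auto
      have "E * U * inv_mat U = U * 1\<^sub>m k * inv_mat U"
        using conj(5)[OF that(1,2)] unfolding that(3) by simp
      then show ?thesis
        using c that(2) inv_mat(2)[OF that(1)] by (simp add: assoc_mult_mat[of _ k k _ k _ k])
    qed
    then have "corner_one m1 m = 1\<^sub>m m" "corner_one n1 n = 1\<^sub>m n" "corner_one l1 l = 1\<^sub>m l"
      using g z by auto
    then show False
      using corner_one_eq_1 mnl d(4) by fastforce
  qed
qed

section \<open>Belitskii's algorithm for triangular groups\<close>

definition trafo_group :: "nat \<Rightarrow> nat \<Rightarrow> nat \<Rightarrow> trafo set \<Rightarrow> bool" where
  "trafo_group m n l G \<longleftrightarrow> G \<subseteq> trafos m n l \<and> trafo_one m n l \<in> G \<and>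
     (\<forall>g \<in> G. \<forall>h \<in> G. trafo_mult g h \<in> G) \<and> (\<forall>g \<in> G. trafo_inv g \<in> G)"

fun triangular_trafo :: "trafo \<Rightarrow> bool" where
  "triangular_trafo (X, Y, Z) \<longleftrightarrow> upper_triangular X \<and> upper_triangular Y \<and> upper_triangular Z"

type_synonym pos = "nat \<times> nat + nat \<times> nat"

fun entry :: "pos \<Rightarrow> linsys \<Rightarrow> complex" where
  "entry (Inl p) (A, B, C) = B $$ p"
| "entry (Inr p) (A, B, C) = C $$ p"

text \<open>The order in which the algorithm visits the entries of a matrix.\<close>

definition grid :: "nat \<Rightarrow> nat \<Rightarrow> (nat \<times> nat) list" where
  "grid p q = concat (map (\<lambda>i. map (Pair i) [0..<q]) (rev [0..<p]))"

definition positions :: "nat \<Rightarrow> nat \<Rightarrow> nat \<Rightarrow> pos list" where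
  "positions m n l = map Inl (grid n m) @ map Inr (grid l n)"

definition scalar_mat :: "complex \<Rightarrow> complex mat" where
  "scalar_mat c = mat 1 1 (\<lambda>_. c)"

lemma scalar_mat_inject [simp]: "scalar_mat c = scalar_mat d \<longleftrightarrow> c = d"
proof
  assume "scalar_mat c = scalar_mat d"
  then have "scalar_mat c $$ (0, 0) = scalar_mat d $$ (0, 0)"
    by simp
  then show "c = d"
    by (simp add: scalar_mat_def)
qed simp

lemma set_grid: "set (grid p q) = {..<p} \<times> {..<q}"
  by (auto simp: grid_def)

text \<open>Upper triangular matrices preserve the span of every initial segment of the basis, so
  every cut is made.\<close>

lemma strips_triangular:
  assumes "\<And>g. g \<in> G \<Longrightarrow> g \<in> carrier_mat k k \<and> upper_triangular g"
  shows "strips [0..<k] G = map (\<lambda>i. [i]) [0..<k]"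
proof -
  have "flag_invariant [0..<k] G b" for b
    using assms by (fastforce simp: flag_invariant_def upper_triangular_def)
  then have f: "filter (flag_invariant [0..<k] G) [0..<Suc (length [0..<k])] = [0..<Suc k]"
    by (simp add: filter_id_conv del: upt_Suc)
  show ?thesis
    unfolding strips_def f Let_def
    by (rule nth_equalityI) (auto simp: nth_tl drop_take take_Suc_conv_app_nth simp del: upt_Suc
        intro!: nth_equalityI)
qed

text \<open>This holds for every set of triangular transformations, so the list of blocks does not
  change while the group shrinks. A run can therefore be followed by a position in one fixed
  list.\<close>

lemma blocks_triangular:
  assumes "G \<subseteq> trafos m n l" "\<And>g. g \<in> G \<Longrightarrow> triangular_trafo g"
  shows "blocks m l [0..<n] G = map (\<lambda>p S. scalar_mat (entry p S)) (positions m n l)"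
proof -
  have "g \<in> carrier_mat m m \<and> upper_triangular g" if "g \<in> (\<lambda>(X, Y, Z). X) ` G" for g
    using that assms GL_carrier by (fastforce simp: trafos_def)
  then have X: "strips [0..<m] ((\<lambda>(X, Y, Z). X) ` G) = map (\<lambda>i. [i]) [0..<m]"
    by (rule strips_triangular)
  have "g \<in> carrier_mat n n \<and> upper_triangular g" if "g \<in> (\<lambda>(X, Y, Z). Y) ` G" for g
    using that assms GL_carrier by (fastforce simp: trafos_def)
  then have Y: "strips [0..<n] ((\<lambda>(X, Y, Z). Y) ` G) = map (\<lambda>i. [i]) [0..<n]"
    by (rule strips_triangular)
  have "g \<in> carrier_mat l l \<and> upper_triangular g" if "g \<in> (\<lambda>(X, Y, Z). Z) ` G" for g
    using that assms GL_carrier by (fastforce simp: trafos_def)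
  then have Z: "strips [0..<l] ((\<lambda>(X, Y, Z). Z) ` G) = map (\<lambda>i. [i]) [0..<l]"
    by (rule strips_triangular)
  have b: "(\<lambda>(A, B, C). block_of [i] [j] B) = (\<lambda>S. scalar_mat (entry (Inl (i, j)) S))"
    "(\<lambda>(A, B, C). block_of [i] [j] C) = (\<lambda>S. scalar_mat (entry (Inr (i, j)) S))" for i j
    by (auto simp: fun_eq_iff block_of_def scalar_mat_def intro!: eq_matI)
  show ?thesis
    unfolding blocks_def Let_def X Y Z
      positions_def grid_def
    by (simp add: map_concat rev_map o_def b del: upt_Suc)
qed

text \<open>For a 1 x 1 block the parameter \<open>r\<close> is 0 or 1, and these two values give
  the entries 0 and 1.\<close>

lemma rank_form_scalar_mat: "rank_form (scalar_mat c) \<longleftrightarrow> c = 0 \<or> c = 1"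
proof
  assume "rank_form (scalar_mat c)"
  then obtain r p q where e: "scalar_mat c = four_block_mat (0\<^sub>m r p) (1\<^sub>m r) (0\<^sub>m q p) (0\<^sub>m q r)"
    by (auto simp: rank_form_def)
  have "r + q = 1" "p + r = 1"
    using arg_cong[OF e, of dim_row] arg_cong[OF e, of dim_col] by (auto simp: scalar_mat_def)
  moreover have "c = four_block_mat (0\<^sub>m r p) (1\<^sub>m r) (0\<^sub>m q p) (0\<^sub>m q r) $$ (0, 0)"
    unfolding e[symmetric] by (simp add: scalar_mat_def)
  ultimately show "c = 0 \<or> c = 1"
    by (cases r) auto
next
  have "scalar_mat 0 = four_block_mat (0\<^sub>m 0 1) (1\<^sub>m 0) (0\<^sub>m 1 1) (0\<^sub>m 1 0)"
    "scalar_mat 1 = four_block_mat (0\<^sub>m 1 0) (1\<^sub>m 1) (0\<^sub>m 0 0) (0\<^sub>m 0 1)"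
    by (auto simp: scalar_mat_def intro!: eq_matI)
  moreover assume "c = 0 \<or> c = 1"
  ultimately show "rank_form (scalar_mat c)"
    unfolding rank_form_def by metis
qed

lemma zero_form_scalar_mat: "zero_form (scalar_mat c) \<longleftrightarrow> c = 0"
proof -
  have "0\<^sub>m (dim_row (scalar_mat c)) (dim_col (scalar_mat c)) = scalar_mat 0"
    by (auto simp: scalar_mat_def intro!: eq_matI)
  then show ?thesis
    by (simp add: zero_form_def)
qed

text \<open>Zero is taken whenever it is attainable, and otherwise 1 if that is attainable; the
  assumption on \<open>c\<close> covers exactly these two branches, so the Weyr form is not
  consulted.\<close>

lemma reduced_scalar_block:
  assumes "c \<in> V" "c = 0 \<or> c = 1 \<and> 0 \<notin> V"
  shows "reduced_block R (scalar_mat ` V) (scalar_mat d) \<longleftrightarrow> d = c"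
  using assms unfolding reduced_block_def by (auto simp: zero_form_scalar_mat rank_form_scalar_mat)

text \<open>The entries of the old system on which an entry of the transformed system depends.\<close>

definition preceq :: "pos \<Rightarrow> pos \<Rightarrow> bool" where
  "preceq q p \<longleftrightarrow> (case (q, p) of
     (Inl (i', j'), Inl (i, j)) \<Rightarrow> i \<le> i' \<and> j' \<le> j
   | (Inr (i', j'), Inr (i, j)) \<Rightarrow> i \<le> i' \<and> j' \<le> j
   | _ \<Rightarrow> False)"

lemma sorted_wrt_concat_map:
  assumes "\<And>x. sorted_wrt P (f x)" "sorted_wrt (\<lambda>x y. \<forall>a \<in> set (f x). \<forall>b \<in> set (f y). P a b) xs"
  shows "sorted_wrt P (concat (map f xs))"
  using assms(2) by (induction xs) (auto simp: sorted_wrt_append assms(1))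

text \<open>Rows are visited from the bottom and each row from the left, so the visiting order is a
  linear extension of \<open>preceq\<close>, under which entries of \<open>B\<close> and of
  \<open>C\<close> are incomparable.\<close>

lemma positions_order:
  assumes "i < length (positions m n l)" "k < length (positions m n l)"
    "preceq (positions m n l ! i) (positions m n l ! k)"
  shows "i \<le> k"
proof -
  have u: "sorted_wrt P [0..<k]" if "\<And>x y. x < y \<Longrightarrow> P x y" for P and k :: nat
    by (rule sorted_wrt_mono_rel[OF _ sorted_wrt_upt]) (use that in auto)
  have g: "sorted_wrt (\<lambda>x y. fst x \<le> fst y \<longrightarrow> \<not> snd y \<le> snd x) (grid p q)" for p q
    unfolding grid_def
    by (rule sorted_wrt_concat_map) (auto simp: sorted_wrt_map sorted_wrt_rev intro!: u)
  have "sorted_wrt (\<lambda>p q. \<not> preceq q p) (positions m n l)"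
    unfolding positions_def sorted_wrt_append sorted_wrt_map
    using g by (auto simp: preceq_def case_prod_beta)
  then show ?thesis
    using assms by (metis linorder_not_less sorted_wrt_nth_less)
qed

lemma mult_mat_index:
  assumes "A \<in> carrier_mat p q" "B \<in> carrier_mat q r" "i < p" "j < r"
  shows "(A * B) $$ (i, j) = (\<Sum>k = 0..<q. A $$ (i, k) * B $$ (k, j))"
  using assms by (auto simp: scalar_prod_def)

text \<open>\<open>Y $$ (i, a)\<close> vanishes for \<open>a < i\<close> and
  \<open>X $$ (c, j)\<close> for \<open>c > j\<close>; only entries weakly below and weakly to the
  left contribute.\<close>

lemma triangular_mult_cong:
  assumes Y: "Y \<in> carrier_mat p p" "upper_triangular Y" and X: "X \<in> carrier_mat q q" "upper_triangular X"
    and B: "B \<in> carrier_mat p q" "B' \<in> carrier_mat p q" and ij: "i < p" "j < q"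
    and eq: "\<And>a c. i \<le> a \<Longrightarrow> a < p \<Longrightarrow> c \<le> j \<Longrightarrow> B $$ (a, c) = B' $$ (a, c)"
  shows "(Y * B * X) $$ (i, j) = ((Y * B' * X) $$ (i, j) :: complex)"
proof -
  have e: "(Y * D * X) $$ (i, j) = (\<Sum>c = 0..<q. (\<Sum>a = 0..<p. Y $$ (i, a) * D $$ (a, c)) * X $$ (c, j))"
    if "D \<in> carrier_mat p q" for D
    unfolding mult_mat_index[OF mult_carrier_mat[OF Y(1) that] X(1) ij]
    by (intro sum.cong refl) (simp only: mult_mat_index[OF Y(1) that ij(1)] atLeastLessThan_iff)
  have "(\<Sum>a = 0..<p. Y $$ (i, a) * B $$ (a, c)) * X $$ (c, j) =
      (\<Sum>a = 0..<p. Y $$ (i, a) * B' $$ (a, c)) * X $$ (c, j)" if "c < q" for c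
  proof (cases "c \<le> j")
    case True
    have "(\<Sum>a = 0..<p. Y $$ (i, a) * B $$ (a, c)) = (\<Sum>a = 0..<p. Y $$ (i, a) * B' $$ (a, c))"
    proof (rule sum.cong[OF refl])
      fix a assume "a \<in> {0..<p}"
      then show "Y $$ (i, a) * B $$ (a, c) = Y $$ (i, a) * B' $$ (a, c)"
        using eq[of a c] True Y ij by (cases "i \<le> a") (auto simp: upper_triangular_def)
    qed
    then show ?thesis
      by simp
  next
    case False
    then show ?thesis
      using X that by (simp add: upper_triangular_def)
  qed
  then show ?thesis
    unfolding e[OF B(1)] e[OF B(2)] by (intro sum.cong) auto
qed

text \<open>The action multiplies by \<open>inv_mat X\<close> and \<open>inv_mat Y\<close> on the
  right, which is why triangularity of the inverse is demanded. For a group of triangular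
  transformations it follows from closure under inverses.\<close>

lemma entry_act_cong:
  assumes g: "g \<in> trafos m n l" "triangular_trafo g" "triangular_trafo (trafo_inv g)"
    and S: "S \<in> systems m n l" "S' \<in> systems m n l" and p: "p \<in> set (positions m n l)"
    and eq: "\<And>q. q \<in> set (positions m n l) \<Longrightarrow> preceq q p \<Longrightarrow> entry q S = entry q S'"
  shows "entry p (act g S) = entry p (act g S')"
proof -
  obtain X Y Z A B C A' B' C' where e: "g = (X, Y, Z)" "S = (A, B, C)" "S' = (A', B', C')"
    by (metis prod_cases3)
  have c: "X \<in> carrier_mat m m" "Y \<in> carrier_mat n n" "Z \<in> carrier_mat l l"
    "inv_mat X \<in> carrier_mat m m" "inv_mat Y \<in> carrier_mat n n"
    using g(1) GL_carrier inv_mat_carrier by (auto simp: trafos_def e)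
  have s: "B \<in> carrier_mat n m" "C \<in> carrier_mat l n" "B' \<in> carrier_mat n m" "C' \<in> carrier_mat l n"
    using S by (auto simp: systems_def e)
  have t: "upper_triangular Y" "upper_triangular Z" "upper_triangular (inv_mat X)" "upper_triangular (inv_mat Y)"
    using g(2,3) by (auto simp: e)
  show ?thesis
  proof (cases p)
    case (Inl ij)
    obtain i j where ij: "ij = (i, j)"
      by (cases ij)
    have r: "i < n" "j < m"
      using p by (auto simp: Inl ij positions_def set_grid)
    have "(Y * B * inv_mat X) $$ (i, j) = (Y * B' * inv_mat X) $$ (i, j)"
    proof (rule triangular_mult_cong[OF c(2) t(1) c(4) t(3) s(1,3) r])
      fix a b assume "i \<le> a" "a < n" "b \<le> j"
      then show "B $$ (a, b) = B' $$ (a, b)"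
        using eq[of "Inl (a, b)"] r by (auto simp: e Inl ij positions_def set_grid preceq_def)
    qed
    then show ?thesis
      by (simp add: e Inl ij)
  next
    case (Inr ij)
    obtain i j where ij: "ij = (i, j)"
      by (cases ij)
    have r: "i < l" "j < n"
      using p by (auto simp: Inr ij positions_def set_grid)
    have "(Z * C * inv_mat Y) $$ (i, j) = (Z * C' * inv_mat Y) $$ (i, j)"
    proof (rule triangular_mult_cong[OF c(3) t(2) c(5) t(4) s(2,4) r])
      fix a b assume "i \<le> a" "a < l" "b \<le> j"
      then show "C $$ (a, b) = C' $$ (a, b)"
        using eq[of "Inr (a, b)"] r by (auto simp: e Inr ij positions_def set_grid preceq_def)
    qed
    then show ?thesis
      by (simp add: e Inr ij)
  qed
qed

lemma systems_eqI:
  assumes "S \<in> systems m n l" "S' \<in> systems m n l" "fst S = fst S'"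
    "\<And>p. p \<in> set (positions m n l) \<Longrightarrow> entry p S = entry p S'"
  shows "S = S'"
proof -
  obtain A B C A' B' C' where e: "S = (A, B, C)" "S' = (A', B', C')"
    by (metis prod_cases3)
  have s: "B \<in> carrier_mat n m" "C \<in> carrier_mat l n" "B' \<in> carrier_mat n m" "C' \<in> carrier_mat l n"
    using assms(1,2) by (auto simp: systems_def e)
  have "B $$ (i, j) = B' $$ (i, j)" if "i < n" "j < m" for i j
    using assms(4)[of "Inl (i, j)"] that by (auto simp: e positions_def set_grid)
  moreover have "C $$ (i, j) = C' $$ (i, j)" if "i < l" "j < n" for i j
    using assms(4)[of "Inr (i, j)"] that by (auto simp: e positions_def set_grid)
  ultimately have "B = B'" "C = C'"
    using s by (auto intro!: eq_matI)
  then show ?thesis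
    using assms(3) e by simp
qed

text \<open>
  \<open>a\<close> is the entry of the normal form, \<open>b\<close> an entry that the remaining group can put in its place.
\<close>

definition reduced_entry :: "complex \<Rightarrow> complex \<Rightarrow> bool" where
  "reduced_entry a b \<longleftrightarrow> a = 0 \<or> b = a \<or> a = 1 \<and> b \<noteq> 0"

lemma trafo_groupD:
  assumes "trafo_group m n l G"
  shows "g \<in> G \<Longrightarrow> g \<in> trafos m n l" "g \<in> G \<Longrightarrow> h \<in> G \<Longrightarrow> trafo_mult g h \<in> G" "g \<in> G \<Longrightarrow> trafo_inv g \<in> G"
    "trafo_one m n l \<in> G"
  using assms by (auto simp: trafo_group_def)

text \<open>Every intermediate system is \<open>act h N\<close> for some \<open>h\<close>. The
  assumption \<open>normal\<close> speaks only about the first position where such a system may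
  differ from \<open>N\<close>; this already forces the reduced value there to be the entry of
  \<open>N\<close>, whichever \<open>g\<close> the step picks.\<close>

lemma triangular_run:
  assumes G: "trafo_group m n l G" and tri: "\<And>g. g \<in> G \<Longrightarrow> triangular_trafo g"
    and N: "N \<in> systems m n l" and fixA: "\<And>g. g \<in> G \<Longrightarrow> fst (act g N) = fst N"
    and normal: "\<And>g k. g \<in> G \<Longrightarrow> k < length (positions m n l) \<Longrightarrow>
      (\<forall>i < k. entry (positions m n l ! i) (act g N) = entry (positions m n l ! i) N) \<Longrightarrow>
      reduced_entry (entry (positions m n l ! k) N) (entry (positions m n l ! k) (act g N))"
    and h: "h \<in> G"
  shows "belitskii_run R m l [0..<n] G (act h N) N' \<longleftrightarrow> N' = N"
proof -
  define len where "len = length (positions m n l)"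
  define e where "e = (\<lambda>i S. entry (positions m n l ! i) S)"
  define F where "F = (\<lambda>k. {g \<in> G. \<forall>i < k. e i (act g N) = e i N})"
  note grp = trafo_groupD[OF G]
  have am: "act g (act h N) = act (trafo_mult g h) N" if "g \<in> G" "h \<in> G" for g h
    using act_mult grp(1) that N by blast
  have ai: "act (trafo_inv g) (act g N) = N" "act g (act (trafo_inv g) N) = N" if "g \<in> G" for g
    using act_inv grp(1) that N by blast+
  have sys: "act g N \<in> systems m n l" if "g \<in> G" for g
    using act_closed grp(1) that N by blast
  have cong: "e k (act g (act h N)) = e k (act g (act h' N))"
    if "g \<in> G" "h \<in> G" "h' \<in> G" "k < len" "\<And>i. i \<le> k \<Longrightarrow> e i (act h N) = e i (act h' N)" for g h h' k
    unfolding e_def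
  proof (rule entry_act_cong)
    show "g \<in> trafos m n l" "triangular_trafo g" "triangular_trafo (trafo_inv g)"
      using grp(1,3) tri that(1) by auto
    show "act h N \<in> systems m n l" "act h' N \<in> systems m n l"
      using sys that by auto
    show "positions m n l ! k \<in> set (positions m n l)"
      using that(4) by (simp add: len_def)
    fix q assume q: "q \<in> set (positions m n l)" "preceq q (positions m n l ! k)"
    then obtain i where i: "i < len" "q = positions m n l ! i"
      by (metis in_set_conv_nth len_def)
    then have "i \<le> k"
      using positions_order q(2) that(4) by (simp add: len_def)
    then show "entry q (act h N) = entry q (act h' N)"
      using that(5) i(2) by (simp add: e_def)
  qed
  have one: "act (trafo_one m n l) N = N"
    using act_one N by blast
  have cong1: "e k (act g (act h N)) = e k (act g N)"
    if "g \<in> G" "h \<in> G" "k < len" "\<And>i. i \<le> k \<Longrightarrow> e i (act h N) = e i N" for g h k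
    using cong[OF that(1,2) grp(4) that(3)] that(4) unfolding one by simp
  have F_mult: "trafo_mult g h \<in> F k" if "g \<in> F k" "h \<in> F k" "k \<le> len" for g h k
  proof -
    have gh: "g \<in> G" "h \<in> G"
      using that by (auto simp: F_def)
    have "e i (act (trafo_mult g h) N) = e i N" if "i < k" for i
      using cong1[OF gh, of i] \<open>g \<in> F k\<close> \<open>h \<in> F k\<close> that \<open>k \<le> len\<close> by (simp add: F_def am[OF gh, symmetric])
    then show ?thesis
      using grp(2)[OF gh] by (simp add: F_def)
  qed
  have F_inv: "trafo_inv g \<in> F k" if "g \<in> F k" "k \<le> len" for g k
  proof -
    have g: "g \<in> G"
      using that by (auto simp: F_def)
    have "e i (act (trafo_inv g) N) = e i N" if "i < k" for i
      using cong1[OF grp(3)[OF g] g, of i] \<open>g \<in> F k\<close> that \<open>k \<le> len\<close> by (simp add: F_def ai[OF g])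
    then show ?thesis
      using grp(3)[OF g] by (simp add: F_def)
  qed
  have FG: "g \<in> G" if "g \<in> F k" for g k
    using that by (simp add: F_def)
  have blocks: "blocks m l [0..<n] (F k) = map (\<lambda>p S. scalar_mat (entry p S)) (positions m n l)" for k
    by (rule blocks_triangular) (use FG grp(1) tri in auto)
  \<comment> \<open>Generalized over \<open>h\<close>, because a step may use any \<open>g\<close>
    that attains the reduced entry. The measure falls since a step at position \<open>i\<close>
    leads from \<open>F k\<close> to \<open>F (Suc i)\<close>, and \<open>k \<le> i\<close>.\<close>
  have main: "belitskii_run R m l [0..<n] (F k) (act h N) N' \<longleftrightarrow> N' = N" if "h \<in> F k" "k \<le> len" for h k N'
    using that
  proof (induction "len - k" arbitrary: k h N' rule: less_induct)
    case less
    note h = less.prems(1) and k = less.prems(2)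
    have hG: "h \<in> G"
      using h FG by blast
    let ?M = "act h N"
    let ?u = "\<lambda>\<beta>. stabilizer (F k) \<beta> ?M \<noteq> F k"
    have hinv: "trafo_inv h \<in> F k"
      by (rule F_inv[OF h k])
    have stab: "stabilizer (F k) (\<lambda>S. scalar_mat (entry (positions m n l ! i) S)) ?M = F k \<longleftrightarrow>
        (\<forall>g \<in> F k. e i (act g ?M) = e i ?M)" for i
      by (auto simp: stabilizer_def e_def)
    show ?case
    proof (cases "find ?u (blocks m l [0..<n] (F k))")
      case None
      \<comment> \<open>No entry is moved by \<open>F k\<close>, in particular not by the inverse of
        \<open>h\<close>, which carries \<open>act h N\<close> to \<open>N\<close>; so the two
        systems agree.\<close>
      then have st: "e i (act g ?M) = e i ?M" if "i < len" "g \<in> F k" for i g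
        using stab[of i] that unfolding blocks find_None_iff len_def by (auto simp: set_conv_nth)
      have "?M = N"
      proof (rule systems_eqI[OF sys[OF hG] N])
        show "fst ?M = fst N"
          by (rule fixA[OF hG])
        fix p assume "p \<in> set (positions m n l)"
        then obtain i where "i < len" "p = positions m n l ! i"
          by (metis in_set_conv_nth len_def)
        then show "entry p ?M = entry p N"
          using st[OF _ hinv, of i] by (simp add: ai[OF hG] e_def)
      qed
      moreover have "belitskii_run R m l [0..<n] (F k) ?M N' \<longleftrightarrow> N' = ?M"
      proof
        assume "belitskii_run R m l [0..<n] (F k) ?M N'"
        then show "N' = ?M"
          by cases (use None in auto)
      next
        assume "N' = ?M"
        then show "belitskii_run R m l [0..<n] (F k) ?M N'"
          using belitskii_run.stop[OF None] by simp
      qed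
      ultimately show ?thesis
        by simp
    next
      case (Some \<beta>)
      then obtain i where "i < length (positions m n l)"
          "\<beta> = map (\<lambda>p S. scalar_mat (entry p S)) (positions m n l) ! i" "?u \<beta>"
          "\<forall>j < i. \<not> ?u (map (\<lambda>p S. scalar_mat (entry p S)) (positions m n l) ! j)"
        unfolding blocks find_Some_iff length_map by metis
      then have i: "i < len" "\<beta> = (\<lambda>S. scalar_mat (entry (positions m n l ! i) S))"
          "stabilizer (F k) \<beta> ?M \<noteq> F k"
        and i4: "\<And>j. j < i \<Longrightarrow> stabilizer (F k) (\<lambda>S. scalar_mat (entry (positions m n l ! j) S)) ?M = F k"
        unfolding len_def by simp_all
      have \<beta>: "\<beta> S = scalar_mat (e i S)" for S
        by (simp add: i(2) e_def)
      have eM: "e j ?M = e j N" if "j < i" for j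
        using i4[OF that] stab[of j] hinv by (metis ai(1) hG)
      have ki: "k \<le> i"
      proof (rule ccontr)
        assume "\<not> k \<le> i"
        then have "e i (act g ?M) = e i ?M" if "g \<in> F k" for g
          using F_mult[OF that h k] h that by (simp add: F_def am[OF FG[OF that] hG])
        then show False
          using i(3) stab[of i] i(2) by simp
      qed
      \<comment> \<open>The positions from \<open>k\<close> up to \<open>i\<close> were skipped
        because \<open>F k\<close> does not move them on \<open>act h N\<close>. Applying
        \<open>g\<close> after \<open>trafo_inv h\<close> shows that it does not move them on
        \<open>N\<close> either, so they impose no further condition on the group.\<close>
      have Fi: "F k = F i"
      proof
        show "F i \<subseteq> F k"
          using ki by (auto simp: F_def)
        show "F k \<subseteq> F i"
        proof
          fix g assume g: "g \<in> F k"
          have "e j (act g N) = e j N" if "j < i" for j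
          proof -
            have "trafo_mult g (trafo_inv h) \<in> F k"
              using F_mult g hinv k by blast
            then have "e j (act (trafo_mult g (trafo_inv h)) ?M) = e j ?M"
              using i4[OF that] stab[of j] by blast
            moreover have "act (trafo_mult g (trafo_inv h)) ?M = act g N"
              using act_mult[OF grp(1) grp(1) sys, of g "trafo_inv h" h] FG[OF g] grp(3)[OF hG] hG ai(1)[OF hG]
              by simp
            ultimately show ?thesis
              using eM that by simp
          qed
          then show "g \<in> F i"
            using g by (simp add: F_def)
        qed
      qed
      define V where "V = (\<lambda>g. e i (act g ?M)) ` F k"
      have Q: "(\<lambda>g. \<beta> (act g ?M)) ` F k = scalar_mat ` V"
        by (simp add: V_def image_image \<beta>)
      have NV: "e i N \<in> V"
        unfolding V_def using hinv ai(1)[OF hG] by (metis image_eqI)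
      have red: "reduced_entry (e i N) (e i (act g ?M))" if "g \<in> F k" for g
      proof -
        have gh: "trafo_mult g h \<in> F i"
          using F_mult[OF that h k] Fi by simp
        then have "\<forall>j < i. entry (positions m n l ! j) (act (trafo_mult g h) N) = entry (positions m n l ! j) N"
          by (simp add: F_def e_def)
        from normal[OF FG[OF gh] i(1)[unfolded len_def] this] show ?thesis
          by (simp only: e_def am[OF FG[OF that] hG])
      qed
      \<comment> \<open>If the entry of \<open>N\<close> is nonzero, \<open>red\<close> leaves two
        possibilities: all attainable values equal it, which contradicts that position
        \<open>i\<close> is moved, or it is 1 and 0 is not attainable.\<close>
      have c01: "e i N = 0 \<or> e i N = 1 \<and> 0 \<notin> V"
      proof (rule ccontr)
        assume c: "\<not> ?thesis"
        then have "\<exists>v \<in> V. v \<noteq> e i N \<Longrightarrow> e i N = 1"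
          using red by (auto simp: V_def reduced_entry_def)
        moreover have "\<exists>v \<in> V. v \<noteq> e i N"
        proof (rule ccontr)
          assume all: "\<not> ?thesis"
          then have "e i (act g ?M) = e i N" if "g \<in> F k" for g
            using that by (auto simp: V_def)
          moreover have "e i ?M = e i N"
            using calculation[of "trafo_one m n l"] act_one[OF sys[OF hG]] grp(4) one by (simp add: F_def)
          ultimately show False
            using i(2,3) stab[of i] by simp
        qed
        ultimately have "e i N = 1"
          by blast
        moreover have "0 \<notin> V"
          using red unfolding calculation V_def reduced_entry_def by fastforce
        ultimately show False
          using c by simp
      qed
      have rb: "reduced_block R ((\<lambda>g. \<beta> (act g ?M)) ` F k) (\<beta> S) \<longleftrightarrow> e i S = e i N" for S
        by (subst Q, subst \<beta>, rule reduced_scalar_block[OF NV c01])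
      have next_run: "belitskii_run R m l [0..<n] (stabilizer (F k) \<beta> (act g ?M)) (act g ?M) N' \<longleftrightarrow> N' = N"
        if g: "g \<in> F k" "e i (act g ?M) = e i N" for g N'
      proof -
        have gh: "trafo_mult g h \<in> F k"
          by (rule F_mult[OF g(1) h k])
        then have gh1: "trafo_mult g h \<in> F (Suc i)"
          using g(2) unfolding Fi by (auto simp: F_def am[OF FG[OF g(1)] hG, symmetric] less_Suc_eq)
        have "e i (act f (act (trafo_mult g h) N)) = e i (act f N)" if "f \<in> F k" for f
          by (rule cong1[OF FG[OF that] FG[OF gh] i(1)]) (use gh1 in \<open>auto simp: F_def less_Suc_eq_le\<close>)
        \<comment> \<open>The stabilizer is formed at \<open>act g ?M\<close> and not at
          \<open>N\<close>. Both give the same group, since these systems agree up to position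
          \<open>i\<close> and a transformed entry depends on nothing later.\<close>
        then have "stabilizer (F k) \<beta> (act g ?M) = F (Suc i)"
          using g(2) unfolding stabilizer_def \<beta> am[OF FG[OF g(1)] hG] Fi
          by (auto simp: F_def less_Suc_eq)
        then show ?thesis
          using less.hyps[of "Suc i" "trafo_mult g h" N'] gh1 i(1) ki by (simp add: am[OF FG[OF g(1)] hG])
      qed
      show ?thesis
      proof
        assume "belitskii_run R m l [0..<n] (F k) ?M N'"
        then show "N' = N"
        proof cases
          case stop
          then show ?thesis
            using Some by simp
        next
          case (step \<beta>' g)
          then have "\<beta>' = \<beta>"
            using Some by simp
          then show ?thesis
            using step rb next_run by blast
        qed
      next
        assume N': "N' = N"
        \<comment> \<open>For existence of the run, \<open>trafo_inv h\<close> is a legitimate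
          choice of \<open>g\<close>: it attains the reduced entry by jumping to \<open>N\<close>
          directly.\<close>
        have "act (trafo_inv h) ?M = N"
          by (rule ai(1)[OF hG])
        then show "belitskii_run R m l [0..<n] (F k) ?M N'"
          using belitskii_run.step[OF Some hinv, of R N'] rb[of N] next_run[OF hinv, of N'] N' by simp
      qed
    qed
  qed
  have "F 0 = G"
    by (auto simp: F_def)
  then show ?thesis
    using main[of h 0 N'] h by simp
qed

section \<open>Uniqueness of the Jordan data and the group left by the reduction of A\<close>

lemma sorted_wrt_mset_unique:
  assumes "\<And>x y. P x y \<Longrightarrow> P y x \<Longrightarrow> x = y"
  shows "sorted_wrt P xs \<Longrightarrow> sorted_wrt P ys \<Longrightarrow> mset xs = mset ys \<Longrightarrow> xs = ys"
proof (induction xs arbitrary: ys)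
  case Nil
  then show ?case
    by simp
next
  case (Cons x xs)
  then obtain y ys' where ys: "ys = y # ys'"
    by (cases ys) auto
  have "set (x # xs) = set (y # ys')"
    using Cons.prems(3) unfolding ys by (metis set_mset_mset)
  then have "x = y"
    using Cons.prems(1,2) assms unfolding ys by (metis list.set_intros(1) set_ConsD sorted_wrt.simps(2))
  then show ?case
    using Cons ys by auto
qed

text \<open>Uniqueness of the Jordan form is available for the sets of blocks only. Distinct
  eigenvalues make the multiplicities in \<open>nas\<close> at most 1, so \<open>nas'\<close>
  contains it as a multiset; the surplus \<open>D\<close> has total size 0 and is empty because
  blocks of size 0 are forbidden. Sortedness and antisymmetry of \<open>R\<close> then fix the
  list.\<close>

lemma jordan_data_unique:
  assumes R: "linear_order R" and nas: "jordan_data R nas" "jordan_data R nas'"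
    and dist: "distinct (map snd nas)"
    and sim: "similar_mat (jordan_matrix nas :: complex mat) (jordan_matrix nas')"
  shows "nas' = nas"
proof -
  let ?n = "sum_list (map fst nas)"
  have "jordan_nf (jordan_matrix nas) nas" "jordan_nf (jordan_matrix nas) nas'"
    using nas sim similar_mat_refl[OF jordan_matrix_carrier] by (auto simp: jordan_nf_def jordan_data_def)
  then have set: "set nas = set nas'"
    by (rule jordan_nf_unique)
  have "jordan_matrix nas' \<in> carrier_mat ?n ?n"
    using similar_mat_intertwine(1)[OF sim jordan_matrix_carrier] .
  then have sum: "sum_list (map fst nas') = ?n"
    by (metis carrier_matD(1) jordan_matrix_dim(1))
  have "distinct nas"
    using dist by (simp add: distinct_map)
  then have "count (mset nas) x = (if x \<in> set nas then 1 else 0)" for x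
    using distinct_count_atmost_1 by metis
  then have "count (mset nas) x \<le> count (mset nas') x" for x
    using set by (simp add: Suc_le_eq)
  then have "mset nas \<subseteq># mset nas'"
    by (rule mset_subset_eqI)
  then obtain D where D: "mset nas' = mset nas + D"
    by (metis subset_mset.less_eqE)
  have "sum_mset (image_mset fst D) = 0"
  proof -
    have "sum_list (map fst nas') = sum_mset (image_mset fst (mset nas'))" for nas' :: "(nat \<times> complex) list"
      by (metis mset_map sum_mset_sum_list)
    then show ?thesis
      using sum D by simp
  qed
  then have "fst x = 0" if "x \<in># D" for x
    using that by (simp add: sum_mset_0_iff)
  moreover have "x \<in> set nas'" if "x \<in># D" for x
    using D that by (metis set_mset_mset union_iff)
  ultimately have "D = {#}"
    using nas(2) unfolding jordan_data_def by (metis image_eqI multiset_nonemptyE)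
  then have "mset nas' = mset nas"
    using D by simp
  moreover have "antisym R"
    using R by (simp add: linear_order_on_def partial_order_on_def)
  ultimately show ?thesis
    using nas unfolding jordan_data_def
    by (intro sorted_wrt_mset_unique[of "\<lambda>(p, a) (q, b). q < p \<or> q = p \<and> (a, b) \<in> R"]) (auto dest: antisymD)
qed

definition centralizer :: "nat \<Rightarrow> nat \<Rightarrow> nat \<Rightarrow> complex mat \<Rightarrow> trafo set" where
  "centralizer m n l A = {(X, Y, Z) \<in> trafos m n l. Y * A = A * Y}"

lemma fst_act_eq_iff:
  assumes "(X, Y, Z) \<in> trafos m n l" "(A, B, C) \<in> systems m n l" "A' \<in> carrier_mat n n"
  shows "fst (act (X, Y, Z) (A, B, C)) = A' \<longleftrightarrow> Y * A = A' * Y"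
proof -
  have "Y \<in> GL n" "Y \<in> carrier_mat n n" "A \<in> carrier_mat n n"
    using assms GL_carrier by (auto simp: trafos_def systems_def)
  then show ?thesis
    using eq_mult_inv_mat_iff[of Y n A' n "Y * A"] assms(3) by auto
qed

lemma centralizer_eq:
  assumes "(A, B, C) \<in> systems m n l"
  shows "centralizer m n l A = {g \<in> trafos m n l. fst (act g (A, B, C)) = A}"
proof -
  have "A \<in> carrier_mat n n"
    using assms by (simp add: systems_def)
  then show ?thesis
    using fst_act_eq_iff[OF _ assms] by (auto simp: centralizer_def simp del: act.simps)
qed

lemma fst_act_cong: "fst S = fst S' \<Longrightarrow> fst (act g S) = fst (act g S')"
  by (cases g; cases S; cases S') auto

text \<open>Membership concerns \<open>A\<close> alone, so \<open>B\<close> and \<open>C\<close> are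
  filled with zeros and the group laws are read off from the action on this auxiliary
  system.\<close>

lemma centralizer_group:
  assumes "A \<in> carrier_mat n n"
  shows "trafo_group m n l (centralizer m n l A)"
proof -
  let ?S = "(A, 0\<^sub>m n m, 0\<^sub>m l n)"
  have S: "?S \<in> systems m n l"
    using assms by (auto simp: systems_def)
  have "fst (act (trafo_mult g h) ?S) = A"
    if "g \<in> trafos m n l" "fst (act g ?S) = A" "h \<in> trafos m n l" "fst (act h ?S) = A" for g h
    using act_mult[OF that(1,3) S] fst_act_cong[of "act h ?S" ?S g] that(2,4) by simp
  moreover have "fst (act (trafo_inv g) ?S) = A" if "g \<in> trafos m n l" "fst (act g ?S) = A" for g
    using act_inv(1)[OF that(1) S] fst_act_cong[of "act g ?S" ?S "trafo_inv g"] that(2) by simp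
  ultimately show ?thesis
    unfolding trafo_group_def centralizer_eq[OF S]
    using trafo_one_closed trafo_mult_closed trafo_inv_closed act_one[OF S] by auto
qed

text \<open>\<open>belitskii_form\<close> leaves both the initial \<open>g\<close> and the Jordan
  data open. The data are forced by \<open>jordan_data_unique\<close>, so \<open>g\<close> must fix
  the Jordan matrix; this is why \<open>run\<close> is asked for all \<open>h\<close> in the
  centralizer.\<close>

lemma belitskii_form_iff:
  assumes R: "linear_order R" and nas: "jordan_data R nas" "distinct (map snd nas)" "weyr_order nas = [0..<n]"
    and N: "(jordan_matrix nas, B, C) \<in> systems m n l"
    and run: "\<And>h N'. h \<in> centralizer m n l (jordan_matrix nas) \<Longrightarrow>
      belitskii_run R m l [0..<n] (centralizer m n l (jordan_matrix nas))
        (act h (jordan_matrix nas, B, C)) N' \<longleftrightarrow> N' = (jordan_matrix nas, B, C)"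
  shows "belitskii_form m n l R (jordan_matrix nas, B, C) N' \<longleftrightarrow> N' = (jordan_matrix nas, B, C)"
proof -
  let ?N = "(jordan_matrix nas, B, C)" and ?G = "centralizer m n l (jordan_matrix nas)"
  have A: "jordan_matrix nas \<in> carrier_mat n n"
    using N by (simp add: systems_def)
  have stab: "stabilizer (trafos m n l) fst S = ?G" if "fst S = jordan_matrix nas" for S
    unfolding stabilizer_def centralizer_eq[OF N] that
    using fst_act_cong[of S ?N] that by auto
  have uniq: "nas' = nas" if jd: "jordan_data R nas'" and g: "g \<in> trafos m n l" and eq: "fst (act g ?N) = jordan_matrix nas'" for g nas'
  proof -
    obtain X Y Z where g: "g = (X, Y, Z)" "Y \<in> GL n"
      using g by (auto simp: trafos_def)
    have Y: "Y \<in> carrier_mat n n" "inv_mat Y \<in> carrier_mat n n"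
      using g GL_carrier inv_mat_carrier by auto
    have e: "jordan_matrix nas' = Y * jordan_matrix nas * inv_mat Y"
      using eq g by simp
    have "similar_mat (jordan_matrix nas') (jordan_matrix nas)"
      by (rule similar_matI[OF _ inv_mat(2,3)[OF g(2)] e]) (use Y A e in auto)
    then show ?thesis
      using jordan_data_unique[OF R nas(1) jd nas(2)] similar_mat_sym by blast
  qed
  have "belitskii_form m n l R ?N N' \<longleftrightarrow>
      (\<exists>g \<in> ?G. belitskii_run R m l [0..<n] ?G (act g ?N) N')"
  proof
    assume "belitskii_form m n l R ?N N'"
    then obtain g nas' where g: "g \<in> trafos m n l" "jordan_data R nas'" "fst (act g ?N) = jordan_matrix nas'"
      "belitskii_run R m l (weyr_order nas') (stabilizer (trafos m n l) fst (act g ?N)) (act g ?N) N'"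
      unfolding belitskii_form_def by blast
    then have nas': "nas' = nas"
      using uniq by blast
    then have "stabilizer (trafos m n l) fst (act g ?N) = ?G"
      using stab g(3) by blast
    then have "belitskii_run R m l [0..<n] ?G (act g ?N) N'"
      using g(4) nas(3) nas' by metis
    moreover have "g \<in> ?G"
      unfolding centralizer_eq[OF N] using g(1,3) nas' by blast
    ultimately show "\<exists>g \<in> ?G. belitskii_run R m l [0..<n] ?G (act g ?N) N'"
      by blast
  next
    assume "\<exists>g \<in> ?G. belitskii_run R m l [0..<n] ?G (act g ?N) N'"
    then obtain g where g: "g \<in> trafos m n l" "fst (act g ?N) = jordan_matrix nas"
      "belitskii_run R m l [0..<n] ?G (act g ?N) N'"
      unfolding centralizer_eq[OF N] by blast
    then show "belitskii_form m n l R ?N N'"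
      unfolding belitskii_form_def using nas(1,3) stab by metis
  qed
  also have "\<dots> \<longleftrightarrow> N' = ?N"
    using run trafo_groupD(4)[OF centralizer_group[OF A]] by blast
  finally show ?thesis .
qed

section \<open>The listed forms are indecomposable and reduced\<close>

text \<open>Two inner dimensions are needed because \<open>Y * B\<close> sums over the states and
  \<open>B' * X\<close> over the inputs.\<close>

lemma mult_mat_eq_iff:
  assumes "U \<in> carrier_mat p q" "V \<in> carrier_mat q r" "U' \<in> carrier_mat p q'" "V' \<in> carrier_mat q' r"
  shows "U * V = (U' * V' :: complex mat) \<longleftrightarrow> (\<forall>i < p. \<forall>j < r.
    (\<Sum>k = 0..<q. U $$ (i, k) * V $$ (k, j)) = (\<Sum>k = 0..<q'. U' $$ (i, k) * V' $$ (k, j)))"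
proof -
  have "U * V = U' * V' \<longleftrightarrow> (\<forall>i < p. \<forall>j < r. (U * V) $$ (i, j) = (U' * V') $$ (i, j))"
    using assms by (auto intro!: eq_matI simp del: index_mult_mat(1))
  then show ?thesis
    using assms by (simp add: mult_mat_index[OF assms(1,2)] mult_mat_index[OF assms(3,4)] del: index_mult_mat(1))
qed

lemma mat_eq_iff_entries:
  assumes "U \<in> carrier_mat p q" "V \<in> carrier_mat p q"
  shows "U = V \<longleftrightarrow> (\<forall>i < p. \<forall>j < q. U $$ (i, j) = V $$ (i, j))"
  using assms by (auto intro!: eq_matI)

section \<open>Entries of the listed matrices and their centralizers\<close>

lemma all_less_small:
  "(\<forall>i < Suc 0. P i) \<longleftrightarrow> P 0"
  "(\<forall>i < 2. P i) \<longleftrightarrow> P 0 \<and> P 1"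
  "(\<forall>i < 3. P i) \<longleftrightarrow> P 0 \<and> P 1 \<and> P (2 :: nat)"
  by (auto simp: numeral_2_eq_2 numeral_3_eq_3 less_Suc_eq)

lemma sum_small:
  "sum f {0..<Suc 0} = (f 0 :: complex)"
  "sum f {0..<2} = (f 0 + f 1 :: complex)"
  "sum f {0..<3} = (f 0 + f 1 + f (2 :: nat) :: complex)"
  by (auto simp: numeral_2_eq_2 numeral_3_eq_3)

lemma upt_small: "[0..<Suc 0] = [0]" "[0..<2] = [0, 1]" "[0..<3] = [0, 1, 2]"
  by (auto simp: numeral_2_eq_2 numeral_3_eq_3)

lemma column_carrier: "column xs \<in> carrier_mat (length xs) 1"
  by (simp add: column_def mat_of_cols_list_def)

lemma row_mat_carrier: "row_mat xs \<in> carrier_mat 1 (length xs)"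
  by (simp add: row_mat_def mat_of_rows_list_def)

lemma column_index: "i < length xs \<Longrightarrow> column xs $$ (i, 0) = xs ! i"
  by (simp add: column_def mat_of_cols_list_def)

lemma row_mat_index: "i < length xs \<Longrightarrow> row_mat xs $$ (0, i) = xs ! i"
  by (simp add: row_mat_def mat_of_rows_list_def)

lemma diagonal_index: "i < length xs \<Longrightarrow> j < length xs \<Longrightarrow> diagonal xs $$ (i, j) = (if i = j then xs ! j else 0)"
  by (simp add: diagonal_def mat_diag_def)

lemma block_sum_J_2_index:
  "i < 3 \<Longrightarrow> j < 3 \<Longrightarrow> block_sum (J 2 a) (diagonal [b]) $$ (i, j) =
    (if i = 0 \<and> j = 1 then 1 else if i = j then if i = 2 then b else a else 0)"
  by (auto simp: block_sum_index diagonal_def mat_diag_def numeral_2_eq_2 numeral_3_eq_3 less_Suc_eq)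

lemma listed_carrier:
  "column [a] \<in> carrier_mat (Suc 0) (Suc 0)" "column [a, b] \<in> carrier_mat 2 (Suc 0)"
  "column [a, b, c] \<in> carrier_mat 3 (Suc 0)"
  "row_mat [a] \<in> carrier_mat (Suc 0) (Suc 0)" "row_mat [a, b] \<in> carrier_mat (Suc 0) 2"
  "row_mat [a, b, c] \<in> carrier_mat (Suc 0) 3"
  "diagonal [a] \<in> carrier_mat (Suc 0) (Suc 0)" "diagonal [a, b] \<in> carrier_mat 2 2"
  "diagonal [a, b, c] \<in> carrier_mat 3 3" "block_sum (J 2 a) (diagonal [b]) \<in> carrier_mat 3 3"
  using column_carrier[of "[a]"] column_carrier[of "[a, b]"] column_carrier[of "[a, b, c]"]
    row_mat_carrier[of "[a]"] row_mat_carrier[of "[a, b]"] row_mat_carrier[of "[a, b, c]"]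
    diagonal_carrier[of "[a]"] diagonal_carrier[of "[a, b]"] diagonal_carrier[of "[a, b, c]"]
    block_sum_carrier[OF jordan_block_carrier[of 2 a] diagonal_carrier[of "[b]"]]
  by (simp_all add: numeral_2_eq_2 numeral_3_eq_3)

lemma commute_diagonal_1:
  "Y \<in> carrier_mat (Suc 0) (Suc 0) \<Longrightarrow> Y * diagonal [a] = diagonal [a] * Y"
  by (subst mult_mat_eq_iff[OF _ listed_carrier(7) listed_carrier(7)])
    (auto simp: diagonal_index)

text \<open>The centralizer of a single Jordan block consists of the polynomials in it, that is, of
  upper triangular Toeplitz matrices; blocks with different eigenvalues contribute
  separately.\<close>

lemma commute_J_2:
  "Y \<in> carrier_mat 2 2 \<Longrightarrow> Y * J 2 a = J 2 a * Y \<longleftrightarrow> Y $$ (1, 0) = 0 \<and> Y $$ (1, 1) = Y $$ (0, 0)"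
  by (subst mult_mat_eq_iff[OF _ jordan_block_carrier jordan_block_carrier])
    (auto simp: all_less_small sum_small algebra_simps)

lemma commute_J_3:
  "Y \<in> carrier_mat 3 3 \<Longrightarrow> Y * J 3 a = J 3 a * Y \<longleftrightarrow>
    Y $$ (1, 0) = 0 \<and> Y $$ (2, 0) = 0 \<and> Y $$ (2, 1) = 0 \<and>
    Y $$ (1, 1) = Y $$ (0, 0) \<and> Y $$ (2, 2) = Y $$ (0, 0) \<and> Y $$ (1, 2) = Y $$ (0, 1)"
  by (subst mult_mat_eq_iff[OF _ jordan_block_carrier jordan_block_carrier])
    (auto simp: all_less_small sum_small algebra_simps)

lemma commute_diagonal_2:
  "Y \<in> carrier_mat 2 2 \<Longrightarrow> a \<noteq> b \<Longrightarrow> Y * diagonal [a, b] = diagonal [a, b] * Y \<longleftrightarrow>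
    Y $$ (0, 1) = 0 \<and> Y $$ (1, 0) = 0"
  by (subst mult_mat_eq_iff[OF _ listed_carrier(8) listed_carrier(8)])
    (auto simp: all_less_small sum_small diagonal_index)

lemma commute_diagonal_3:
  "Y \<in> carrier_mat 3 3 \<Longrightarrow> a \<noteq> b \<Longrightarrow> a \<noteq> c \<Longrightarrow> b \<noteq> c \<Longrightarrow>
    Y * diagonal [a, b, c] = diagonal [a, b, c] * Y \<longleftrightarrow>
    Y $$ (0, 1) = 0 \<and> Y $$ (0, 2) = 0 \<and> Y $$ (1, 0) = 0 \<and> Y $$ (1, 2) = 0 \<and> Y $$ (2, 0) = 0 \<and> Y $$ (2, 1) = 0"
  by (subst mult_mat_eq_iff[OF _ listed_carrier(9) listed_carrier(9)])
    (auto simp: all_less_small sum_small diagonal_index)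

lemma commute_J_2_diagonal:
  assumes "Y \<in> carrier_mat 3 3" "a \<noteq> b"
  shows "Y * block_sum (J 2 a) (diagonal [b]) = block_sum (J 2 a) (diagonal [b]) * Y \<longleftrightarrow>
    Y $$ (1, 0) = 0 \<and> Y $$ (1, 1) = Y $$ (0, 0) \<and>
    Y $$ (0, 2) = 0 \<and> Y $$ (1, 2) = 0 \<and> Y $$ (2, 0) = 0 \<and> Y $$ (2, 1) = 0"
  using assms
  by (subst mult_mat_eq_iff[OF _ listed_carrier(10) listed_carrier(10)])
    (auto simp: all_less_small sum_small block_sum_J_2_index algebra_simps)

lemmas commute_simps = commute_diagonal_1 commute_J_2 commute_J_3 commute_diagonal_2 commute_diagonal_3
  commute_J_2_diagonal

text \<open>One scalar \<open>c\<close> in {0, 1} expresses both trivial endomorphisms, so that the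
  goal for a listed form is a small polynomial problem in the entries.\<close>

lemma indecomposable_entriesI:
  assumes S: "(A, B, C) \<in> systems m n l"
    and triv: "\<And>P Q T. P \<in> carrier_mat m m \<Longrightarrow> Q \<in> carrier_mat n n \<Longrightarrow> T \<in> carrier_mat l l \<Longrightarrow>
      Q * A = A * Q \<Longrightarrow>
      \<forall>i < m. \<forall>j < m. (\<Sum>k = 0..<m. P $$ (i, k) * P $$ (k, j)) = P $$ (i, j) \<Longrightarrow>
      \<forall>i < n. \<forall>j < n. (\<Sum>k = 0..<n. Q $$ (i, k) * Q $$ (k, j)) = Q $$ (i, j) \<Longrightarrow>
      \<forall>i < l. \<forall>j < l. (\<Sum>k = 0..<l. T $$ (i, k) * T $$ (k, j)) = T $$ (i, j) \<Longrightarrow>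
      \<forall>i < n. \<forall>j < m. (\<Sum>k = 0..<n. Q $$ (i, k) * B $$ (k, j)) = (\<Sum>k = 0..<m. B $$ (i, k) * P $$ (k, j)) \<Longrightarrow>
      \<forall>i < l. \<forall>j < n. (\<Sum>k = 0..<l. T $$ (i, k) * C $$ (k, j)) = (\<Sum>k = 0..<n. C $$ (i, k) * Q $$ (k, j)) \<Longrightarrow>
      \<exists>c \<in> {0, 1}. (\<forall>i < m. \<forall>j < m. P $$ (i, j) = (if i = j then c else 0)) \<and>
        (\<forall>i < n. \<forall>j < n. Q $$ (i, j) = (if i = j then c else 0)) \<and>
        (\<forall>i < l. \<forall>j < l. T $$ (i, j) = (if i = j then c else 0))"
  shows "indecomposable m n l (A, B, C)"
proof (rule indecomposableI[OF S])
  fix P Q T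
  assume E: "idempotent_endo m n l (A, B, C) (P, Q, T)"
  have s: "A \<in> carrier_mat n n" "B \<in> carrier_mat n m" "C \<in> carrier_mat l n"
    using S by (auto simp: systems_def)
  have c: "P \<in> carrier_mat m m" "Q \<in> carrier_mat n n" "T \<in> carrier_mat l l"
    using E by (auto simp: idempotent_endo_def)
  have idem: "\<forall>i < k. \<forall>j < k. (\<Sum>r = 0..<k. W $$ (i, r) * W $$ (r, j)) = W $$ (i, j)"
    if "W \<in> carrier_mat k k" "W * W = W" for W k
    using mult_mat_index[OF that(1,1)] that(2) by metis
  have "\<exists>c \<in> {0, 1}. (\<forall>i < m. \<forall>j < m. P $$ (i, j) = (if i = j then c else 0)) \<and>
        (\<forall>i < n. \<forall>j < n. Q $$ (i, j) = (if i = j then c else 0)) \<and>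
        (\<forall>i < l. \<forall>j < l. T $$ (i, j) = (if i = j then c else 0))"
    by (rule triv[OF c])
      (use E c s in \<open>auto simp: idempotent_endo_def mult_mat_eq_iff[symmetric] simp del: index_mult_mat intro!: idem[rule_format]\<close>)
  then show "P = 0\<^sub>m m m \<and> Q = 0\<^sub>m n n \<and> T = 0\<^sub>m l l \<or> P = 1\<^sub>m m \<and> Q = 1\<^sub>m n \<and> T = 1\<^sub>m l"
    using c by (auto simp: mat_eq_iff_entries[of _ m m] mat_eq_iff_entries[of _ n n] mat_eq_iff_entries[of _ l l])
qed

text \<open>On one Jordan block an idempotent has a single diagonal value \<open>x\<close> with
  \<open>x * x = x\<close>, and equations such as \<open>2 * x * y = y\<close> successively remove
  the entries above the diagonal. The nonzero entries of \<open>B\<close> and \<open>C\<close> then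
  identify the values belonging to different eigenvalues, to the inputs and to the outputs.\<close>

lemma listed_form_indecomposable: "listed_form m n l S \<Longrightarrow> indecomposable m n l S"
  by (induction rule: listed_form.induct;
      rule indecomposable_entriesI, simp add: systems_def listed_carrier,
      auto simp: commute_simps all_less_small sum_small column_index row_mat_index)

text \<open>The recursion stops at the first difference, which matches the assumption
  \<open>normal\<close> of \<open>triangular_run\<close> and lets it be evaluated on explicit
  lists.\<close>

fun reduced_list :: "complex list \<Rightarrow> complex list \<Rightarrow> bool" where
  "reduced_list (a # as) (b # bs) \<longleftrightarrow> reduced_entry a b \<and> (b = a \<longrightarrow> reduced_list as bs)"
| "reduced_list _ _ \<longleftrightarrow> True"

lemma reduced_listD:
  "reduced_list as bs \<Longrightarrow> k < length as \<Longrightarrow> length bs = length as \<Longrightarrow> \<forall>i < k. bs ! i = as ! i \<Longrightarrow>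
    reduced_entry (as ! k) (bs ! k)"
proof (induction as bs arbitrary: k rule: reduced_list.induct)
  case (1 a as b bs)
  show ?case
  proof (cases k)
    case 0
    then show ?thesis
      using "1.prems" by simp
  next
    case (Suc k')
    then have "b = a" "\<forall>i < k'. bs ! i = as ! i"
      using "1.prems"(4) by (metis nth_Cons_0 zero_less_Suc, metis Suc_less_eq nth_Cons_Suc)
    then show ?thesis
      using 1 Suc by simp
  qed
qed auto

text \<open>Restates \<open>triangular_run\<close> without the action: \<open>B'\<close> and
  \<open>C'\<close> are constrained by the intertwining equations only, and invertibility enters as
  nonzero diagonal entries.\<close>

lemma triangular_run_entries:
  assumes G: "trafo_group m n l G" and tri: "\<And>g. g \<in> G \<Longrightarrow> triangular_trafo g"
    and N: "(A, B, C) \<in> systems m n l" and fixA: "\<And>X Y Z. (X, Y, Z) \<in> G \<Longrightarrow> Y * A = A * Y"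
    and normal: "\<And>X Y Z B' C'. (X, Y, Z) \<in> G \<Longrightarrow> X \<in> carrier_mat m m \<Longrightarrow> Y \<in> carrier_mat n n \<Longrightarrow> Z \<in> carrier_mat l l \<Longrightarrow>
      \<forall>i < m. X $$ (i, i) \<noteq> 0 \<Longrightarrow> \<forall>i < n. Y $$ (i, i) \<noteq> 0 \<Longrightarrow> \<forall>i < l. Z $$ (i, i) \<noteq> 0 \<Longrightarrow>
      Y * A = A * Y \<Longrightarrow>
      \<forall>i < n. \<forall>j < m. (\<Sum>k = 0..<n. Y $$ (i, k) * B $$ (k, j)) = (\<Sum>k = 0..<m. B' $$ (i, k) * X $$ (k, j)) \<Longrightarrow>
      \<forall>i < l. \<forall>j < n. (\<Sum>k = 0..<l. Z $$ (i, k) * C $$ (k, j)) = (\<Sum>k = 0..<n. C' $$ (i, k) * Y $$ (k, j)) \<Longrightarrow>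
      reduced_list (map (($$) B) (grid n m) @ map (($$) C) (grid l n))
        (map (($$) B') (grid n m) @ map (($$) C') (grid l n))"
    and h: "h \<in> G"
  shows "belitskii_run R m l [0..<n] G (act h (A, B, C)) N' \<longleftrightarrow> N' = (A, B, C)"
proof (rule triangular_run[OF G tri N _ _ h])
  have s: "A \<in> carrier_mat n n" "B \<in> carrier_mat n m" "C \<in> carrier_mat l n"
    using N by (auto simp: systems_def)
  show fst: "fst (act g (A, B, C)) = fst (A, B, C)" if "g \<in> G" for g
  proof -
    obtain X Y Z where g: "g = (X, Y, Z)"
      by (metis prod_cases3)
    then show ?thesis
      using fst_act_eq_iff[of X Y Z m n l A B C A] trafo_groupD(1)[OF G that] N s(1) fixA that
      by (simp del: act.simps)
  qed
  fix g k
  assume g: "g \<in> G" and k: "k < length (positions m n l)"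
    and eq: "\<forall>i < k. entry (positions m n l ! i) (act g (A, B, C)) = entry (positions m n l ! i) (A, B, C)"
  obtain X Y Z where XYZ: "g = (X, Y, Z)"
    by (metis prod_cases3)
  obtain B' C' where act: "act g (A, B, C) = (A, B', C')"
    using fst[OF g] by (metis fst_conv prod_cases3)
  have S': "(A, B', C') \<in> systems m n l"
    using act_closed[OF trafo_groupD(1)[OF G g] N] act by simp
  then have s': "B' \<in> carrier_mat n m" "C' \<in> carrier_mat l n"
    by (auto simp: systems_def)
  have gl: "X \<in> GL m" "Y \<in> GL n" "Z \<in> GL l"
    using trafo_groupD(1)[OF G g] by (auto simp: XYZ trafos_def)
  then have c: "X \<in> carrier_mat m m" "Y \<in> carrier_mat n n" "Z \<in> carrier_mat l l"
    using GL_carrier by auto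
  \<comment> \<open>The determinant of a triangular matrix is the product of its diagonal, so
    invertibility makes every diagonal entry nonzero.\<close>
  have diag: "\<forall>i < q. W $$ (i, i) \<noteq> 0" if W: "W \<in> GL q" "upper_triangular W" for W q
  proof -
    have c: "W \<in> carrier_mat q q"
      using W(1) by (rule GL_carrier)
    have "prod_list (diag_mat W) \<noteq> 0"
      using W(1) GL_iff_det[OF c] det_upper_triangular[OF W(2) c] by simp
    then show ?thesis
      using c by (force simp: prod_list_zero_iff diag_mat_def)
  qed
  have i: "Y * A = A * Y" "Y * B = B' * X" "Z * C = C' * Y"
    using act_eq_iff[of X Y Z m n l A B C A B' C'] trafo_groupD(1)[OF G g] N S' act by (auto simp: XYZ simp del: act.simps)
  have t: "upper_triangular X" "upper_triangular Y" "upper_triangular Z"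
    using tri[OF g] by (auto simp: XYZ)
  have "reduced_list (map (($$) B) (grid n m) @ map (($$) C) (grid l n))
        (map (($$) B') (grid n m) @ map (($$) C') (grid l n))"
    by (rule normal[OF g[unfolded XYZ] c diag[OF gl(1) t(1)] diag[OF gl(2) t(2)] diag[OF gl(3) t(3)] i(1)
          i(2)[unfolded mult_mat_eq_iff[OF c(2) s(2) s'(1) c(1)]]
          i(3)[unfolded mult_mat_eq_iff[OF c(3) s(3) s'(2) c(2)]]])
  moreover have "map (\<lambda>p. entry p (A, D, E)) (positions m n l) = map (($$) D) (grid n m) @ map (($$) E) (grid l n)" for D E
    by (simp add: positions_def)
  ultimately have red: "reduced_list (map (\<lambda>p. entry p (A, B, C)) (positions m n l))
      (map (\<lambda>p. entry p (A, B', C')) (positions m n l))"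
    by simp
  show "reduced_entry (entry (positions m n l ! k) (A, B, C)) (entry (positions m n l ! k) (act g (A, B, C)))"
    using reduced_listD[OF red, of k] k eq unfolding act by simp
qed

text \<open>With at most one input and one output, \<open>X\<close> and \<open>Z\<close> are at most
  1 x 1 and thus triangular; only for \<open>Y\<close> does this have to be assumed.\<close>

lemma belitskii_form_normal:
  assumes R: "linear_order R" and nas: "jordan_data R nas" "distinct (map snd nas)" "weyr_order nas = [0..<n]"
    and A: "A = jordan_matrix nas" and N: "(A, B, C) \<in> systems m n l" and ml: "m \<le> 1" "l \<le> 1"
    and tri: "\<And>Y. Y \<in> carrier_mat n n \<Longrightarrow> Y * A = A * Y \<Longrightarrow> \<forall>i < n. \<forall>j < n. j < i \<longrightarrow> Y $$ (i, j) = 0"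
    and normal: "\<And>X Y Z B' C'. X \<in> carrier_mat m m \<Longrightarrow> Y \<in> carrier_mat n n \<Longrightarrow> Z \<in> carrier_mat l l \<Longrightarrow>
      \<forall>i < m. X $$ (i, i) \<noteq> 0 \<Longrightarrow> \<forall>i < n. Y $$ (i, i) \<noteq> 0 \<Longrightarrow> \<forall>i < l. Z $$ (i, i) \<noteq> 0 \<Longrightarrow>
      Y * A = A * Y \<Longrightarrow>
      \<forall>i < n. \<forall>j < m. (\<Sum>k = 0..<n. Y $$ (i, k) * B $$ (k, j)) = (\<Sum>k = 0..<m. B' $$ (i, k) * X $$ (k, j)) \<Longrightarrow>
      \<forall>i < l. \<forall>j < n. (\<Sum>k = 0..<l. Z $$ (i, k) * C $$ (k, j)) = (\<Sum>k = 0..<n. C' $$ (i, k) * Y $$ (k, j)) \<Longrightarrow>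
      reduced_list (map (($$) B) (grid n m) @ map (($$) C) (grid l n))
        (map (($$) B') (grid n m) @ map (($$) C') (grid l n))"
  shows "belitskii_form m n l R (A, B, C) N' \<longleftrightarrow> N' = (A, B, C)"
  unfolding A
proof (rule belitskii_form_iff[OF R nas])
  let ?G = "centralizer m n l (jordan_matrix nas)"
  show N1: "(jordan_matrix nas, B, C) \<in> systems m n l"
    using N A by simp
  then have "jordan_matrix nas \<in> carrier_mat n n"
    by (simp add: systems_def)
  then have G: "trafo_group m n l ?G"
    by (rule centralizer_group)
  fix h N' assume h: "h \<in> ?G"
  have tri1: "triangular_trafo g" if gG: "g \<in> ?G" for g
  proof -
    obtain X Y Z where g: "g = (X, Y, Z)" "X \<in> carrier_mat m m" "Y \<in> carrier_mat n n" "Z \<in> carrier_mat l l" "Y * A = A * Y"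
      using gG GL_carrier by (auto simp: centralizer_def trafos_def A)
    then show ?thesis
      using tri[OF g(3,5)] ml by (auto simp: upper_triangular_def)
  qed
  show "belitskii_run R m l [0..<n] ?G (act h (jordan_matrix nas, B, C)) N' \<longleftrightarrow> N' = (jordan_matrix nas, B, C)"
  proof (rule triangular_run_entries[OF G tri1 N1 _ _ h])
    show "Y * jordan_matrix nas = jordan_matrix nas * Y" if "(X, Y, Z) \<in> ?G" for X Y Z
      using that by (simp add: centralizer_def)
  qed (use normal in \<open>simp_all add: A\<close>)
qed

lemma grid_small:
  "grid p 0 = []" "grid 0 q = []" "grid (Suc 0) (Suc 0) = [(0, 0)]"
  "grid 2 (Suc 0) = [(1, 0), (0, 0)]" "grid 3 (Suc 0) = [(2, 0), (1, 0), (0, 0)]"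
  "grid (Suc 0) 2 = [(0, 0), (0, 1)]" "grid (Suc 0) 3 = [(0, 0), (0, 1), (0, 2)]"
  "grid 2 2 = [(1, 0), (1, 1), (0, 0), (0, 1)]"
  by (simp_all add: grid_def upt_small)

text \<open>The last assumption of \<open>belitskii_form_normal\<close> as a closed formula, so that
  it can be proved by induction over \<open>listed_form\<close>.\<close>

definition entry_normal :: "nat \<Rightarrow> nat \<Rightarrow> nat \<Rightarrow> complex mat \<Rightarrow> complex mat \<Rightarrow> complex mat \<Rightarrow> bool" where
  "entry_normal m n l A B C \<longleftrightarrow> (\<forall>X Y Z B' C'.
      X \<in> carrier_mat m m \<longrightarrow> Y \<in> carrier_mat n n \<longrightarrow> Z \<in> carrier_mat l l \<longrightarrow>
      (\<forall>i < m. X $$ (i, i) \<noteq> 0) \<longrightarrow> (\<forall>i < n. Y $$ (i, i) \<noteq> 0) \<longrightarrow> (\<forall>i < l. Z $$ (i, i) \<noteq> 0) \<longrightarrow>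
      Y * A = A * Y \<longrightarrow>
      (\<forall>i < n. \<forall>j < m. (\<Sum>k = 0..<n. Y $$ (i, k) * B $$ (k, j)) = (\<Sum>k = 0..<m. B' $$ (i, k) * X $$ (k, j))) \<longrightarrow>
      (\<forall>i < l. \<forall>j < n. (\<Sum>k = 0..<l. Z $$ (i, k) * C $$ (k, j)) = (\<Sum>k = 0..<n. C' $$ (i, k) * Y $$ (k, j))) \<longrightarrow>
      reduced_list (map (($$) B) (grid n m) @ map (($$) C) (grid l n))
        (map (($$) B') (grid n m) @ map (($$) C') (grid l n)))"

lemma listed_form_systems: "listed_form m n l S \<Longrightarrow> S \<in> systems m n l"
  by (induction rule: listed_form.induct) (simp_all add: systems_def listed_carrier)

lemma listed_form_centralizer:
  "listed_form m n l S \<Longrightarrow> Y \<in> carrier_mat n n \<Longrightarrow> Y * fst S = fst S * Y \<Longrightarrow>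
    \<forall>i < n. \<forall>j < n. j < i \<longrightarrow> Y $$ (i, j) = 0"
  by (induction rule: listed_form.induct) (simp_all add: commute_simps all_less_small)

text \<open>Once the preceding entries are preserved, an entry 1 is multiplied by a quotient of
  nonzero diagonal entries and cannot vanish. The parameter in \<open>[1 b]\<close> or
  \<open>[1 c]\<close> is visited last, when the earlier entries have made these quotients 1 and
  removed the off-diagonal part of \<open>Y\<close>, so it is fixed.\<close>

lemma listed_form_entry_normal:
  "listed_form m n l S \<Longrightarrow> m \<le> 1 \<Longrightarrow> l \<le> 1 \<Longrightarrow>
    entry_normal m n l (fst S) (fst (snd S)) (snd (snd S))"
  by (induction rule: listed_form.induct)
    (auto simp: entry_normal_def reduced_entry_def grid_small commute_simps all_less_small
      sum_small column_index row_mat_index)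

text \<open>A single step at a first block \<open>\<beta>\<close> of arbitrary shape, after which
  the smaller group \<open>G'\<close> takes over. The assumption \<open>stab_all\<close> requires
  the same stabilizer at every system of the orbit that shares the block of \<open>N\<close>, so the
  choice of \<open>g\<close> is immaterial; \<open>moved\<close> ensures that this block is the one
  selected.\<close>

lemma first_block_run:
  assumes G: "trafo_group m n l G" and N: "N \<in> systems m n l"
    and blocks: "blocks m l ix G = \<beta> # \<beta>s" and sub: "G' \<subseteq> G"
    and stab_all: "\<forall>f \<in> G. \<forall>k \<in> G. \<beta> (act k N) = \<beta> N \<longrightarrow>
      (\<beta> (act f (act k N)) = \<beta> N \<longleftrightarrow> f \<in> G')"
    and moved: "k0 \<in> G" "\<beta> (act k0 N) \<noteq> \<beta> N"
    and red: "\<And>W. reduced_block R ((\<lambda>k. \<beta> (act k N)) ` G) W \<longleftrightarrow> W = \<beta> N"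
  shows "trafo_group m n l G'"
    and "(\<And>k N'. k \<in> G' \<Longrightarrow> belitskii_run R m l ix G' (act k N) N' \<longleftrightarrow> N' = N) \<Longrightarrow>
      h \<in> G \<Longrightarrow> belitskii_run R m l ix G (act h N) N' \<longleftrightarrow> N' = N"
proof -
  note grp = trafo_groupD[OF G]
  have stab: "\<beta> (act f (act k N)) = \<beta> N \<longleftrightarrow> f \<in> G'"
    if "f \<in> G" "k \<in> G" "\<beta> (act k N) = \<beta> N" for f k
    using stab_all that by blast
  have am: "act g (act h N) = act (trafo_mult g h) N" if "g \<in> G" "h \<in> G" for g h
    using act_mult grp(1) that N by blast
  have ai: "act (trafo_inv g) (act g N) = N" "act g (act (trafo_inv g) N) = N" if "g \<in> G" for g
    using act_inv grp(1) that N by blast+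
  have one: "act (trafo_one m n l) N = N"
    using act_one N by blast
  have stab1: "\<beta> (act f N) = \<beta> N \<longleftrightarrow> f \<in> G'" if "f \<in> G" for f
    using stab[OF that grp(4)] one by simp
  show "trafo_group m n l G'"
    unfolding trafo_group_def
  proof (intro conjI ballI)
    show "G' \<subseteq> trafos m n l"
      using sub grp(1) by blast
    show "trafo_one m n l \<in> G'"
      using stab1[OF grp(4)] one by simp
  next
    fix g h assume "g \<in> G'" "h \<in> G'"
    then have g: "g \<in> G" "h \<in> G" "g \<in> G'" "h \<in> G'"
      using sub by auto
    have "\<beta> (act g (act h N)) = \<beta> N"
      using stab[OF g(1,2)] stab1[OF g(2)] g(3,4) by simp
    then show "trafo_mult g h \<in> G'"
      using stab1[OF grp(2)[OF g(1,2)]] am[OF g(1,2)] by simp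
  next
    fix g assume "g \<in> G'"
    then have g: "g \<in> G" "g \<in> G'"
      using sub by auto
    show "trafo_inv g \<in> G'"
      using stab[OF grp(3)[OF g(1)] g(1)] stab1[OF g(1)] g(2) ai(1)[OF g(1)] by simp
  qed
  assume run': "\<And>k N'. k \<in> G' \<Longrightarrow> belitskii_run R m l ix G' (act k N) N' \<longleftrightarrow> N' = N"
    and h: "h \<in> G"
  let ?M = "act h N"
  \<comment> \<open>\<open>G\<close> is a group, so the blocks attainable from
    \<open>act h N\<close> are those attainable from \<open>N\<close>, and \<open>red\<close>
    applies to both.\<close>
  have orbit: "(\<lambda>k. \<beta> (act k ?M)) ` G = (\<lambda>k. \<beta> (act k N)) ` G"
  proof
    show "(\<lambda>k. \<beta> (act k ?M)) ` G \<subseteq> (\<lambda>k. \<beta> (act k N)) ` G"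
    proof (rule image_subsetI)
      fix k assume k: "k \<in> G"
      show "\<beta> (act k ?M) \<in> (\<lambda>k. \<beta> (act k N)) ` G"
        unfolding am[OF k h] using grp(2)[OF k h] by (rule imageI)
    qed
    show "(\<lambda>k. \<beta> (act k N)) ` G \<subseteq> (\<lambda>k. \<beta> (act k ?M)) ` G"
    proof
      fix W assume "W \<in> (\<lambda>k. \<beta> (act k N)) ` G"
      then obtain k where k: "k \<in> G" "W = \<beta> (act k N)"
        by blast
      have "act (trafo_mult k (trafo_inv h)) ?M = act k N"
        using act_mult[of k m n l "trafo_inv h" ?M] grp(1,3) k(1) h act_closed[OF grp(1)[OF h] N] ai(1)[OF h]
        by simp
      then show "W \<in> (\<lambda>k. \<beta> (act k ?M)) ` G"
        using k grp(2)[OF k(1) grp(3)[OF h]] by (metis image_eqI)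
    qed
  qed
  have "stabilizer G \<beta> ?M \<noteq> G"
  proof
    assume "stabilizer G \<beta> ?M = G"
    then have "\<forall>W \<in> (\<lambda>k. \<beta> (act k ?M)) ` G. W = \<beta> ?M"
      unfolding stabilizer_def by blast
    then have "\<forall>W \<in> (\<lambda>k. \<beta> (act k N)) ` G. W = \<beta> ?M"
      unfolding orbit .
    moreover have "\<beta> N \<in> (\<lambda>k. \<beta> (act k N)) ` G"
      using grp(4) one by (metis image_eqI)
    ultimately show False
      using moved by auto
  qed
  then have find: "find (\<lambda>\<beta>. stabilizer G \<beta> ?M \<noteq> G) (blocks m l ix G) = Some \<beta>"
    unfolding blocks by simp
  have next_run: "belitskii_run R m l ix (stabilizer G \<beta> (act g ?M)) (act g ?M) N' \<longleftrightarrow> N' = N"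
    if g: "g \<in> G" "\<beta> (act g ?M) = \<beta> N" for g N'
  proof -
    have gh: "trafo_mult g h \<in> G" "\<beta> (act (trafo_mult g h) N) = \<beta> N"
      using grp(2)[OF g(1) h] g(2) am[OF g(1) h] by simp_all
    have "stabilizer G \<beta> (act g ?M) = G'"
      unfolding stabilizer_def g(2) unfolding am[OF g(1) h] using stab[OF _ gh] sub by blast
    then show ?thesis
      using run'[of "trafo_mult g h" N'] stab1[OF gh(1)] gh(2) am[OF g(1) h] by simp
  qed
  show "belitskii_run R m l ix G ?M N' \<longleftrightarrow> N' = N"
  proof
    assume "belitskii_run R m l ix G ?M N'"
    then show "N' = N"
    proof cases
      case stop
      then show ?thesis
        using find by simp
    next
      case (step \<beta>' g)
      then have \<beta>': "\<beta>' = \<beta>"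
        using find by simp
      then have "\<beta> (act g ?M) = \<beta> N"
        using step(3) red unfolding \<beta>' orbit by blast
      then show ?thesis
        using step next_run \<beta>' by blast
    qed
  next
    assume N': "N' = N"
    have r: "reduced_block R ((\<lambda>k. \<beta> (act k ?M)) ` G) (\<beta> (act (trafo_inv h) ?M))"
      unfolding orbit red ai(1)[OF h] ..
    have "belitskii_run R m l ix (stabilizer G \<beta> (act (trafo_inv h) ?M)) (act (trafo_inv h) ?M) N'"
      using next_run[OF grp(3)[OF h] arg_cong[OF ai(1)[OF h], of \<beta>]] N' by blast
    then show "belitskii_run R m l ix G ?M N'"
      by (rule belitskii_run.step[OF find grp(3)[OF h] r])
  qed
qed

section \<open>The sizes with two inputs or two outputs\<close>

lemma centralizer_act:
  assumes "(X, Y, Z) \<in> centralizer m n l A" "(A, B, C) \<in> systems m n l"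
  shows "\<exists>B' C'. act (X, Y, Z) (A, B, C) = (A, B', C') \<and> (A, B', C') \<in> systems m n l \<and>
    Y * B = B' * X \<and> Z * C = C' * Y"
proof -
  have t: "(X, Y, Z) \<in> trafos m n l" and c: "Y * A = A * Y"
    using assms(1) by (auto simp: centralizer_def)
  have A: "A \<in> carrier_mat n n"
    using assms(2) by (simp add: systems_def)
  have "fst (act (X, Y, Z) (A, B, C)) = A"
    using fst_act_eq_iff[OF t assms(2) A] c by simp
  then obtain B' C' where a: "act (X, Y, Z) (A, B, C) = (A, B', C')"
    by (metis fst_conv prod_cases3)
  then have "(A, B', C') \<in> systems m n l"
    using act_closed[OF t assms(2)] by simp
  then show ?thesis
    using act_eq_iff[OF t assms(2), of A B' C'] a by blast
qed

lemma GL_2_nonzero: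
  assumes "X \<in> GL 2"
  shows "X $$ (0, 0) * X $$ (1, 1) \<noteq> X $$ (0, 1) * X $$ (1, 0)"
proof -
  let ?W = "inv_mat X"
  have c: "X \<in> carrier_mat 2 2" "?W \<in> carrier_mat 2 2"
    using assms GL_carrier inv_mat_carrier by auto
  have "X * ?W = 1\<^sub>m 2 * 1\<^sub>m 2"
    using inv_mat(2)[OF assms] by simp
  then have e: "X $$ (0, 0) * ?W $$ (0, 0) + X $$ (0, 1) * ?W $$ (1, 0) = 1"
      "X $$ (0, 0) * ?W $$ (0, 1) + X $$ (0, 1) * ?W $$ (1, 1) = 0"
      "X $$ (1, 0) * ?W $$ (0, 0) + X $$ (1, 1) * ?W $$ (1, 0) = 0"
      "X $$ (1, 0) * ?W $$ (0, 1) + X $$ (1, 1) * ?W $$ (1, 1) = 1"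
    using mult_mat_eq_iff[OF c one_carrier_mat one_carrier_mat] by (auto simp: all_less_small sum_small)
  \<comment> \<open>Multiplicativity of the 2 x 2 determinant, written out for \<open>X\<close> and
    its inverse.\<close>
  have "(X $$ (0, 0) * X $$ (1, 1) - X $$ (0, 1) * X $$ (1, 0)) *
      (?W $$ (0, 0) * ?W $$ (1, 1) - ?W $$ (0, 1) * ?W $$ (1, 0)) =
      (X $$ (0, 0) * ?W $$ (0, 0) + X $$ (0, 1) * ?W $$ (1, 0)) *
      (X $$ (1, 0) * ?W $$ (0, 1) + X $$ (1, 1) * ?W $$ (1, 1)) -
      (X $$ (0, 0) * ?W $$ (0, 1) + X $$ (0, 1) * ?W $$ (1, 1)) *
      (X $$ (1, 0) * ?W $$ (0, 0) + X $$ (1, 1) * ?W $$ (1, 0))"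
    by (simp add: algebra_simps)
  then show ?thesis
    unfolding e by auto
qed

lemma swap_GL: "mat 2 2 (\<lambda>(i, j). if i = j then 0 else 1) \<in> GL 2"
  by (rule GL_I[of _ _ "mat 2 2 (\<lambda>(i, j). if i = j then 0 else 1)"])
    (auto simp: mat_eq_iff_entries[of _ 2 2] all_less_small scalar_prod_def sum_small)

text \<open>The exchange of the two basis vectors does not preserve the span of the first, so its
  presence rules out a cut between them.\<close>

lemma strips_GL_2:
  assumes "mat 2 2 (\<lambda>(i, j). if i = j then 0 else 1) \<in> G"
  shows "strips [0..<2] G = [[0, 1]]"
proof -
  have "flag_invariant [0, 1] G 0" "flag_invariant [0, 1] G 2"
    by (auto simp: flag_invariant_def)
  moreover have "\<not> flag_invariant [0, 1] G (Suc 0)"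
  proof
    assume f: "flag_invariant [0, 1] G (Suc 0)"
    have "mat 2 2 (\<lambda>(i, j). if i = j then 0 else 1 :: complex) $$ ([0, 1] ! 1, [0, 1] ! 0) = 0"
      by (rule f[unfolded flag_invariant_def, rule_format, OF assms]) simp
    then show False
      by simp
  qed
  moreover have "[0..<Suc (length [0..<2::nat])] = [0, Suc 0, 2]"
    by (simp add: numeral_2_eq_2)
  ultimately show ?thesis
    unfolding strips_def upt_small(2) Let_def by (simp add: numeral_2_eq_2)
qed

text \<open>A nonzero row has \<open>r = 1\<close>, which leaves \<open>q = 0\<close> and
  \<open>p = 1\<close>: the unit stands at the right end.\<close>

lemma rank_form_row:
  assumes "W \<in> carrier_mat 1 2" "\<not> zero_form W"
  shows "rank_form W \<longleftrightarrow> W $$ (0, 0) = 0 \<and> W $$ (0, 1) = 1"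
proof
  assume "rank_form W"
  then obtain r p q where e: "W = four_block_mat (0\<^sub>m r p) (1\<^sub>m r) (0\<^sub>m q p) (0\<^sub>m q r)"
    by (auto simp: rank_form_def)
  have d: "r + q = 1" "p + r = 2"
    using assms(1) unfolding e by auto
  have "r \<noteq> 0"
  proof
    assume "r = 0"
    then have "W = 0\<^sub>m 1 2"
      unfolding e using d by (intro eq_matI) auto
    then show False
      using assms(2) by (simp add: zero_form_def)
  qed
  then have "r = 1" "q = 0" "p = 1"
    using d by auto
  then show "W $$ (0, 0) = 0 \<and> W $$ (0, 1) = 1"
    unfolding e by simp
next
  assume "W $$ (0, 0) = 0 \<and> W $$ (0, 1) = 1"
  then have "W = four_block_mat (0\<^sub>m 1 1) (1\<^sub>m 1) (0\<^sub>m 0 1) (0\<^sub>m 0 1)"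
    using assms(1) by (intro eq_matI) (auto simp: less_Suc_eq numeral_2_eq_2)
  then show "rank_form W"
    unfolding rank_form_def by metis
qed

text \<open>Here \<open>r = 1\<close> leaves \<open>p = 0\<close> and \<open>q = 1\<close>: the unit
  stands on top.\<close>

lemma rank_form_column:
  assumes "W \<in> carrier_mat 2 1" "\<not> zero_form W"
  shows "rank_form W \<longleftrightarrow> W $$ (0, 0) = 1 \<and> W $$ (1, 0) = 0"
proof
  assume "rank_form W"
  then obtain r p q where e: "W = four_block_mat (0\<^sub>m r p) (1\<^sub>m r) (0\<^sub>m q p) (0\<^sub>m q r)"
    by (auto simp: rank_form_def)
  have d: "r + q = 2" "p + r = 1"
    using assms(1) unfolding e by auto
  have "r \<noteq> 0"
  proof
    assume "r = 0"
    then have "W = 0\<^sub>m 2 1"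
      unfolding e using d by (intro eq_matI) auto
    then show False
      using assms(2) by (simp add: zero_form_def)
  qed
  then have "r = 1" "q = 1" "p = 0"
    using d by auto
  then show "W $$ (0, 0) = 1 \<and> W $$ (1, 0) = 0"
    unfolding e by simp
next
  assume "W $$ (0, 0) = 1 \<and> W $$ (1, 0) = 0"
  then have "W = four_block_mat (0\<^sub>m 1 0) (1\<^sub>m 1) (0\<^sub>m 1 0) (0\<^sub>m 1 1)"
    using assms(1) by (intro eq_matI) (auto simp: less_Suc_eq numeral_2_eq_2)
  then show "rank_form W"
    unfolding rank_form_def by metis
qed

lemma reduced_block_rank_iff:
  assumes "V \<in> Q" "rank_form V" "\<And>W. W \<in> Q \<Longrightarrow> \<not> zero_form W"
    "\<And>W. W \<in> Q \<Longrightarrow> rank_form W \<Longrightarrow> W = V"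
  shows "reduced_block R Q W \<longleftrightarrow> W = V"
proof -
  have "\<not> (\<exists>N' \<in> Q. zero_form N')" "\<exists>N' \<in> Q. rank_form N'"
    using assms by blast+
  then have "reduced_block R Q W \<longleftrightarrow> W \<in> Q \<and> rank_form W"
    unfolding reduced_block_def by simp
  then show ?thesis
    using assms(1,2,4) by blast
qed

lemma J_2_trafos:
  assumes "(X, Y, Z) \<in> centralizer m 2 l (J 2 a)"
  shows "X \<in> GL m" "Y \<in> GL 2" "Z \<in> GL l" "X \<in> carrier_mat m m" "Y \<in> carrier_mat 2 2" "Z \<in> carrier_mat l l"
    "Y $$ (1, 0) = 0" "Y $$ (1, 1) = Y $$ (0, 0)" "Y $$ (0, 0) \<noteq> 0"
proof -
  show gl: "X \<in> GL m" "Y \<in> GL 2" "Z \<in> GL l"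
    using assms by (auto simp: centralizer_def trafos_def)
  then show c: "X \<in> carrier_mat m m" "Y \<in> carrier_mat 2 2" "Z \<in> carrier_mat l l"
    using GL_carrier by auto
  show "Y $$ (1, 0) = 0" "Y $$ (1, 1) = Y $$ (0, 0)"
    using assms commute_J_2[OF c(2)] by (auto simp: centralizer_def)
  then show "Y $$ (0, 0) \<noteq> 0"
    using GL_2_nonzero[OF gl(2)] by auto
qed

lemma J_2_strips:
  "strips [0..<2] ((\<lambda>(X, Y, Z). Y) ` centralizer m 2 l (J 2 a)) = [[0], [1]]"
proof -
  have "strips [0..<2] ((\<lambda>(X, Y, Z). Y) ` centralizer m 2 l (J 2 a)) = map (\<lambda>i. [i]) [0..<2]"
  proof (rule strips_triangular)
    fix g assume "g \<in> (\<lambda>(X, Y, Z). Y) ` centralizer m 2 l (J 2 a)"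
    then obtain X Z where "(X, g, Z) \<in> centralizer m 2 l (J 2 a)"
      by auto
    from J_2_trafos[OF this] show "g \<in> carrier_mat 2 2 \<and> upper_triangular g"
      by (auto simp: upper_triangular_def numeral_2_eq_2 less_Suc_eq)
  qed
  then show ?thesis
    by (simp add: upt_small)
qed

text \<open>\<open>Y\<close> is triangular, but \<open>X\<close> is an arbitrary invertible matrix,
  so the first block is the whole bottom row of \<open>B\<close>. Its rank form is
  \<open>[0 1]\<close>, and preserving this row makes \<open>X\<close> triangular.\<close>

lemma belitskii_run_220:
  assumes h: "h \<in> centralizer 2 2 0 (J 2 a)"
  shows "belitskii_run R 2 0 [0..<2] (centralizer 2 2 0 (J 2 a)) (act h (J 2 a, 1\<^sub>m 2, 0\<^sub>m 0 2)) N' \<longleftrightarrow>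
    N' = (J 2 a, 1\<^sub>m 2, 0\<^sub>m 0 2)"
proof -
  let ?G = "centralizer 2 2 0 (J 2 a)" and ?N = "(J 2 a, 1\<^sub>m 2, 0\<^sub>m 0 2)"
  let ?\<sigma> = "mat 2 2 (\<lambda>(i, j). if i = j then 0 else 1) :: complex mat"
  define \<beta> :: "linsys \<Rightarrow> complex mat" where "\<beta> = (\<lambda>(A, B, C). block_of [1] [0, 1] B)"
  \<comment> \<open>With bottom row \<open>[0 1]\<close> before and after,
    \<open>Y * B = B' * X\<close> says in the last row that \<open>[0 y]\<close> is the bottom row
    of \<open>X\<close>, where \<open>y\<close> is the last diagonal entry of
    \<open>Y\<close>.\<close>
  define G' where "G' = {(X, Y, Z) \<in> ?G. X $$ (1, 0) = 0 \<and> X $$ (1, 1) = Y $$ (1, 1)}"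
  have N: "?N \<in> systems 2 2 0"
    by (simp add: systems_def)
  have G: "trafo_group 2 2 0 ?G"
    by (rule centralizer_group) simp
  have \<sigma>: "(?\<sigma>, 1\<^sub>m 2, 1\<^sub>m 0) \<in> ?G"
    using swap_GL by (simp add: centralizer_def trafos_def GL_one)
  then have XS: "strips [0..<2] ((\<lambda>(X, Y, Z). X) ` ?G) = [[0, 1]]"
    by (intro strips_GL_2) force
  obtain \<beta>s where blocks: "blocks 2 0 [0..<2] ?G = \<beta> # \<beta>s"
    unfolding blocks_def Let_def XS J_2_strips by (simp add: \<beta>_def)
  have \<beta>c: "\<beta> S \<in> carrier_mat 1 2" for S
    by (cases S) (simp add: \<beta>_def block_of_def numeral_2_eq_2)
  have \<beta>i: "\<beta> (A, B, C) $$ (0, 0) = B $$ (1, 0)" "\<beta> (A, B, C) $$ (0, 1) = B $$ (1, 1)" for A B C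
    by (simp_all add: \<beta>_def block_of_def)
  have \<beta>eq: "\<beta> (A, B, C) = \<beta> ?N \<longleftrightarrow> B $$ (1, 0) = 0 \<and> B $$ (1, 1) = 1" for A B C
    using \<beta>i[of A B C] \<beta>i[of "J 2 a" "1\<^sub>m 2" "0\<^sub>m 0 2"]
    by (simp add: mat_eq_iff_entries[OF \<beta>c \<beta>c] all_less_small)
  have rows: "Y $$ (1, 1) * B $$ (1, 0) = B' $$ (1, 0) * X $$ (0, 0) + B' $$ (1, 1) * X $$ (1, 0)"
      "Y $$ (1, 1) * B $$ (1, 1) = B' $$ (1, 0) * X $$ (0, 1) + B' $$ (1, 1) * X $$ (1, 1)"
    if "(X, Y, Z) \<in> ?G" "(J 2 a, B, C) \<in> systems 2 2 0" "act (X, Y, Z) (J 2 a, B, C) = (J 2 a, B', C')"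
    for X Y Z B C B' C'
  proof -
    have "B \<in> carrier_mat 2 2" "B' \<in> carrier_mat 2 2" "Y * B = B' * X"
      using centralizer_act[OF that(1,2)] that(2,3) by (auto simp: systems_def)
    then show "Y $$ (1, 1) * B $$ (1, 0) = B' $$ (1, 0) * X $$ (0, 0) + B' $$ (1, 1) * X $$ (1, 0)"
      "Y $$ (1, 1) * B $$ (1, 1) = B' $$ (1, 0) * X $$ (0, 1) + B' $$ (1, 1) * X $$ (1, 1)"
      using mult_mat_eq_iff[of Y 2 2 B 2 B' 2 X] J_2_trafos[OF that(1)]
      by (auto simp: all_less_small sum_small)
  qed
  have stab: "\<beta> (act f (act k ?N)) = \<beta> ?N \<longleftrightarrow> f \<in> G'"
    if f: "f \<in> ?G" and k: "k \<in> ?G" and kN: "\<beta> (act k ?N) = \<beta> ?N" for f k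
  proof -
    obtain X Y Z where XYZ: "f = (X, Y, Z)"
      by (metis prod_cases3)
    obtain B C where BC: "act k ?N = (J 2 a, B, C)" "(J 2 a, B, C) \<in> systems 2 2 0"
      using centralizer_act[OF _ N] k by (metis prod_cases3)
    obtain B' C' where B'C': "act f (J 2 a, B, C) = (J 2 a, B', C')"
      using centralizer_act[OF _ BC(2)] f by (metis prod_cases3)
    have B: "B $$ (1, 0) = 0" "B $$ (1, 1) = 1"
      using kN unfolding BC(1) \<beta>eq by auto
    note eqs = rows[OF f[unfolded XYZ] BC(2) B'C'[unfolded XYZ], unfolded B]
    note J = J_2_trafos[OF f[unfolded XYZ]]
    have "B' $$ (1, 0) = 0 \<and> B' $$ (1, 1) = 1 \<longleftrightarrow> X $$ (1, 0) = 0 \<and> X $$ (1, 1) = Y $$ (1, 1)"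
      using eqs J(8,9) GL_2_nonzero[OF J(1)] by auto
    then show ?thesis
      using f unfolding BC(1) B'C' \<beta>eq by (simp add: G'_def XYZ)
  qed
  have moved: "\<beta> (act (?\<sigma>, 1\<^sub>m 2, 1\<^sub>m 0) ?N) \<noteq> \<beta> ?N"
  proof -
    have "act (trafo_one 2 2 0) ?N = ?N"
      by (rule act_one[OF N])
    then have "\<beta> (act (?\<sigma>, 1\<^sub>m 2, 1\<^sub>m 0) ?N) = \<beta> ?N \<longleftrightarrow> (?\<sigma>, 1\<^sub>m 2, 1\<^sub>m 0) \<in> G'"
      using stab[OF \<sigma> trafo_groupD(4)[OF G]] by simp
    then show ?thesis
      by (simp add: G'_def)
  qed
  have mem: "\<beta> ?N \<in> (\<lambda>k. \<beta> (act k ?N)) ` ?G"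
    by (rule image_eqI[of _ _ "trafo_one 2 2 0"]) (simp_all only: act_one[OF N] trafo_groupD(4)[OF G])
  have red: "reduced_block R ((\<lambda>k. \<beta> (act k ?N)) ` ?G) W \<longleftrightarrow> W = \<beta> ?N" for W
  proof (rule reduced_block_rank_iff[OF mem])
    show nz: "\<not> zero_form V" if V: "V \<in> (\<lambda>k. \<beta> (act k ?N)) ` ?G" for V
    proof
      assume z: "zero_form V"
      obtain k where k: "k \<in> ?G" "V = \<beta> (act k ?N)"
        using V by blast
      obtain X Y Z where XYZ: "k = (X, Y, Z)"
        by (metis prod_cases3)
      obtain B C where BC: "act k ?N = (J 2 a, B, C)"
        using centralizer_act[OF _ N] k by (metis prod_cases3)
      have "V = 0\<^sub>m 1 2"
        using z \<beta>c[of "act k ?N"] unfolding k(2) zero_form_def by (metis carrier_matD)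
      then have "B $$ (1, 0) = 0" "B $$ (1, 1) = 0"
        using \<beta>i[of "J 2 a" B C] unfolding k(2) BC by auto
      then show False
        using rows(2)[OF k(1)[unfolded XYZ] N BC[unfolded XYZ]] J_2_trafos(8,9)[OF k(1)[unfolded XYZ]] by simp
    qed
    show "rank_form (\<beta> ?N)"
      using rank_form_row[OF \<beta>c[of ?N] nz[OF mem]] \<beta>i[of "J 2 a" "1\<^sub>m 2" "0\<^sub>m 0 2"] by simp
    show "V = \<beta> ?N" if V: "V \<in> (\<lambda>k. \<beta> (act k ?N)) ` ?G" "rank_form V" for V
    proof -
      have Vc: "V \<in> carrier_mat 1 2"
        using V(1) \<beta>c by blast
      then show ?thesis
        using rank_form_row[OF Vc nz[OF V(1)]] V(2) \<beta>i[of "J 2 a" "1\<^sub>m 2" "0\<^sub>m 0 2"]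
        by (simp add: mat_eq_iff_entries[OF Vc \<beta>c] all_less_small)
    qed
  qed
  have sub: "G' \<subseteq> ?G"
    by (auto simp: G'_def)
  have stab_all: "\<forall>f \<in> ?G. \<forall>k \<in> ?G. \<beta> (act k ?N) = \<beta> ?N \<longrightarrow> (\<beta> (act f (act k ?N)) = \<beta> ?N \<longleftrightarrow> f \<in> G')"
    using stab by blast
  note first = first_block_run[OF G N blocks sub stab_all \<sigma> moved red]
  show ?thesis
  proof (rule first(2)[OF _ h])
    fix k N' assume k: "k \<in> G'"
    show "belitskii_run R 2 0 [0..<2] G' (act k ?N) N' \<longleftrightarrow> N' = ?N"
    proof (rule triangular_run_entries[OF first(1) _ N _ _ k])
      show "triangular_trafo g" if "g \<in> G'" for g
      proof -
        obtain X Y Z where "g = (X, Y, Z)"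
          by (metis prod_cases3)
        then show ?thesis
          using that J_2_trafos[of X Y Z 2 0 a]
          by (auto simp: G'_def upper_triangular_def numeral_2_eq_2 less_Suc_eq)
      qed
      show "Y * J 2 a = J 2 a * Y" if "(X, Y, Z) \<in> G'" for X Y Z
        using that by (simp add: G'_def centralizer_def)
    next
      fix X Y Z B' C' assume g: "(X, Y, Z) \<in> G'" and nz: "\<forall>i < 2. X $$ (i, i) \<noteq> 0" "\<forall>i < 2. Y $$ (i, i) \<noteq> 0"
        and e: "\<forall>i < 2. \<forall>j < 2. (\<Sum>k = 0..<2. Y $$ (i, k) * 1\<^sub>m 2 $$ (k, j)) = (\<Sum>k = 0..<2. B' $$ (i, k) * X $$ (k, j))"
      have "X $$ (1, 0) = 0" "X $$ (1, 1) = Y $$ (1, 1)" "Y $$ (1, 0) = 0"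
        using g J_2_trafos[of X Y Z 2 0 a] by (auto simp: G'_def)
      then show "reduced_list (map (($$) (1\<^sub>m 2)) (grid 2 2) @ map (($$) (0\<^sub>m 0 2)) (grid 0 2))
          (map (($$) B') (grid 2 2) @ map (($$) C') (grid 0 2))"
        using nz e by (auto simp: grid_small reduced_entry_def all_less_small sum_small)
    qed
  qed
qed

text \<open>Dually, \<open>Z\<close> is arbitrary while \<open>Y\<close> cuts the columns of
  \<open>C\<close>, so the first block is the whole first column; its rank form has entries 1 and
  0.\<close>

lemma belitskii_run_022:
  assumes h: "h \<in> centralizer 0 2 2 (J 2 a)"
  shows "belitskii_run R 0 2 [0..<2] (centralizer 0 2 2 (J 2 a)) (act h (J 2 a, 0\<^sub>m 2 0, 1\<^sub>m 2)) N' \<longleftrightarrow>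
    N' = (J 2 a, 0\<^sub>m 2 0, 1\<^sub>m 2)"
proof -
  let ?G = "centralizer 0 2 2 (J 2 a)" and ?N = "(J 2 a, 0\<^sub>m 2 0, 1\<^sub>m 2)"
  let ?\<sigma> = "mat 2 2 (\<lambda>(i, j). if i = j then 0 else 1) :: complex mat"
  define \<beta> :: "linsys \<Rightarrow> complex mat" where "\<beta> = (\<lambda>(A, B, C). block_of [0, 1] [0] C)"
  \<comment> \<open>The first column of \<open>Z * C = C' * Y\<close>, with 1 above 0 on both sides:
    the first column of \<open>Z\<close> is \<open>Y $$ (0, 0)\<close> above 0.\<close>
  define G' where "G' = {(X, Y, Z) \<in> ?G. Z $$ (1, 0) = 0 \<and> Z $$ (0, 0) = Y $$ (0, 0)}"
  have N: "?N \<in> systems 0 2 2"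
    by (simp add: systems_def)
  have G: "trafo_group 0 2 2 ?G"
    by (rule centralizer_group) simp
  have \<sigma>: "(1\<^sub>m 0, 1\<^sub>m 2, ?\<sigma>) \<in> ?G"
    using swap_GL by (simp add: centralizer_def trafos_def GL_one)
  then have ZS: "strips [0..<2] ((\<lambda>(X, Y, Z). Z) ` ?G) = [[0, 1]]"
    by (intro strips_GL_2) force
  have XS: "strips [0..<0] H = []" for H
    by (simp add: strips_def)
  obtain \<beta>s where blocks: "blocks 0 2 [0..<2] ?G = \<beta> # \<beta>s"
    unfolding blocks_def Let_def ZS J_2_strips XS by (simp add: \<beta>_def)
  have \<beta>c: "\<beta> S \<in> carrier_mat 2 1" for S
    by (cases S) (simp add: \<beta>_def block_of_def numeral_2_eq_2)
  have \<beta>i: "\<beta> (A, B, C) $$ (0, 0) = C $$ (0, 0)" "\<beta> (A, B, C) $$ (1, 0) = C $$ (1, 0)" for A B C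
    by (simp_all add: \<beta>_def block_of_def)
  have \<beta>eq: "\<beta> (A, B, C) = \<beta> ?N \<longleftrightarrow> C $$ (0, 0) = 1 \<and> C $$ (1, 0) = 0" for A B C
    using \<beta>i[of A B C] \<beta>i[of "J 2 a" "0\<^sub>m 2 0" "1\<^sub>m 2"]
    by (simp add: mat_eq_iff_entries[OF \<beta>c \<beta>c] all_less_small)
  have cols: "Z $$ (0, 0) * C $$ (0, 0) + Z $$ (0, 1) * C $$ (1, 0) = C' $$ (0, 0) * Y $$ (0, 0)"
      "Z $$ (1, 0) * C $$ (0, 0) + Z $$ (1, 1) * C $$ (1, 0) = C' $$ (1, 0) * Y $$ (0, 0)"
    if "(X, Y, Z) \<in> ?G" "(J 2 a, B, C) \<in> systems 0 2 2" "act (X, Y, Z) (J 2 a, B, C) = (J 2 a, B', C')"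
    for X Y Z B C B' C'
  proof -
    have "C \<in> carrier_mat 2 2" "C' \<in> carrier_mat 2 2" "Z * C = C' * Y"
      using centralizer_act[OF that(1,2)] that(2,3) by (auto simp: systems_def)
    then show "Z $$ (0, 0) * C $$ (0, 0) + Z $$ (0, 1) * C $$ (1, 0) = C' $$ (0, 0) * Y $$ (0, 0)"
      "Z $$ (1, 0) * C $$ (0, 0) + Z $$ (1, 1) * C $$ (1, 0) = C' $$ (1, 0) * Y $$ (0, 0)"
      using mult_mat_eq_iff[of Z 2 2 C 2 C' 2 Y] J_2_trafos[OF that(1)]
      by (auto simp: all_less_small sum_small)
  qed
  have stab: "\<beta> (act f (act k ?N)) = \<beta> ?N \<longleftrightarrow> f \<in> G'"
    if f: "f \<in> ?G" and k: "k \<in> ?G" and kN: "\<beta> (act k ?N) = \<beta> ?N" for f k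
  proof -
    obtain X Y Z where XYZ: "f = (X, Y, Z)"
      by (metis prod_cases3)
    obtain B C where BC: "act k ?N = (J 2 a, B, C)" "(J 2 a, B, C) \<in> systems 0 2 2"
      using centralizer_act[OF _ N] k by (metis prod_cases3)
    obtain B' C' where B'C': "act f (J 2 a, B, C) = (J 2 a, B', C')"
      using centralizer_act[OF _ BC(2)] f by (metis prod_cases3)
    have C: "C $$ (0, 0) = 1" "C $$ (1, 0) = 0"
      using kN unfolding BC(1) \<beta>eq by auto
    note eqs = cols[OF f[unfolded XYZ] BC(2) B'C'[unfolded XYZ], unfolded C]
    note J = J_2_trafos[OF f[unfolded XYZ]]
    have "C' $$ (0, 0) = 1 \<and> C' $$ (1, 0) = 0 \<longleftrightarrow> Z $$ (1, 0) = 0 \<and> Z $$ (0, 0) = Y $$ (0, 0)"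
      using eqs J(9) by auto
    then show ?thesis
      using f unfolding BC(1) B'C' \<beta>eq by (simp add: G'_def XYZ)
  qed
  have moved: "\<beta> (act (1\<^sub>m 0, 1\<^sub>m 2, ?\<sigma>) ?N) \<noteq> \<beta> ?N"
  proof -
    have "act (trafo_one 0 2 2) ?N = ?N"
      by (rule act_one[OF N])
    then have "\<beta> (act (1\<^sub>m 0, 1\<^sub>m 2, ?\<sigma>) ?N) = \<beta> ?N \<longleftrightarrow> (1\<^sub>m 0, 1\<^sub>m 2, ?\<sigma>) \<in> G'"
      using stab[OF \<sigma> trafo_groupD(4)[OF G]] by simp
    then show ?thesis
      by (simp add: G'_def)
  qed
  have mem: "\<beta> ?N \<in> (\<lambda>k. \<beta> (act k ?N)) ` ?G"
    by (rule image_eqI[of _ _ "trafo_one 0 2 2"]) (simp_all only: act_one[OF N] trafo_groupD(4)[OF G])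
  have red: "reduced_block R ((\<lambda>k. \<beta> (act k ?N)) ` ?G) W \<longleftrightarrow> W = \<beta> ?N" for W
  proof (rule reduced_block_rank_iff[OF mem])
    show nz: "\<not> zero_form V" if V: "V \<in> (\<lambda>k. \<beta> (act k ?N)) ` ?G" for V
    proof
      assume z: "zero_form V"
      obtain k where k: "k \<in> ?G" "V = \<beta> (act k ?N)"
        using V by blast
      obtain X Y Z where XYZ: "k = (X, Y, Z)"
        by (metis prod_cases3)
      obtain B C where BC: "act k ?N = (J 2 a, B, C)"
        using centralizer_act[OF _ N] k by (metis prod_cases3)
      have "V = 0\<^sub>m 2 1"
        using z \<beta>c[of "act k ?N"] unfolding k(2) zero_form_def by (metis carrier_matD)
      then have "C $$ (0, 0) = 0" "C $$ (1, 0) = 0"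
        using \<beta>i[of "J 2 a" B C] unfolding k(2) BC by auto
      then show False
        using cols[OF k(1)[unfolded XYZ] N BC[unfolded XYZ]] GL_2_nonzero[OF J_2_trafos(3)[OF k(1)[unfolded XYZ]]]
        by simp
    qed
    show "rank_form (\<beta> ?N)"
      using rank_form_column[OF \<beta>c[of ?N] nz[OF mem]] \<beta>i[of "J 2 a" "0\<^sub>m 2 0" "1\<^sub>m 2"] by simp
    show "V = \<beta> ?N" if V: "V \<in> (\<lambda>k. \<beta> (act k ?N)) ` ?G" "rank_form V" for V
    proof -
      have Vc: "V \<in> carrier_mat 2 1"
        using V(1) \<beta>c by blast
      then show ?thesis
        using rank_form_column[OF Vc nz[OF V(1)]] V(2) \<beta>i[of "J 2 a" "0\<^sub>m 2 0" "1\<^sub>m 2"]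
        by (simp add: mat_eq_iff_entries[OF Vc \<beta>c] all_less_small)
    qed
  qed
  have sub: "G' \<subseteq> ?G"
    by (auto simp: G'_def)
  have stab_all: "\<forall>f \<in> ?G. \<forall>k \<in> ?G. \<beta> (act k ?N) = \<beta> ?N \<longrightarrow> (\<beta> (act f (act k ?N)) = \<beta> ?N \<longleftrightarrow> f \<in> G')"
    using stab by blast
  note first = first_block_run[OF G N blocks sub stab_all \<sigma> moved red]
  show ?thesis
  proof (rule first(2)[OF _ h])
    fix k N' assume k: "k \<in> G'"
    show "belitskii_run R 0 2 [0..<2] G' (act k ?N) N' \<longleftrightarrow> N' = ?N"
    proof (rule triangular_run_entries[OF first(1) _ N _ _ k])
      show "triangular_trafo g" if "g \<in> G'" for g
      proof -
        obtain X Y Z where "g = (X, Y, Z)"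
          by (metis prod_cases3)
        then show ?thesis
          using that J_2_trafos[of X Y Z 0 2 a]
          by (auto simp: G'_def upper_triangular_def numeral_2_eq_2 less_Suc_eq)
      qed
      show "Y * J 2 a = J 2 a * Y" if "(X, Y, Z) \<in> G'" for X Y Z
        using that by (simp add: G'_def centralizer_def)
    next
      fix X Y Z B' C' assume g: "(X, Y, Z) \<in> G'" and nz: "\<forall>i < 2. Y $$ (i, i) \<noteq> 0" "\<forall>i < 2. Z $$ (i, i) \<noteq> 0"
        and e: "\<forall>i < 2. \<forall>j < 2. (\<Sum>k = 0..<2. Z $$ (i, k) * 1\<^sub>m 2 $$ (k, j)) = (\<Sum>k = 0..<2. C' $$ (i, k) * Y $$ (k, j))"
      have "Z $$ (1, 0) = 0" "Z $$ (0, 0) = Y $$ (0, 0)" "Y $$ (1, 0) = 0"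
        using g J_2_trafos[of X Y Z 0 2 a] by (auto simp: G'_def)
      then show "reduced_list (map (($$) (0\<^sub>m 2 0)) (grid 2 0) @ map (($$) (1\<^sub>m 2)) (grid 2 2))
          (map (($$) B') (grid 2 0) @ map (($$) C') (grid 2 2))"
        using nz e by (auto simp: grid_small reduced_entry_def all_less_small sum_small)
    qed
  qed
qed

lemma listed_form_belitskii_form:
  assumes listed: "listed_form m n l (jordan_matrix nas, B, C)" and R: "linear_order R"
    and nas: "jordan_data R nas" "distinct (map snd nas)" "weyr_order nas = [0..<n]"
  shows "belitskii_form m n l R (jordan_matrix nas, B, C) N' \<longleftrightarrow> N' = (jordan_matrix nas, B, C)"
proof (cases "m \<le> 1 \<and> l \<le> 1")
  case True
  show ?thesis
  proof (rule belitskii_form_normal[OF R nas refl listed_form_systems[OF listed]])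
    show "\<forall>i < n. \<forall>j < n. j < i \<longrightarrow> Y $$ (i, j) = 0"
      if "Y \<in> carrier_mat n n" "Y * jordan_matrix nas = jordan_matrix nas * Y" for Y
      using listed_form_centralizer[OF listed that(1)] that(2) by simp
  qed (use True listed_form_entry_normal[OF listed] in \<open>auto simp: entry_normal_def\<close>)
next
  case False
  have sys: "(jordan_matrix nas, B, C) \<in> systems m n l"
    by (rule listed_form_systems[OF listed])
  consider (inputs) a where "m = 2" "n = 2" "l = 0" "jordan_matrix nas = J 2 a" "B = 1\<^sub>m 2" "C = 0\<^sub>m 0 2"
    | (outputs) a where "m = 0" "n = 2" "l = 2" "jordan_matrix nas = J 2 a" "B = 0\<^sub>m 2 0" "C = 1\<^sub>m 2"
    using listed False by (cases rule: listed_form.cases) auto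
  then show ?thesis
  proof cases
    case inputs
    show ?thesis
    proof (rule belitskii_form_iff[OF R nas sys])
      fix h N' assume "h \<in> centralizer m n l (jordan_matrix nas)"
      then show "belitskii_run R m l [0..<n] (centralizer m n l (jordan_matrix nas))
          (act h (jordan_matrix nas, B, C)) N' \<longleftrightarrow> N' = (jordan_matrix nas, B, C)"
        unfolding inputs by (rule belitskii_run_220)
    qed
  next
    case outputs
    show ?thesis
    proof (rule belitskii_form_iff[OF R nas sys])
      fix h N' assume "h \<in> centralizer m n l (jordan_matrix nas)"
      then show "belitskii_run R m l [0..<n] (centralizer m n l (jordan_matrix nas))
          (act h (jordan_matrix nas, B, C)) N' \<longleftrightarrow> N' = (jordan_matrix nas, B, C)"
        unfolding outputs by (rule belitskii_run_022)
    qed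
  qed
qed

section \<open>Classification\<close>

text \<open>The diagonals alone suffice to tell the triple from 0 and from 1, which keeps
  \<open>nontriv\<close> easy to check for explicit matrices.\<close>

lemma decomposableI:
  assumes S: "(A, B, C) \<in> systems m n l"
    and c: "P \<in> carrier_mat m m" "Q \<in> carrier_mat n n" "T \<in> carrier_mat l l"
    and QA: "Q * A = A * Q"
    and idem: "\<forall>i < m. \<forall>j < m. (\<Sum>k = 0..<m. P $$ (i, k) * P $$ (k, j)) = P $$ (i, j)"
      "\<forall>i < n. \<forall>j < n. (\<Sum>k = 0..<n. Q $$ (i, k) * Q $$ (k, j)) = Q $$ (i, j)"
      "\<forall>i < l. \<forall>j < l. (\<Sum>k = 0..<l. T $$ (i, k) * T $$ (k, j)) = T $$ (i, j)"
    and QB: "\<forall>i < n. \<forall>j < m. (\<Sum>k = 0..<n. Q $$ (i, k) * B $$ (k, j)) = (\<Sum>k = 0..<m. B $$ (i, k) * P $$ (k, j))"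
    and TC: "\<forall>i < l. \<forall>j < n. (\<Sum>k = 0..<l. T $$ (i, k) * C $$ (k, j)) = (\<Sum>k = 0..<n. C $$ (i, k) * Q $$ (k, j))"
    and nontriv: "\<And>c. c \<in> {0, 1} \<Longrightarrow> \<not> ((\<forall>i < m. P $$ (i, i) = c) \<and> (\<forall>i < n. Q $$ (i, i) = c) \<and> (\<forall>i < l. T $$ (i, i) = c))"
  shows "\<not> indecomposable m n l (A, B, C)"
proof (rule decomposable_if_idempotent[OF S])
  have s: "A \<in> carrier_mat n n" "B \<in> carrier_mat n m" "C \<in> carrier_mat l n"
    using S by (auto simp: systems_def)
  have idem': "W * W = W" if "W \<in> carrier_mat k k"
      "\<forall>i < k. \<forall>j < k. (\<Sum>r = 0..<k. W $$ (i, r) * W $$ (r, j)) = W $$ (i, j)" for W :: "complex mat" and k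
    unfolding mat_eq_iff_entries[OF mult_carrier_mat[OF that(1,1)] that(1)]
    using that(2) mult_mat_index[OF that(1,1)] by simp
  show "idempotent_endo m n l (A, B, C) (P, Q, T)"
    unfolding idempotent_endo_def
    using c QA idem'[OF c(1) idem(1)] idem'[OF c(2) idem(2)] idem'[OF c(3) idem(3)]
      QB[folded mult_mat_eq_iff[OF c(2) s(2) s(2) c(1)]] TC[folded mult_mat_eq_iff[OF c(3) s(3) s(3) c(2)]]
    by simp
  show "\<not> (P = 0\<^sub>m m m \<and> Q = 0\<^sub>m n n \<and> T = 0\<^sub>m l l)"
    using nontriv[of 0] by auto
  show "\<not> (P = 1\<^sub>m m \<and> Q = 1\<^sub>m n \<and> T = 1\<^sub>m l)"
    using nontriv[of 1] by auto
qed

lemma indecomposableD: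
  assumes "indecomposable m n l (A, B, C)" "(A, B, C) \<in> systems m n l"
    "P \<in> carrier_mat m m" "Q \<in> carrier_mat n n" "T \<in> carrier_mat l l"
    "Q * A = A * Q"
    "\<forall>i < m. \<forall>j < m. (\<Sum>k = 0..<m. P $$ (i, k) * P $$ (k, j)) = P $$ (i, j)"
    "\<forall>i < n. \<forall>j < n. (\<Sum>k = 0..<n. Q $$ (i, k) * Q $$ (k, j)) = Q $$ (i, j)"
    "\<forall>i < l. \<forall>j < l. (\<Sum>k = 0..<l. T $$ (i, k) * T $$ (k, j)) = T $$ (i, j)"
    "\<forall>i < n. \<forall>j < m. (\<Sum>k = 0..<n. Q $$ (i, k) * B $$ (k, j)) = (\<Sum>k = 0..<m. B $$ (i, k) * P $$ (k, j))"
    "\<forall>i < l. \<forall>j < n. (\<Sum>k = 0..<l. T $$ (i, k) * C $$ (k, j)) = (\<Sum>k = 0..<n. C $$ (i, k) * Q $$ (k, j))"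
    "\<And>c. c \<in> {0, 1} \<Longrightarrow> \<not> ((\<forall>i < m. P $$ (i, i) = c) \<and> (\<forall>i < n. Q $$ (i, i) = c) \<and> (\<forall>i < l. T $$ (i, i) = c))"
  shows False
  using decomposableI[OF assms(2-)] assms(1) by blast

text \<open>\<open>A\<close> is kept, so that the listed form refers to the same Jordan data, in the
  same order of the eigenvalues, as the given system.\<close>

definition classified :: "nat \<Rightarrow> nat \<Rightarrow> nat \<Rightarrow> complex mat \<Rightarrow> complex mat \<Rightarrow> complex mat \<Rightarrow> bool" where
  "classified m n l A B C \<longleftrightarrow>
     (\<exists>B' C'. listed_form m n l (A, B', C') \<and> equivalent m n l (A, B, C) (A, B', C'))"

lemma GL_triangularI:
  assumes c: "X \<in> carrier_mat k k" and t: "\<forall>i < k. \<forall>j < k. j < i \<longrightarrow> X $$ (i, j) = 0" and d: "\<forall>i < k. X $$ (i, i) \<noteq> 0"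
  shows "X \<in> GL k"
proof -
  have "upper_triangular X"
    using c t by (auto simp: upper_triangular_def)
  then have "det X = prod_list (diag_mat X)"
    using det_upper_triangular c by blast
  moreover have "prod_list (diag_mat X) \<noteq> 0"
    using c d by (auto simp: prod_list_zero_iff diag_mat_def)
  ultimately show ?thesis
    using GL_iff_det[OF c] by simp
qed

lemma listedI:
  assumes listed: "listed_form m n l (A, B', C')" and S: "(A, B, C) \<in> systems m n l"
    and g: "X \<in> GL m" "Y \<in> GL n" "Z \<in> GL l" and YA: "Y * A = A * Y"
    and YB: "\<forall>i < n. \<forall>j < m. (\<Sum>k = 0..<n. Y $$ (i, k) * B $$ (k, j)) = (\<Sum>k = 0..<m. B' $$ (i, k) * X $$ (k, j))"
    and ZC: "\<forall>i < l. \<forall>j < n. (\<Sum>k = 0..<l. Z $$ (i, k) * C $$ (k, j)) = (\<Sum>k = 0..<n. C' $$ (i, k) * Y $$ (k, j))"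
  shows "classified m n l A B C"
proof -
  have S': "(A, B', C') \<in> systems m n l"
    by (rule listed_form_systems[OF listed])
  have s: "B \<in> carrier_mat n m" "C \<in> carrier_mat l n" "B' \<in> carrier_mat n m" "C' \<in> carrier_mat l n"
    using S S' by (auto simp: systems_def)
  have c: "X \<in> carrier_mat m m" "Y \<in> carrier_mat n n" "Z \<in> carrier_mat l l"
    using g GL_carrier by auto
  have "equivalent m n l (A, B, C) (A, B', C')"
    by (rule equivalentI[OF S S' g YA YB[folded mult_mat_eq_iff[OF c(2) s(1,3) c(1)]]
          ZC[folded mult_mat_eq_iff[OF c(3) s(2,4) c(2)]]])
  then show ?thesis
    using listed by (auto simp: classified_def)
qed

text \<open>Starts from the listed form. With \<open>X\<close> the identity,
  \<open>Y * B' = B * X\<close> lets the entries of \<open>Y\<close> be read off from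
  \<open>B\<close> without division; \<open>listedI\<close> offers the same for
  \<open>C\<close>.\<close>

lemma listedI':
  assumes listed: "listed_form m n l (A, B', C')" and S: "(A, B, C) \<in> systems m n l"
    and g: "X \<in> GL m" "Y \<in> GL n" "Z \<in> GL l" and YA: "Y * A = A * Y"
    and YB: "\<forall>i < n. \<forall>j < m. (\<Sum>k = 0..<n. Y $$ (i, k) * B' $$ (k, j)) = (\<Sum>k = 0..<m. B $$ (i, k) * X $$ (k, j))"
    and ZC: "\<forall>i < l. \<forall>j < n. (\<Sum>k = 0..<l. Z $$ (i, k) * C' $$ (k, j)) = (\<Sum>k = 0..<n. C $$ (i, k) * Y $$ (k, j))"
  shows "classified m n l A B C"
proof -
  have S': "(A, B', C') \<in> systems m n l"
    by (rule listed_form_systems[OF listed])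
  have s: "B \<in> carrier_mat n m" "C \<in> carrier_mat l n" "B' \<in> carrier_mat n m" "C' \<in> carrier_mat l n"
    using S S' by (auto simp: systems_def)
  have c: "X \<in> carrier_mat m m" "Y \<in> carrier_mat n n" "Z \<in> carrier_mat l l"
    using g GL_carrier by auto
  have "equivalent m n l (A, B', C') (A, B, C)"
    by (rule equivalentI[OF S' S g YA YB[folded mult_mat_eq_iff[OF c(2) s(3,1) c(1)]]
          ZC[folded mult_mat_eq_iff[OF c(3) s(4,2) c(2)]]])
  then show ?thesis
    using listed unfolding classified_def by (blast intro: equivalent_sym)
qed

text \<open>If \<open>B = 0\<close>, the inputs split off as a summand of size
  \<open>(m, 0, 0)\<close>, and the states remain in the other summand.\<close>

lemma input_nonzero:
  assumes ind: "indecomposable m n l (A, B, C)" and S: "(A, B, C) \<in> systems m n l" and nm: "n \<noteq> 0" "m \<noteq> 0"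
  shows "\<not> (\<forall>i < n. \<forall>j < m. B $$ (i, j) = 0)"
proof
  assume z: "\<forall>i < n. \<forall>j < m. B $$ (i, j) = 0"
  have "A \<in> carrier_mat n n"
    using S by (simp add: systems_def)
  moreover have "(\<Sum>k = 0..<m. 1\<^sub>m m $$ (i, k) * 1\<^sub>m m $$ (k, j)) = (1\<^sub>m m $$ (i, j) :: complex)"
    if "i < m" "j < m" for i j
    using mult_mat_index[of "1\<^sub>m m :: complex mat" m m "1\<^sub>m m" m i j] that by simp
  ultimately show False
    using z nm
    by (intro indecomposableD[OF ind S, where P = "1\<^sub>m m" and Q = "0\<^sub>m n n" and T = "0\<^sub>m l l"]) auto
qed

lemma output_nonzero:
  assumes ind: "indecomposable m n l (A, B, C)" and S: "(A, B, C) \<in> systems m n l" and nl: "n \<noteq> 0" "l \<noteq> 0"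
  shows "\<not> (\<forall>i < l. \<forall>j < n. C $$ (i, j) = 0)"
proof
  assume z: "\<forall>i < l. \<forall>j < n. C $$ (i, j) = 0"
  have "A \<in> carrier_mat n n"
    using S by (simp add: systems_def)
  moreover have "(\<Sum>k = 0..<l. 1\<^sub>m l $$ (i, k) * 1\<^sub>m l $$ (k, j)) = (1\<^sub>m l $$ (i, j) :: complex)"
    if "i < l" "j < l" for i j
    using mult_mat_index[of "1\<^sub>m l :: complex mat" l l "1\<^sub>m l" l i j] that by simp
  ultimately show False
    using z nl
    by (intro indecomposableD[OF ind S, where P = "0\<^sub>m m m" and Q = "0\<^sub>m n n" and T = "1\<^sub>m l"]) auto
qed

lemma scalar_mat_carrier: "scalar_mat c \<in> carrier_mat (Suc 0) (Suc 0)"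
  by (simp add: scalar_mat_def)

lemma scalar_mat_index: "scalar_mat c $$ (0, 0) = c"
  by (simp add: scalar_mat_def)

lemma scalar_mat_GL: "c \<noteq> 0 \<Longrightarrow> scalar_mat c \<in> GL (Suc 0)"
  by (rule GL_triangularI) (auto simp: scalar_mat_carrier scalar_mat_index)

abbreviation M2 :: "complex \<Rightarrow> complex \<Rightarrow> complex \<Rightarrow> complex \<Rightarrow> complex mat" where
  "M2 a b c d \<equiv> mat_of_rows_list 2 [[a, b], [c, d]]"

abbreviation M3 :: "complex \<Rightarrow> complex \<Rightarrow> complex \<Rightarrow> complex \<Rightarrow> complex \<Rightarrow> complex \<Rightarrow> complex \<Rightarrow> complex \<Rightarrow> complex \<Rightarrow> complex mat" where
  "M3 a b c d e f g h i \<equiv> mat_of_rows_list 3 [[a, b, c], [d, e, f], [g, h, i]]"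

lemma rows_carrier: "M2 a b c d \<in> carrier_mat 2 2" "M3 a b c d e f g h i \<in> carrier_mat 3 3"
  by (auto simp: mat_of_rows_list_def numeral_2_eq_2 numeral_3_eq_3)

lemma rows_index:
  "i < 2 \<Longrightarrow> j < 2 \<Longrightarrow> M2 a b c d $$ (i, j) = [[a, b], [c, d]] ! i ! j"
  "i < 3 \<Longrightarrow> j < 3 \<Longrightarrow> M3 a b c d e f g h k $$ (i, j) = [[a, b, c], [d, e, f], [g, h, k]] ! i ! j"
  by (simp_all add: mat_of_rows_list_def)

lemmas matrix_simps = all_less_small sum_small rows_carrier rows_index scalar_mat_carrier scalar_mat_index
  column_index row_mat_index diagonal_index block_sum_J_2_index listed_carrier commute_simps
  GL_one scalar_mat_GL

lemma M2_GL: "a \<noteq> 0 \<Longrightarrow> d \<noteq> 0 \<Longrightarrow> M2 a b 0 d \<in> GL 2"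
  by (rule GL_triangularI) (auto simp: matrix_simps)

lemma M3_GL: "a \<noteq> 0 \<Longrightarrow> e \<noteq> 0 \<Longrightarrow> i \<noteq> 0 \<Longrightarrow> M3 a b c 0 e f 0 0 i \<in> GL 3"
  by (rule GL_triangularI) (auto simp: matrix_simps)

lemmas GL_simps = M2_GL M3_GL

subsection \<open>One state\<close>

lemma classify_110:
  assumes S: "(diagonal [a], B, C) \<in> systems 1 1 0" and ind: "indecomposable 1 1 0 (diagonal [a], B, C)"
  shows "classified 1 1 0 (diagonal [a]) B C"
proof -
  have "B $$ (0, 0) \<noteq> 0"
    using input_nonzero[OF ind S] by (auto simp: all_less_small)
  then show ?thesis
    by (intro listedI[OF listed_form.intros(1) S, where X = "scalar_mat (B $$ (0, 0))" and Y = "1\<^sub>m 1" and Z = "1\<^sub>m 0"])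
      (auto simp: matrix_simps)
qed

lemma classify_011:
  assumes S: "(diagonal [a], B, C) \<in> systems 0 1 1" and ind: "indecomposable 0 1 1 (diagonal [a], B, C)"
  shows "classified 0 1 1 (diagonal [a]) B C"
proof -
  have "C $$ (0, 0) \<noteq> 0"
    using output_nonzero[OF ind S] by (auto simp: all_less_small)
  then show ?thesis
    by (intro listedI[OF listed_form.intros(2) S, where X = "1\<^sub>m 0" and Y = "scalar_mat (C $$ (0, 0))" and Z = "1\<^sub>m 1"])
      (auto simp: matrix_simps)
qed

lemma classify_111:
  assumes S: "(diagonal [a], B, C) \<in> systems 1 1 1" and ind: "indecomposable 1 1 1 (diagonal [a], B, C)"
  shows "classified 1 1 1 (diagonal [a]) B C"
proof -
  have "B $$ (0, 0) \<noteq> 0" "C $$ (0, 0) \<noteq> 0"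
    using input_nonzero[OF ind S] output_nonzero[OF ind S] by (auto simp: all_less_small)
  \<comment> \<open>\<open>Y = c\<close> turns the output entry into 1 and scales the input entry to
    \<open>c * b\<close>, which \<open>X\<close> then normalizes.\<close>
  then show ?thesis
    by (intro listedI[OF listed_form.intros(3) S, where X = "scalar_mat (C $$ (0, 0) * B $$ (0, 0))"
          and Y = "scalar_mat (C $$ (0, 0))" and Z = "1\<^sub>m 1"])
      (auto simp: matrix_simps)
qed

text \<open>Several inputs into one state have a nonzero kernel vector. \<open>P\<close> projects
  onto its span, so \<open>B * P = 0\<close> and this input direction splits off; for three inputs
  the first two suffice.\<close>

lemma one_state_inputs:
  assumes S: "(A, B, C) \<in> systems m 1 l" and ind: "indecomposable m 1 l (A, B, C)"
  shows "m \<noteq> 2 \<and> m \<noteq> 3"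
proof -
  have A: "A \<in> carrier_mat (Suc 0) (Suc 0)"
    using S by (auto simp: systems_def)
  let ?b = "\<lambda>i. B $$ (0, i)"
  have "m \<noteq> 2"
  proof
    assume m: "m = 2"
    have "?b 0 \<noteq> 0"
      by (rule ccontr, rule indecomposableD[OF ind S, where P = "M2 1 0 0 0" and Q = "0\<^sub>m 1 1" and T = "0\<^sub>m l l"])
        (use A m in \<open>auto simp: matrix_simps\<close>)
    then show False
      by (intro indecomposableD[OF ind S, where P = "M2 0 (- ?b 1 / ?b 0) 0 1" and Q = "0\<^sub>m 1 1" and T = "0\<^sub>m l l"])
        (use A m in \<open>auto simp: matrix_simps\<close>)
  qed
  moreover have "m \<noteq> 3"
  proof
    assume m: "m = 3"
    have "?b 0 \<noteq> 0"
      by (rule ccontr, rule indecomposableD[OF ind S, where P = "M3 1 0 0 0 0 0 0 0 0" and Q = "0\<^sub>m 1 1" and T = "0\<^sub>m l l"])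
        (use A m in \<open>auto simp: matrix_simps\<close>)
    then show False
      by (intro indecomposableD[OF ind S, where P = "M3 0 (- ?b 1 / ?b 0) 0 0 1 0 0 0 0" and Q = "0\<^sub>m 1 1" and T = "0\<^sub>m l l"])
        (use A m in \<open>auto simp: matrix_simps\<close>)
  qed
  ultimately show ?thesis
    by simp
qed

text \<open>\<open>T\<close> is a rank one projection with \<open>T * C = 0\<close>, so an output
  direction that carries nothing splits off.\<close>

lemma one_state_outputs:
  assumes S: "(A, B, C) \<in> systems m 1 l" and ind: "indecomposable m 1 l (A, B, C)"
  shows "l \<noteq> 2 \<and> l \<noteq> 3"
proof -
  have A: "A \<in> carrier_mat (Suc 0) (Suc 0)"
    using S by (auto simp: systems_def)
  let ?c = "\<lambda>i. C $$ (i, 0)"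
  have "l \<noteq> 2"
  proof
    assume l: "l = 2"
    have "?c 0 \<noteq> 0"
      by (rule ccontr, rule indecomposableD[OF ind S, where P = "0\<^sub>m m m" and Q = "0\<^sub>m 1 1" and T = "M2 1 0 0 0"])
        (use A l in \<open>auto simp: matrix_simps\<close>)
    then show False
      by (intro indecomposableD[OF ind S, where P = "0\<^sub>m m m" and Q = "0\<^sub>m 1 1" and T = "M2 0 0 (- ?c 1 / ?c 0) 1"])
        (use A l in \<open>auto simp: matrix_simps\<close>)
  qed
  moreover have "l \<noteq> 3"
  proof
    assume l: "l = 3"
    have "?c 0 \<noteq> 0"
      by (rule ccontr, rule indecomposableD[OF ind S, where P = "0\<^sub>m m m" and Q = "0\<^sub>m 1 1" and T = "M3 1 0 0 0 0 0 0 0 0"])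
        (use A l in \<open>auto simp: matrix_simps\<close>)
    then show False
      by (intro indecomposableD[OF ind S, where P = "0\<^sub>m m m" and Q = "0\<^sub>m 1 1" and T = "M3 0 0 0 (- ?c 1 / ?c 0) 1 0 0 0 0"])
        (use A l in \<open>auto simp: matrix_simps\<close>)
  qed
  ultimately show ?thesis
    by simp
qed

subsection \<open>Two states\<close>

lemma classify_J_2_120:
  assumes S: "(J 2 a, B, C) \<in> systems 1 2 0" and ind: "indecomposable 1 2 0 (J 2 a, B, C)"
  shows "classified 1 2 0 (J 2 a) B C"
proof -
  let ?b = "\<lambda>i. B $$ (i, 0)"
  have "?b 0 \<noteq> 0 \<or> ?b 1 \<noteq> 0"
    using input_nonzero[OF ind S] by (auto simp: all_less_small)
  then consider "?b 1 \<noteq> 0" | "?b 1 = 0" "?b 0 \<noteq> 0"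
    by blast
  then show ?thesis
  proof cases
    case 1
    \<comment> \<open>\<open>Y\<close> is \<open>?b 1\<close> times the identity plus
      \<open>?b 0\<close> times the nilpotent part of the Jordan block; it commutes with
      \<open>J 2 a\<close> and its last column is \<open>B\<close>.\<close>
    then show ?thesis
      by (intro listedI'[OF listed_form.intros(4) S, where X = "1\<^sub>m 1" and Y = "M2 (?b 1) (?b 0) 0 (?b 1)" and Z = "1\<^sub>m 0"])
        (auto simp: matrix_simps GL_simps)
  next
    case 2
    then show ?thesis
      by (intro listedI'[OF listed_form.intros(5) S, where X = "1\<^sub>m 1" and Y = "M2 (?b 0) 0 0 (?b 0)" and Z = "1\<^sub>m 0"])
        (auto simp: matrix_simps GL_simps)
  qed
qed

lemma classify_J_2_021:
  assumes S: "(J 2 a, B, C) \<in> systems 0 2 1" and ind: "indecomposable 0 2 1 (J 2 a, B, C)"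
  shows "classified 0 2 1 (J 2 a) B C"
proof -
  let ?c = "\<lambda>i. C $$ (0, i)"
  have "?c 0 \<noteq> 0 \<or> ?c 1 \<noteq> 0"
    using output_nonzero[OF ind S] by (auto simp: all_less_small)
  then consider "?c 0 \<noteq> 0" | "?c 0 = 0" "?c 1 \<noteq> 0"
    by blast
  then show ?thesis
  proof cases
    case 1
    then show ?thesis
      by (intro listedI[OF listed_form.intros(7) S, where X = "1\<^sub>m 0" and Y = "M2 (?c 0) (?c 1) 0 (?c 0)" and Z = "1\<^sub>m 1"])
        (auto simp: matrix_simps GL_simps)
  next
    case 2
    then show ?thesis
      by (intro listedI[OF listed_form.intros(8) S, where X = "1\<^sub>m 0" and Y = "M2 (?c 1) 0 0 (?c 1)" and Z = "1\<^sub>m 1"])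
        (auto simp: matrix_simps GL_simps)
  qed
qed

text \<open>Covers equal eigenvalues as well, which the classification has to refute.\<close>

lemma commute_diagonal_2_iff:
  "Y \<in> carrier_mat 2 2 \<Longrightarrow> Y * diagonal [a, b] = diagonal [a, b] * Y \<longleftrightarrow>
    Y $$ (0, 1) * b = a * Y $$ (0, 1) \<and> Y $$ (1, 0) * a = b * Y $$ (1, 0)"
  by (subst mult_mat_eq_iff[OF _ listed_carrier(8) listed_carrier(8)])
    (auto simp: all_less_small sum_small diagonal_index)

lemma classify_diagonal_120:
  assumes S: "(diagonal [a, b], B, C) \<in> systems 1 2 0" and ind: "indecomposable 1 2 0 (diagonal [a, b], B, C)"
  shows "a \<noteq> b \<and> classified 1 2 0 (diagonal [a, b]) B C"
proof -
  let ?b = "\<lambda>i. B $$ (i, 0)"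
  note [simp] = commute_diagonal_2_iff
  have b0: "?b 0 \<noteq> 0"
    by (rule ccontr, rule indecomposableD[OF ind S, where P = "0\<^sub>m 1 1" and Q = "M2 1 0 0 0" and T = "0\<^sub>m 0 0"])
      (auto simp: matrix_simps)
  have b1: "?b 1 \<noteq> 0"
    by (rule ccontr, rule indecomposableD[OF ind S, where P = "0\<^sub>m 1 1" and Q = "M2 0 0 0 1" and T = "0\<^sub>m 0 0"])
      (auto simp: matrix_simps)
  \<comment> \<open>For \<open>a = b\<close> every matrix commutes with \<open>A\<close>.
    \<open>Q\<close> fixes \<open>B\<close> and kills the second basis vector, so a state without
    input splits off.\<close>
  have ab: "a \<noteq> b"
    by (rule notI, rule indecomposableD[OF ind S, where P = "1\<^sub>m 1" and Q = "M2 1 0 (?b 1 / ?b 0) 0" and T = "0\<^sub>m 0 0"])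
      (use b0 in \<open>auto simp: matrix_simps\<close>)
  have "classified 1 2 0 (diagonal [a, b]) B C"
    using b0 b1
    by (intro listedI'[OF listed_form.intros(6)[OF ab] S, where X = "1\<^sub>m 1" and Y = "M2 (?b 0) 0 0 (?b 1)" and Z = "1\<^sub>m 0"])
      (auto simp: matrix_simps GL_simps)
  with ab show ?thesis ..
qed

lemma classify_diagonal_021:
  assumes S: "(diagonal [a, b], B, C) \<in> systems 0 2 1" and ind: "indecomposable 0 2 1 (diagonal [a, b], B, C)"
  shows "a \<noteq> b \<and> classified 0 2 1 (diagonal [a, b]) B C"
proof -
  let ?c = "\<lambda>i. C $$ (0, i)"
  note [simp] = commute_diagonal_2_iff
  have c0: "?c 0 \<noteq> 0"
    by (rule ccontr, rule indecomposableD[OF ind S, where P = "0\<^sub>m 0 0" and Q = "M2 1 0 0 0" and T = "0\<^sub>m 1 1"])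
      (auto simp: matrix_simps)
  have c1: "?c 1 \<noteq> 0"
    by (rule ccontr, rule indecomposableD[OF ind S, where P = "0\<^sub>m 0 0" and Q = "M2 0 0 0 1" and T = "0\<^sub>m 1 1"])
      (auto simp: matrix_simps)
  \<comment> \<open>Here \<open>C * Q = C\<close>, and the kernel of \<open>Q\<close> is the kernel
    of \<open>C\<close>: a state without output splits off.\<close>
  have ab: "a \<noteq> b"
    by (rule notI, rule indecomposableD[OF ind S, where P = "0\<^sub>m 0 0" and Q = "M2 1 (?c 1 / ?c 0) 0 0" and T = "1\<^sub>m 1"])
      (use c0 in \<open>auto simp: matrix_simps\<close>)
  have "classified 0 2 1 (diagonal [a, b]) B C"
    using c0 c1
    by (intro listedI[OF listed_form.intros(9)[OF ab] S, where X = "1\<^sub>m 0" and Y = "M2 (?c 0) 0 0 (?c 1)" and Z = "1\<^sub>m 1"])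
      (auto simp: matrix_simps GL_simps)
  with ab show ?thesis ..
qed

lemma classify_J_2_121:
  assumes S: "(J 2 a, B, C) \<in> systems 1 2 1" and ind: "indecomposable 1 2 1 (J 2 a, B, C)"
  shows "classified 1 2 1 (J 2 a) B C"
proof -
  let ?b = "\<lambda>i. B $$ (i, 0)" and ?c = "\<lambda>i. C $$ (0, i)"
  have "?b 0 \<noteq> 0 \<or> ?b 1 \<noteq> 0" "?c 0 \<noteq> 0 \<or> ?c 1 \<noteq> 0"
    using input_nonzero[OF ind S] output_nonzero[OF ind S] by (auto simp: all_less_small)
  then consider "?b 1 \<noteq> 0" "?c 0 \<noteq> 0" | "?b 1 \<noteq> 0" "?c 0 = 0" "?c 1 \<noteq> 0"
    | "?b 1 = 0" "?b 0 \<noteq> 0" "?c 0 \<noteq> 0" | "?b 1 = 0" "?b 0 \<noteq> 0" "?c 0 = 0" "?c 1 \<noteq> 0"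
    by blast
  then show ?thesis
  proof cases
    case 1
    \<comment> \<open>With this \<open>Y\<close>, \<open>C * Y\<close> has entries
      \<open>?c 0 * ?b 1\<close> and \<open>?c 0 * ?b 0 + ?c 1 * ?b 1\<close>; dividing by the first
      one gives the parameter.\<close>
    then show ?thesis
      by (intro listedI'[OF listed_form.intros(10)[of a "(?c 0 * ?b 0 + ?c 1 * ?b 1) / (?c 0 * ?b 1)"] S,
            where X = "1\<^sub>m 1" and Y = "M2 (?b 1) (?b 0) 0 (?b 1)" and Z = "scalar_mat (?c 0 * ?b 1)"])
        (auto simp: matrix_simps GL_simps)
  next
    case 2
    then show ?thesis
      by (intro listedI'[OF listed_form.intros(11) S, where X = "1\<^sub>m 1" and Y = "M2 (?b 1) (?b 0) 0 (?b 1)" and Z = "scalar_mat (?c 1 * ?b 1)"])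
        (auto simp: matrix_simps GL_simps)
  next
    case 3
    then show ?thesis
      by (intro listedI[OF listed_form.intros(12) S, where X = "scalar_mat (?c 0 * ?b 0)" and Y = "M2 (?c 0) (?c 1) 0 (?c 0)" and Z = "1\<^sub>m 1"])
        (auto simp: matrix_simps GL_simps)
  next
    case 4
    then show ?thesis
      by (intro listedI[OF listed_form.intros(13) S, where X = "scalar_mat (?c 1 * ?b 0)" and Y = "M2 (?c 1) 0 0 (?c 1)" and Z = "1\<^sub>m 1"])
        (auto simp: matrix_simps GL_simps)
  qed
qed

lemma classify_diagonal_121:
  assumes S: "(diagonal [a, b], B, C) \<in> systems 1 2 1" and ind: "indecomposable 1 2 1 (diagonal [a, b], B, C)"
  shows "a \<noteq> b \<and> classified 1 2 1 (diagonal [a, b]) B C"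
proof -
  let ?b = "\<lambda>i. B $$ (i, 0)" and ?c = "\<lambda>i. C $$ (0, i)"
  note [simp] = commute_diagonal_2_iff
  have nz: "?b 0 \<noteq> 0 \<or> ?b 1 \<noteq> 0" "?c 0 \<noteq> 0 \<or> ?c 1 \<noteq> 0"
    using input_nonzero[OF ind S] output_nonzero[OF ind S] by (auto simp: all_less_small)
  have ab: "a \<noteq> b"
  proof
    assume ab: "a = b"
    \<comment> \<open>\<open>d\<close> is the scalar \<open>C * B\<close>. When \<open>A\<close> is
      scalar, it decides whether input and output meet in a common one-dimensional summand.\<close>
    define d where "d = ?c 0 * ?b 0 + ?c 1 * ?b 1"
    consider "d \<noteq> 0" | "d = 0" "?b 0 \<noteq> 0" | "d = 0" "?b 1 \<noteq> 0"
      using nz by blast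
    then show False
    proof cases
      case 1
      \<comment> \<open>\<open>B * C / d\<close>, the projection onto the image of \<open>B\<close>
        along the kernel of \<open>C\<close>. Its trace is 1, so it cannot be the identity although
        \<open>P\<close> and \<open>T\<close> are.\<close>
      let ?Q = "M2 (?b 0 * ?c 0 / d) (?b 0 * ?c 1 / d) (?b 1 * ?c 0 / d) (?b 1 * ?c 1 / d)"
      have Q: "?Q * diagonal [a, b] = diagonal [a, b] * ?Q"
        by (simp add: matrix_simps ab)
      have tr: "?b 0 * ?c 0 / d + ?b 1 * ?c 1 / d = 1"
      proof -
        have "?b 0 * ?c 0 + ?b 1 * ?c 1 = d"
          by (simp add: d_def mult.commute)
        then show ?thesis
          using 1 by (simp add: add_divide_distrib[symmetric])
      qed
      show False
      proof (rule indecomposableD[OF ind S _ _ _ Q, where P = "1\<^sub>m 1" and T = "1\<^sub>m 1"])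
        show "\<forall>i < 2. \<forall>j < 2. (\<Sum>k = 0..<2. ?Q $$ (i, k) *
            ?Q $$ (k, j)) = ?Q $$ (i, j)"
          using 1 by (simp add: matrix_simps field_simps) (simp add: d_def algebra_simps)
        show "\<forall>i < 2. \<forall>j < 1. (\<Sum>k = 0..<2. ?Q $$ (i, k) * B $$ (k, j)) =
            (\<Sum>k = 0..<1. B $$ (i, k) * 1\<^sub>m 1 $$ (k, j))"
          using 1 by (simp add: matrix_simps field_simps) (simp add: d_def algebra_simps)
        show "\<forall>i < 1. \<forall>j < 2. (\<Sum>k = 0..<1. 1\<^sub>m 1 $$ (i, k) * C $$ (k, j)) =
            (\<Sum>k = 0..<2. C $$ (i, k) * ?Q $$ (k, j))"
          using 1 by (simp add: matrix_simps field_simps) (simp add: d_def algebra_simps)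
        fix t :: complex assume "t \<in> {0, 1}"
        then show "\<not> ((\<forall>i < 1. 1\<^sub>m 1 $$ (i, i) = t) \<and>
            (\<forall>i < 2. ?Q $$ (i, i) = t) \<and>
            (\<forall>i < 1. 1\<^sub>m 1 $$ (i, i) = t))"
          using tr by (auto simp: matrix_simps)
      qed (auto simp: matrix_simps)
    next
      case 2
      \<comment> \<open>Now \<open>C\<close> vanishes on the image of \<open>B\<close>.
        \<open>Q\<close> projects onto that image, which together with the input forms a summand
        without output; hence \<open>T = 0\<close>.\<close>
      then have c0: "?c 0 = - ?c 1 * ?b 1 / ?b 0"
        by (simp add: d_def field_simps add_eq_0_iff)
      show False
        by (rule indecomposableD[OF ind S, where P = "1\<^sub>m 1" and Q = "M2 1 0 (?b 1 / ?b 0) 0" and T = "0\<^sub>m 1 1"])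
          (use 2 ab c0 in \<open>auto simp: matrix_simps\<close>)
    next
      case 3
      then have c1: "?c 1 = - ?c 0 * ?b 0 / ?b 1"
        by (simp add: d_def field_simps add_eq_0_iff)
      show False
        by (rule indecomposableD[OF ind S, where P = "1\<^sub>m 1" and Q = "M2 0 (?b 0 / ?b 1) 0 1" and T = "0\<^sub>m 1 1"])
          (use 3 ab c1 in \<open>auto simp: matrix_simps\<close>)
    qed
  qed
  consider "?b 0 \<noteq> 0" "?b 1 \<noteq> 0" "?c 0 \<noteq> 0" | "?b 0 \<noteq> 0" "?b 1 \<noteq> 0" "?c 0 = 0" "?c 1 \<noteq> 0"
    | "?b 0 = 0" "?b 1 \<noteq> 0" | "?b 0 \<noteq> 0" "?b 1 = 0"
    using nz by blast
  then have "classified 1 2 1 (diagonal [a, b]) B C"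
  proof cases
    case 1
    then show ?thesis
      by (intro listedI'[OF listed_form.intros(14)[OF ab, of "?c 1 * ?b 1 / (?c 0 * ?b 0)"] S,
            where X = "1\<^sub>m 1" and Y = "M2 (?b 0) 0 0 (?b 1)" and Z = "scalar_mat (?c 0 * ?b 0)"])
        (auto simp: matrix_simps GL_simps)
  next
    case 2
    then show ?thesis
      by (intro listedI'[OF listed_form.intros(15)[OF ab] S,
            where X = "1\<^sub>m 1" and Y = "M2 (?b 0) 0 0 (?b 1)" and Z = "scalar_mat (?c 1 * ?b 1)"])
        (auto simp: matrix_simps GL_simps)
  next
    case 3
    have "?c 0 \<noteq> 0"
      by (rule ccontr, rule indecomposableD[OF ind S, where P = "0\<^sub>m 1 1" and Q = "M2 1 0 0 0" and T = "0\<^sub>m 1 1"])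
        (use 3 in \<open>auto simp: matrix_simps\<close>)
    moreover have "?c 1 \<noteq> 0"
      by (rule ccontr, rule indecomposableD[OF ind S, where P = "1\<^sub>m 1" and Q = "M2 0 0 0 1" and T = "0\<^sub>m 1 1"])
        (use 3 in \<open>auto simp: matrix_simps\<close>)
    ultimately show ?thesis
      using 3
      by (intro listedI[OF listed_form.intros(16)[OF ab] S,
            where X = "scalar_mat (?c 1 * ?b 1)" and Y = "M2 (?c 0) 0 0 (?c 1)" and Z = "1\<^sub>m 1"])
        (auto simp: matrix_simps GL_simps)
  next
    case 4
    have "?c 1 \<noteq> 0"
      by (rule ccontr, rule indecomposableD[OF ind S, where P = "0\<^sub>m 1 1" and Q = "M2 0 0 0 1" and T = "0\<^sub>m 1 1"])
        (use 4 in \<open>auto simp: matrix_simps\<close>)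
    moreover have "?c 0 \<noteq> 0"
      by (rule ccontr, rule indecomposableD[OF ind S, where P = "1\<^sub>m 1" and Q = "M2 1 0 0 0" and T = "0\<^sub>m 1 1"])
        (use 4 in \<open>auto simp: matrix_simps\<close>)
    ultimately show ?thesis
      using 4
      by (intro listedI[OF listed_form.intros(17)[OF ab] S,
            where X = "scalar_mat (?c 0 * ?b 0)" and Y = "M2 (?c 0) 0 0 (?c 1)" and Z = "1\<^sub>m 1"])
        (auto simp: matrix_simps GL_simps)
  qed
  with ab show ?thesis ..
qed

section \<open>Two states with two inputs or two outputs\<close>

lemma GL_2I:
  assumes c: "X \<in> carrier_mat 2 2" and d: "X $$ (0, 0) * X $$ (1, 1) \<noteq> X $$ (0, 1) * X $$ (1, 0)"
  shows "X \<in> GL 2"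
proof -
  define d where "d = X $$ (0, 0) * X $$ (1, 1) - X $$ (0, 1) * X $$ (1, 0)"
  have "d \<noteq> 0"
    using assms(2) by (simp add: d_def)
  moreover have "d / d = 1"
    using \<open>d \<noteq> 0\<close> by simp
  \<comment> \<open>The inverse is the adjugate divided by the determinant.\<close>
  ultimately have "X * M2 (X $$ (1, 1) / d) (- X $$ (0, 1) / d) (- X $$ (1, 0) / d) (X $$ (0, 0) / d) = 1\<^sub>m 2 * 1\<^sub>m 2"
    by (subst mult_mat_eq_iff[OF c rows_carrier(1) one_carrier_mat one_carrier_mat],
        simp add: matrix_simps diff_divide_distrib[symmetric] mult.commute) (simp add: d_def)
  then show ?thesis
    using GL_I[OF c rows_carrier(1)] by simp
qed

text \<open>If \<open>B\<close> is singular, the projection \<open>P\<close> onto a line in its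
  kernel satisfies \<open>B * P = 0\<close>, so this input direction splits off. The cases locate a
  kernel vector.\<close>

lemma input_invertible:
  assumes S: "(A, B, C) \<in> systems 2 2 l" and ind: "indecomposable 2 2 l (A, B, C)"
  shows "B \<in> GL 2"
proof (rule GL_2I)
  have A: "A \<in> carrier_mat 2 2"
    using S by (auto simp: systems_def)
  show "B \<in> carrier_mat 2 2"
    using S by (auto simp: systems_def)
  show "B $$ (0, 0) * B $$ (1, 1) \<noteq> B $$ (0, 1) * B $$ (1, 0)"
  proof
    assume d: "B $$ (0, 0) * B $$ (1, 1) = B $$ (0, 1) * B $$ (1, 0)"
    consider "B $$ (0, 0) \<noteq> 0" | "B $$ (0, 0) = 0" "B $$ (1, 0) \<noteq> 0" | "B $$ (0, 0) = 0" "B $$ (1, 0) = 0"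
      by blast
    then show False
    proof cases
      case 1
      then show False
        using d A
        by (intro indecomposableD[OF ind S, where P = "M2 0 (- B $$ (0, 1) / B $$ (0, 0)) 0 1" and Q = "0\<^sub>m 2 2" and T = "0\<^sub>m l l"])
          (auto simp: matrix_simps field_simps)
    next
      case 2
      then show False
        using d A
        by (intro indecomposableD[OF ind S, where P = "M2 0 (- B $$ (1, 1) / B $$ (1, 0)) 0 1" and Q = "0\<^sub>m 2 2" and T = "0\<^sub>m l l"])
          (auto simp: matrix_simps field_simps)
    next
      case 3
      then show False
        using A
        by (intro indecomposableD[OF ind S, where P = "M2 1 0 0 0" and Q = "0\<^sub>m 2 2" and T = "0\<^sub>m l l"])
          (auto simp: matrix_simps)
    qed
  qed
qed

text \<open>If \<open>C\<close> is singular, there is a rank one projection \<open>T\<close> with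
  \<open>T * C = 0\<close>; it splits off an output.\<close>

lemma output_invertible:
  assumes S: "(A, B, C) \<in> systems m 2 2" and ind: "indecomposable m 2 2 (A, B, C)"
  shows "C \<in> GL 2"
proof (rule GL_2I)
  have A: "A \<in> carrier_mat 2 2"
    using S by (auto simp: systems_def)
  show "C \<in> carrier_mat 2 2"
    using S by (auto simp: systems_def)
  show "C $$ (0, 0) * C $$ (1, 1) \<noteq> C $$ (0, 1) * C $$ (1, 0)"
  proof
    assume d: "C $$ (0, 0) * C $$ (1, 1) = C $$ (0, 1) * C $$ (1, 0)"
    consider "C $$ (0, 0) \<noteq> 0" | "C $$ (0, 0) = 0" "C $$ (0, 1) \<noteq> 0" | "C $$ (0, 0) = 0" "C $$ (0, 1) = 0"
      by blast
    then show False
    proof cases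
      case 1
      then show False
        using d A
        by (intro indecomposableD[OF ind S, where T = "M2 0 0 (- C $$ (1, 0) / C $$ (0, 0)) 1" and Q = "0\<^sub>m 2 2" and P = "0\<^sub>m m m"])
          (auto simp: matrix_simps field_simps)
    next
      case 2
      then show False
        using d A
        by (intro indecomposableD[OF ind S, where T = "M2 0 0 (- C $$ (1, 1) / C $$ (0, 1)) 1" and Q = "0\<^sub>m 2 2" and P = "0\<^sub>m m m"])
          (auto simp: matrix_simps field_simps)
    next
      case 3
      then show False
        using A
        by (intro indecomposableD[OF ind S, where T = "M2 1 0 0 0" and Q = "0\<^sub>m 2 2" and P = "0\<^sub>m m m"])
          (auto simp: matrix_simps)
    qed
  qed
qed

lemma classify_J_2_220:
  assumes S: "(J 2 a, B, C) \<in> systems 2 2 0" and ind: "indecomposable 2 2 0 (J 2 a, B, C)"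
  shows "classified 2 2 0 (J 2 a) B C"
  using input_invertible[OF S ind]
  by (intro listedI[OF listed_form.intros(31) S, where X = B and Y = "1\<^sub>m 2" and Z = "1\<^sub>m 0"])
    (auto simp: matrix_simps)

lemma classify_J_2_022:
  assumes S: "(J 2 a, B, C) \<in> systems 0 2 2" and ind: "indecomposable 0 2 2 (J 2 a, B, C)"
  shows "classified 0 2 2 (J 2 a) B C"
  using output_invertible[OF S ind]
  by (intro listedI'[OF listed_form.intros(30) S, where X = "1\<^sub>m 0" and Y = "1\<^sub>m 2" and Z = C])
    (auto simp: matrix_simps)

text \<open>The projection \<open>Q\<close> onto the first coordinate commutes with the diagonal
  matrix. Invertibility of \<open>B\<close> lets it be transported to the inputs, as
  \<open>P = inv_mat B * Q * B\<close>.\<close>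

lemma diagonal_220_decomposable:
  assumes S: "(diagonal [a, b], B, C) \<in> systems 2 2 0"
  shows "\<not> indecomposable 2 2 0 (diagonal [a, b], B, C)"
proof
  assume ind: "indecomposable 2 2 0 (diagonal [a, b], B, C)"
  have B: "B \<in> GL 2"
    by (rule input_invertible[OF S ind])
  let ?Q = "M2 1 0 0 0" and ?V = "inv_mat B"
  have c: "B \<in> carrier_mat 2 2" "?V \<in> carrier_mat 2 2" "C \<in> carrier_mat 0 2"
    using B GL_carrier inv_mat_carrier S by (auto simp: systems_def)
  note Q = rows_carrier(1)[of 1 0 0 0]
  have QQ: "?Q * ?Q = ?Q"
    unfolding mat_eq_iff_entries[OF mult_carrier_mat[OF Q Q] Q]
    by (simp add: mult_mat_index[OF Q Q] matrix_simps del: index_mult_mat(1))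
  have BP: "B * (?V * (?Q * B)) = ?Q * B"
    using c Q inv_mat(2)[OF B] by (simp add: assoc_mult_mat[of B 2 2 ?V 2 _ 2, symmetric])
  have "?V * (?Q * B) * (?V * (?Q * B)) = ?V * (?Q * (B * (?V * (?Q * B))))"
    using c Q by (simp add: assoc_mult_mat[of _ 2 2 _ 2 _ 2])
  also have "\<dots> = ?V * ((?Q * ?Q) * B)"
    unfolding BP using c Q by (simp add: assoc_mult_mat[of _ 2 2 _ 2 _ 2])
  finally have PP: "?V * (?Q * B) * (?V * (?Q * B)) = ?V * (?Q * B)"
    unfolding QQ .
  have "idempotent_endo 2 2 0 (diagonal [a, b], B, C) (?V * (?Q * B), ?Q, 0\<^sub>m 0 0)"
  proof -
    have "?Q * diagonal [a, b] = diagonal [a, b] * ?Q"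
      by (simp add: commute_diagonal_2_iff[OF Q] matrix_simps)
    moreover have "0\<^sub>m 0 0 * C = C * ?Q"
      by (rule eq_matI) (use c carrier_matD[OF Q] in auto)
    ultimately show ?thesis
      unfolding idempotent_endo_def using PP QQ BP c Q by simp
  qed
  moreover have "?Q \<noteq> 0\<^sub>m 2 2" "?Q \<noteq> 1\<^sub>m 2"
    by (auto simp: mat_eq_iff_entries[OF Q zero_carrier_mat] mat_eq_iff_entries[OF Q one_carrier_mat] matrix_simps)
  ultimately show False
    using decomposable_if_idempotent[OF S] ind by blast
qed

text \<open>The same coordinate projection, transported to the outputs as
  \<open>T = C * Q * inv_mat C\<close>.\<close>

lemma diagonal_022_decomposable:
  assumes S: "(diagonal [a, b], B, C) \<in> systems 0 2 2"
  shows "\<not> indecomposable 0 2 2 (diagonal [a, b], B, C)"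
proof
  assume ind: "indecomposable 0 2 2 (diagonal [a, b], B, C)"
  have C: "C \<in> GL 2"
    by (rule output_invertible[OF S ind])
  let ?Q = "M2 1 0 0 0" and ?V = "inv_mat C"
  have c: "C \<in> carrier_mat 2 2" "?V \<in> carrier_mat 2 2" "B \<in> carrier_mat 2 0"
    using C GL_carrier inv_mat_carrier S by (auto simp: systems_def)
  note Q = rows_carrier(1)[of 1 0 0 0]
  have QQ: "?Q * ?Q = ?Q"
    unfolding mat_eq_iff_entries[OF mult_carrier_mat[OF Q Q] Q]
    by (simp add: mult_mat_index[OF Q Q] matrix_simps del: index_mult_mat(1))
  have TC: "C * ?Q * ?V * C = C * ?Q"
  proof -
    have "C * ?Q * ?V * C = C * ?Q * (?V * C)"
      by (rule assoc_mult_mat[of _ 2 2 _ 2 _ 2]) (use c Q in auto)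
    then show ?thesis
      using c Q inv_mat(3)[OF C] by simp
  qed
  have "C * ?Q * ?V * (C * ?Q * ?V) = (C * ?Q * ?V * C) * (?Q * ?V)"
    using c Q by (simp add: assoc_mult_mat[of _ 2 2 _ 2 _ 2])
  also have "\<dots> = C * (?Q * ?Q) * ?V"
    unfolding TC using c Q by (simp add: assoc_mult_mat[of _ 2 2 _ 2 _ 2])
  finally have TT: "C * ?Q * ?V * (C * ?Q * ?V) = C * ?Q * ?V"
    unfolding QQ .
  have "idempotent_endo 0 2 2 (diagonal [a, b], B, C) (0\<^sub>m 0 0, ?Q, C * ?Q * ?V)"
  proof -
    have "?Q * diagonal [a, b] = diagonal [a, b] * ?Q"
      by (simp add: commute_diagonal_2_iff[OF Q] matrix_simps)
    moreover have "?Q * B = B * 0\<^sub>m 0 0"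
      by (rule eq_matI) (use c carrier_matD[OF Q] in auto)
    moreover have "C * ?Q * ?V \<in> carrier_mat 2 2"
      using c Q by simp
    ultimately show ?thesis
      unfolding idempotent_endo_def using TT QQ TC Q by (simp del: assoc_mult_mat)
  qed
  moreover have "?Q \<noteq> 0\<^sub>m 2 2" "?Q \<noteq> 1\<^sub>m 2"
    by (auto simp: mat_eq_iff_entries[OF Q zero_carrier_mat] mat_eq_iff_entries[OF Q one_carrier_mat] matrix_simps)
  ultimately show False
    using decomposable_if_idempotent[OF S] ind by blast
qed

subsection \<open>Three states\<close>

lemma commute_diagonal_3_iff:
  "Y \<in> carrier_mat 3 3 \<Longrightarrow> Y * diagonal [a, b, c] = diagonal [a, b, c] * Y \<longleftrightarrow>
    Y $$ (0, 1) * b = a * Y $$ (0, 1) \<and> Y $$ (0, 2) * c = a * Y $$ (0, 2) \<and>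
    Y $$ (1, 0) * a = b * Y $$ (1, 0) \<and> Y $$ (1, 2) * c = b * Y $$ (1, 2) \<and>
    Y $$ (2, 0) * a = c * Y $$ (2, 0) \<and> Y $$ (2, 1) * b = c * Y $$ (2, 1)"
  by (subst mult_mat_eq_iff[OF _ listed_carrier(9) listed_carrier(9)])
    (auto simp: all_less_small sum_small diagonal_index)

text \<open>Compared with different eigenvalues, the entries \<open>Y $$ (0, 2)\<close> and
  \<open>Y $$ (2, 1)\<close>, the maps between the two Jordan chains, become free. The idempotents
  that refute \<open>a = b\<close> rely on them.\<close>

lemma commute_J_2_diagonal_equal:
  assumes "Y \<in> carrier_mat 3 3"
  shows "Y * block_sum (J 2 a) (diagonal [a]) = block_sum (J 2 a) (diagonal [a]) * Y \<longleftrightarrow>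
    Y $$ (1, 0) = 0 \<and> Y $$ (1, 1) = Y $$ (0, 0) \<and> Y $$ (1, 2) = 0 \<and> Y $$ (2, 0) = 0"
  using assms
  by (subst mult_mat_eq_iff[OF _ listed_carrier(10) listed_carrier(10)])
    (auto simp: all_less_small sum_small block_sum_J_2_index algebra_simps)

lemma classify_J_3_130:
  assumes S: "(J 3 a, B, C) \<in> systems 1 3 0" and ind: "indecomposable 1 3 0 (J 3 a, B, C)"
  shows "classified 1 3 0 (J 3 a) B C"
proof -
  let ?b = "\<lambda>i. B $$ (i, 0)"
  have "?b 0 \<noteq> 0 \<or> ?b 1 \<noteq> 0 \<or> ?b 2 \<noteq> 0"
    using input_nonzero[OF ind S] by (auto simp: all_less_small)
  then consider "?b 2 \<noteq> 0" | "?b 2 = 0" "?b 1 \<noteq> 0" | "?b 2 = 0" "?b 1 = 0" "?b 0 \<noteq> 0"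
    by blast
  then show ?thesis
  proof cases
    case 1
    \<comment> \<open>\<open>Y\<close> is the upper triangular Toeplitz matrix with last column
      \<open>B\<close>, a polynomial in the Jordan block; the other cases shift this
      pattern.\<close>
    then show ?thesis
      by (intro listedI'[OF listed_form.intros(18) S, where X = "1\<^sub>m 1"
            and Y = "M3 (?b 2) (?b 1) (?b 0) 0 (?b 2) (?b 1) 0 0 (?b 2)" and Z = "1\<^sub>m 0"])
        (auto simp: matrix_simps GL_simps)
  next
    case 2
    then show ?thesis
      by (intro listedI'[OF listed_form.intros(19) S, where X = "1\<^sub>m 1"
            and Y = "M3 (?b 1) (?b 0) 0 0 (?b 1) (?b 0) 0 0 (?b 1)" and Z = "1\<^sub>m 0"])
        (auto simp: matrix_simps GL_simps)
  next
    case 3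
    then show ?thesis
      by (intro listedI'[OF listed_form.intros(20) S, where X = "1\<^sub>m 1"
            and Y = "M3 (?b 0) 0 0 0 (?b 0) 0 0 0 (?b 0)" and Z = "1\<^sub>m 0"])
        (auto simp: matrix_simps GL_simps)
  qed
qed

lemma classify_J_3_031:
  assumes S: "(J 3 a, B, C) \<in> systems 0 3 1" and ind: "indecomposable 0 3 1 (J 3 a, B, C)"
  shows "classified 0 3 1 (J 3 a) B C"
proof -
  let ?c = "\<lambda>i. C $$ (0, i)"
  have "?c 0 \<noteq> 0 \<or> ?c 1 \<noteq> 0 \<or> ?c 2 \<noteq> 0"
    using output_nonzero[OF ind S] by (auto simp: all_less_small)
  then consider "?c 0 \<noteq> 0" | "?c 0 = 0" "?c 1 \<noteq> 0" | "?c 0 = 0" "?c 1 = 0" "?c 2 \<noteq> 0"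
    by blast
  then show ?thesis
  proof cases
    case 1
    \<comment> \<open>The upper triangular Toeplitz matrix whose first row is
      \<open>C\<close>.\<close>
    then show ?thesis
      by (intro listedI[OF listed_form.intros(24) S, where X = "1\<^sub>m 0"
            and Y = "M3 (?c 0) (?c 1) (?c 2) 0 (?c 0) (?c 1) 0 0 (?c 0)" and Z = "1\<^sub>m 1"])
        (auto simp: matrix_simps GL_simps)
  next
    case 2
    then show ?thesis
      by (intro listedI[OF listed_form.intros(25) S, where X = "1\<^sub>m 0"
            and Y = "M3 (?c 1) (?c 2) 0 0 (?c 1) (?c 2) 0 0 (?c 1)" and Z = "1\<^sub>m 1"])
        (auto simp: matrix_simps GL_simps)
  next
    case 3
    then show ?thesis
      by (intro listedI[OF listed_form.intros(26) S, where X = "1\<^sub>m 0"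
            and Y = "M3 (?c 2) 0 0 0 (?c 2) 0 0 0 (?c 2)" and Z = "1\<^sub>m 1"])
        (auto simp: matrix_simps GL_simps)
  qed
qed

lemma classify_J_2_diagonal_130:
  assumes S: "(block_sum (J 2 a) (diagonal [b]), B, C) \<in> systems 1 3 0"
    and ind: "indecomposable 1 3 0 (block_sum (J 2 a) (diagonal [b]), B, C)"
  shows "a \<noteq> b \<and> classified 1 3 0 (block_sum (J 2 a) (diagonal [b])) B C"
proof -
  let ?b = "\<lambda>i. B $$ (i, 0)"
  have ab: "a \<noteq> b"
  proof
    assume ab: "a = b"
    note [simp] = commute_J_2_diagonal_equal
    \<comment> \<open>In each case a nontrivial projection commuting with \<open>A\<close> fixes
      \<open>B\<close>. Its kernel is a summand without input: the single state in the outer cases,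
      the Jordan block of size 2 in the middle one.\<close>
    consider "?b 1 \<noteq> 0" | "?b 1 = 0" "?b 2 \<noteq> 0" | "?b 1 = 0" "?b 2 = 0"
      by blast
    then show False
    proof cases
      case 1
      then show False
        by (intro indecomposableD[OF ind S, where P = "1\<^sub>m 1" and Q = "M3 1 0 0 0 1 0 0 (?b 2 / ?b 1) 0" and T = "0\<^sub>m 0 0"])
          (use ab in \<open>auto simp: matrix_simps\<close>)
    next
      case 2
      then show False
        by (intro indecomposableD[OF ind S, where P = "1\<^sub>m 1" and Q = "M3 0 0 (?b 0 / ?b 2) 0 0 0 0 0 1" and T = "0\<^sub>m 0 0"])
          (use ab in \<open>auto simp: matrix_simps\<close>)
    next
      case 3
      then show False
        by (intro indecomposableD[OF ind S, where P = "1\<^sub>m 1" and Q = "M3 1 0 0 0 1 0 0 0 0" and T = "0\<^sub>m 0 0"])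
          (use ab in \<open>auto simp: matrix_simps\<close>)
    qed
  qed
  \<comment> \<open>Otherwise the eigenvalue \<open>b\<close> splits off as a system without input;
    the same argument for \<open>a\<close> follows.\<close>
  have b2: "?b 2 \<noteq> 0"
    by (rule ccontr, rule indecomposableD[OF ind S, where P = "0\<^sub>m 1 1" and Q = "M3 0 0 0 0 0 0 0 0 1" and T = "0\<^sub>m 0 0"])
      (use ab in \<open>auto simp: matrix_simps\<close>)
  have "\<not> (?b 0 = 0 \<and> ?b 1 = 0)"
    by (rule notI, rule indecomposableD[OF ind S, where P = "0\<^sub>m 1 1" and Q = "M3 1 0 0 0 1 0 0 0 0" and T = "0\<^sub>m 0 0"])
      (use ab in \<open>auto simp: matrix_simps\<close>)
  then consider "?b 1 \<noteq> 0" | "?b 1 = 0" "?b 0 \<noteq> 0"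
    by blast
  then have "classified 1 3 0 (block_sum (J 2 a) (diagonal [b])) B C"
  proof cases
    case 1
    then show ?thesis
      using b2 ab
      by (intro listedI'[OF listed_form.intros(21)[OF ab] S, where X = "1\<^sub>m 1"
            and Y = "M3 (?b 1) (?b 0) 0 0 (?b 1) 0 0 0 (?b 2)" and Z = "1\<^sub>m 0"])
        (auto simp: matrix_simps GL_simps)
  next
    case 2
    then show ?thesis
      using b2 ab
      by (intro listedI'[OF listed_form.intros(22)[OF ab] S, where X = "1\<^sub>m 1"
            and Y = "M3 (?b 0) 0 0 0 (?b 0) 0 0 0 (?b 2)" and Z = "1\<^sub>m 0"])
        (auto simp: matrix_simps GL_simps)
  qed
  with ab show ?thesis ..
qed

lemma classify_J_2_diagonal_031:
  assumes S: "(block_sum (J 2 a) (diagonal [b]), B, C) \<in> systems 0 3 1"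
    and ind: "indecomposable 0 3 1 (block_sum (J 2 a) (diagonal [b]), B, C)"
  shows "a \<noteq> b \<and> classified 0 3 1 (block_sum (J 2 a) (diagonal [b])) B C"
proof -
  let ?c = "\<lambda>i. C $$ (0, i)"
  have ab: "a \<noteq> b"
  proof
    assume ab: "a = b"
    note [simp] = commute_J_2_diagonal_equal
    \<comment> \<open>Dual projections, with \<open>C * Q = C\<close>: the kernel of
      \<open>Q\<close> is a summand without output.\<close>
    consider "?c 0 \<noteq> 0" | "?c 0 = 0" "?c 2 \<noteq> 0" | "?c 0 = 0" "?c 2 = 0"
      by blast
    then show False
    proof cases
      case 1
      then show False
        by (intro indecomposableD[OF ind S, where P = "0\<^sub>m 0 0" and Q = "M3 1 0 (?c 2 / ?c 0) 0 1 0 0 0 0" and T = "1\<^sub>m 1"])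
          (use ab in \<open>auto simp: matrix_simps\<close>)
    next
      case 2
      then show False
        by (intro indecomposableD[OF ind S, where P = "0\<^sub>m 0 0" and Q = "M3 0 0 0 0 0 0 0 (?c 1 / ?c 2) 1" and T = "1\<^sub>m 1"])
          (use ab in \<open>auto simp: matrix_simps\<close>)
    next
      case 3
      then show False
        by (intro indecomposableD[OF ind S, where P = "0\<^sub>m 0 0" and Q = "M3 1 0 0 0 1 0 0 0 0" and T = "1\<^sub>m 1"])
          (use ab in \<open>auto simp: matrix_simps\<close>)
    qed
  qed
  have c2: "?c 2 \<noteq> 0"
    by (rule ccontr, rule indecomposableD[OF ind S, where P = "0\<^sub>m 0 0" and Q = "M3 0 0 0 0 0 0 0 0 1" and T = "0\<^sub>m 1 1"])
      (use ab in \<open>auto simp: matrix_simps\<close>)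
  have "\<not> (?c 0 = 0 \<and> ?c 1 = 0)"
    by (rule notI, rule indecomposableD[OF ind S, where P = "0\<^sub>m 0 0" and Q = "M3 1 0 0 0 1 0 0 0 0" and T = "0\<^sub>m 1 1"])
      (use ab in \<open>auto simp: matrix_simps\<close>)
  then consider "?c 0 \<noteq> 0" | "?c 0 = 0" "?c 1 \<noteq> 0"
    by blast
  then have "classified 0 3 1 (block_sum (J 2 a) (diagonal [b])) B C"
  proof cases
    case 1
    then show ?thesis
      using c2 ab
      by (intro listedI[OF listed_form.intros(27)[OF ab] S, where X = "1\<^sub>m 0"
            and Y = "M3 (?c 0) (?c 1) 0 0 (?c 0) 0 0 0 (?c 2)" and Z = "1\<^sub>m 1"])
        (auto simp: matrix_simps GL_simps)
  next
    case 2
    then show ?thesis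
      using c2 ab
      by (intro listedI[OF listed_form.intros(28)[OF ab] S, where X = "1\<^sub>m 0"
            and Y = "M3 (?c 1) 0 0 0 (?c 1) 0 0 0 (?c 2)" and Z = "1\<^sub>m 1"])
        (auto simp: matrix_simps GL_simps)
  qed
  with ab show ?thesis ..
qed

lemma classify_diagonal_130:
  assumes S: "(diagonal [a, b, c], B, C) \<in> systems 1 3 0" and ind: "indecomposable 1 3 0 (diagonal [a, b, c], B, C)"
  shows "distinct [a, b, c] \<and> classified 1 3 0 (diagonal [a, b, c]) B C"
proof -
  let ?b = "\<lambda>i. B $$ (i, 0)"
  note [simp] = commute_diagonal_3_iff
  have b0: "?b 0 \<noteq> 0"
    by (rule ccontr, rule indecomposableD[OF ind S, where P = "0\<^sub>m 1 1" and Q = "M3 1 0 0 0 0 0 0 0 0" and T = "0\<^sub>m 0 0"])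
      (auto simp: matrix_simps)
  have b1: "?b 1 \<noteq> 0"
    by (rule ccontr, rule indecomposableD[OF ind S, where P = "0\<^sub>m 1 1" and Q = "M3 0 0 0 0 1 0 0 0 0" and T = "0\<^sub>m 0 0"])
      (auto simp: matrix_simps)
  have b2: "?b 2 \<noteq> 0"
    by (rule ccontr, rule indecomposableD[OF ind S, where P = "0\<^sub>m 1 1" and Q = "M3 0 0 0 0 0 0 0 0 1" and T = "0\<^sub>m 0 0"])
      (auto simp: matrix_simps)
  \<comment> \<open>For each coinciding pair of eigenvalues, \<open>Q\<close> fixes \<open>B\<close>
    and kills the later of the two basis vectors, so a state without input splits off.\<close>
  have ab: "a \<noteq> b"
    by (rule notI, rule indecomposableD[OF ind S, where P = "1\<^sub>m 1" and Q = "M3 1 0 0 (?b 1 / ?b 0) 0 0 0 0 1" and T = "0\<^sub>m 0 0"])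
      (use b0 in \<open>auto simp: matrix_simps\<close>)
  have ac: "a \<noteq> c"
    by (rule notI, rule indecomposableD[OF ind S, where P = "1\<^sub>m 1" and Q = "M3 1 0 0 0 1 0 (?b 2 / ?b 0) 0 0" and T = "0\<^sub>m 0 0"])
      (use b0 in \<open>auto simp: matrix_simps\<close>)
  have bc: "b \<noteq> c"
    by (rule notI, rule indecomposableD[OF ind S, where P = "1\<^sub>m 1" and Q = "M3 1 0 0 0 1 0 0 (?b 2 / ?b 1) 0" and T = "0\<^sub>m 0 0"])
      (use b1 in \<open>auto simp: matrix_simps\<close>)
  have "classified 1 3 0 (diagonal [a, b, c]) B C"
    using b0 b1 b2
    by (intro listedI'[OF listed_form.intros(23)[OF ab ac bc] S, where X = "1\<^sub>m 1"
          and Y = "M3 (?b 0) 0 0 0 (?b 1) 0 0 0 (?b 2)" and Z = "1\<^sub>m 0"])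
      (auto simp: matrix_simps GL_simps)
  then show ?thesis
    using ab ac bc by simp
qed

lemma classify_diagonal_031:
  assumes S: "(diagonal [a, b, c], B, C) \<in> systems 0 3 1" and ind: "indecomposable 0 3 1 (diagonal [a, b, c], B, C)"
  shows "distinct [a, b, c] \<and> classified 0 3 1 (diagonal [a, b, c]) B C"
proof -
  let ?c = "\<lambda>i. C $$ (0, i)"
  note [simp] = commute_diagonal_3_iff
  have c0: "?c 0 \<noteq> 0"
    by (rule ccontr, rule indecomposableD[OF ind S, where P = "0\<^sub>m 0 0" and Q = "M3 1 0 0 0 0 0 0 0 0" and T = "0\<^sub>m 1 1"])
      (auto simp: matrix_simps)
  have c1: "?c 1 \<noteq> 0"
    by (rule ccontr, rule indecomposableD[OF ind S, where P = "0\<^sub>m 0 0" and Q = "M3 0 0 0 0 1 0 0 0 0" and T = "0\<^sub>m 1 1"])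
      (auto simp: matrix_simps)
  have c2: "?c 2 \<noteq> 0"
    by (rule ccontr, rule indecomposableD[OF ind S, where P = "0\<^sub>m 0 0" and Q = "M3 0 0 0 0 0 0 0 0 1" and T = "0\<^sub>m 1 1"])
      (auto simp: matrix_simps)
  \<comment> \<open>For each coinciding pair, \<open>C * Q = C\<close> for a projection
    \<open>Q\<close> of rank 2; its kernel is a state without output.\<close>
  have ab: "a \<noteq> b"
    by (rule notI, rule indecomposableD[OF ind S, where P = "0\<^sub>m 0 0" and Q = "M3 1 (?c 1 / ?c 0) 0 0 0 0 0 0 1" and T = "1\<^sub>m 1"])
      (use c0 in \<open>auto simp: matrix_simps\<close>)
  have ac: "a \<noteq> c"
    by (rule notI, rule indecomposableD[OF ind S, where P = "0\<^sub>m 0 0" and Q = "M3 1 0 (?c 2 / ?c 0) 0 1 0 0 0 0" and T = "1\<^sub>m 1"])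
      (use c0 in \<open>auto simp: matrix_simps\<close>)
  have bc: "b \<noteq> c"
    by (rule notI, rule indecomposableD[OF ind S, where P = "0\<^sub>m 0 0" and Q = "M3 1 0 0 0 1 (?c 2 / ?c 1) 0 0 0" and T = "1\<^sub>m 1"])
      (use c1 in \<open>auto simp: matrix_simps\<close>)
  have "classified 0 3 1 (diagonal [a, b, c]) B C"
    using c0 c1 c2
    by (intro listedI[OF listed_form.intros(29)[OF ab ac bc] S, where X = "1\<^sub>m 0"
          and Y = "M3 (?c 0) 0 0 0 (?c 1) 0 0 0 (?c 2)" and Z = "1\<^sub>m 1"])
      (auto simp: matrix_simps GL_simps)
  then show ?thesis
    using ab ac bc by simp
qed

subsection \<open>Jordan data of small size\<close>

text \<open>Any ranking of the complex numbers is refined to a linear order, ties being broken by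
  the real and then the imaginary part. This makes any prescribed order of distinct eigenvalues
  available.\<close>

lemma ex_linear_order:
  fixes k :: "complex \<Rightarrow> nat"
  shows "\<exists>R. linear_order R \<and> (\<forall>x y. k x < k y \<longrightarrow> (x, y) \<in> R)"
proof -
  let ?R = "{(x, y). k x < k y \<or> k x = k y \<and> (Re x < Re y \<or> Re x = Re y \<and> Im x \<le> Im y)}"
  have "refl ?R" "trans ?R" "antisym ?R" "total ?R"
    by (auto simp: refl_on_def trans_def antisym_def total_on_def complex_eq_iff)
  then have "linear_order ?R"
    by (simp add: linear_order_on_def partial_order_on_def preorder_on_def)
  then show ?thesis
    by (intro exI[of _ ?R]) auto
qed

lemma jordan_matrix_single: "jordan_matrix [(k, a)] = J k a"
  unfolding jordan_matrix_Cons_block_sum jordan_matrix_Nil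
  by (rule eq_matI) (auto simp: block_sum_index)

lemma jordan_matrix_small:
  "jordan_matrix [(Suc 0, a)] = diagonal [a]"
  "jordan_matrix [(Suc 0, a), (Suc 0, b)] = diagonal [a, b]"
  "jordan_matrix [(Suc 0, a), (Suc 0, b), (Suc 0, c)] = diagonal [a, b, c]"
  "jordan_matrix [(2, a), (Suc 0, b)] = block_sum (J 2 a) (diagonal [b])"
  using jordan_matrix_diagonal[of "[a]"] jordan_matrix_diagonal[of "[a, b]"] jordan_matrix_diagonal[of "[a, b, c]"]
    jordan_matrix_diagonal[of "[b]"] jordan_matrix_Cons_block_sum[of "(2, a)" "[(Suc 0, b)]"] by simp_all

lemma jordan_data_small:
  "jordan_data R [(k, a)] \<longleftrightarrow> k \<noteq> 0"
  "jordan_data R [(Suc 0, a), (Suc 0, b)] \<longleftrightarrow> (a, b) \<in> R"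
  "jordan_data R [(Suc 0, a), (Suc 0, b), (Suc 0, c)] \<longleftrightarrow> (a, b) \<in> R \<and> (a, c) \<in> R \<and> (b, c) \<in> R"
  "jordan_data R [(2, a), (Suc 0, b)]"
  by (auto simp: jordan_data_def)

lemma weyr_order_small:
  "weyr_order [(Suc 0, a)] = [0..<Suc 0]"
  "weyr_order [(2, a)] = [0..<2]"
  "weyr_order [(3, a)] = [0..<3]"
  "a \<noteq> b \<Longrightarrow> weyr_order [(Suc 0, a), (Suc 0, b)] = [0..<2]"
  "a \<noteq> b \<Longrightarrow> weyr_order [(2, a), (Suc 0, b)] = [0..<3]"
  "a \<noteq> b \<Longrightarrow> a \<noteq> c \<Longrightarrow> b \<noteq> c \<Longrightarrow> weyr_order [(Suc 0, a), (Suc 0, b), (Suc 0, c)] = [0..<3]"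
  by (simp_all add: weyr_order_def numeral_2_eq_2 numeral_3_eq_3)

text \<open>Larger blocks come first, so for three states the sizes 1, 2 in this order do not
  occur.\<close>

lemma jordan_data_cases:
  assumes "jordan_data R nas" "sum_list (map fst nas) = n"
  shows "n = 1 \<Longrightarrow> \<exists>a. nas = [(1, a)]"
    "n = 2 \<Longrightarrow> (\<exists>a. nas = [(2, a)]) \<or> (\<exists>a b. nas = [(1, a), (1, b)])"
    "n = 3 \<Longrightarrow> (\<exists>a. nas = [(3, a)]) \<or> (\<exists>a b. nas = [(2, a), (1, b)]) \<or> (\<exists>a b c. nas = [(1, a), (1, b), (1, c)])"
proof -
  have pos: "\<forall>x \<in> set nas. fst x \<ge> 1"
    using assms(1) unfolding jordan_data_def by (metis One_nat_def Suc_leI bot_nat_0.not_eq_extremum image_eqI)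
  have len: "length nas \<le> n"
  proof -
    have "length xs \<le> sum_list (map fst xs)" if "\<forall>x \<in> set xs. fst x \<ge> 1" for xs :: "(nat \<times> complex) list"
      using that by (induction xs) auto
    then show ?thesis
      using pos assms(2) by blast
  qed
  consider "nas = []" | p a where "nas = [(p, a)]" | p a q b where "nas = [(p, a), (q, b)]"
    | p a q b r c where "nas = [(p, a), (q, b), (r, c)]" | "length nas > 3"
    by (cases nas rule: list.exhaust; metis (no_types) list.exhaust prod.exhaust list.size(3,4) add_Suc_right Suc_less_eq zero_less_Suc numeral_3_eq_3 add_0_right)
  note cs = this
  show "n = 1 \<Longrightarrow> \<exists>a. nas = [(1, a)]"
    using assms pos len by (cases rule: cs) auto
  show "n = 2 \<Longrightarrow> (\<exists>a. nas = [(2, a)]) \<or> (\<exists>a b. nas = [(1, a), (1, b)])"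
    using assms pos len by (cases rule: cs) auto
  show "n = 3 \<Longrightarrow> (\<exists>a. nas = [(3, a)]) \<or> (\<exists>a b. nas = [(2, a), (1, b)]) \<or> (\<exists>a b c. nas = [(1, a), (1, b), (1, c)])"
    using assms pos len by (cases rule: cs) (auto simp: jordan_data_def)
qed

definition admissible :: "complex rel \<Rightarrow> nat \<Rightarrow> (nat \<times> complex) list \<Rightarrow> bool" where
  "admissible R n nas \<longleftrightarrow> jordan_data R nas \<and> distinct (map snd nas) \<and> weyr_order nas = [0..<n]"

lemma ex_admissible:
  "\<exists>R nas. linear_order R \<and> admissible R 1 nas \<and> diagonal [a] = jordan_matrix nas"
  "\<exists>R nas. linear_order R \<and> admissible R 2 nas \<and> J 2 a = jordan_matrix nas"
  "\<exists>R nas. linear_order R \<and> admissible R 3 nas \<and> J 3 a = jordan_matrix nas"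
  "a \<noteq> b \<Longrightarrow> \<exists>R nas. linear_order R \<and> admissible R 2 nas \<and> diagonal [a, b] = jordan_matrix nas"
  "a \<noteq> b \<Longrightarrow> \<exists>R nas. linear_order R \<and> admissible R 3 nas \<and> block_sum (J 2 a) (diagonal [b]) = jordan_matrix nas"
  "a \<noteq> b \<Longrightarrow> a \<noteq> c \<Longrightarrow> b \<noteq> c \<Longrightarrow>
    \<exists>R nas. linear_order R \<and> admissible R 3 nas \<and> diagonal [a, b, c] = jordan_matrix nas"
proof -
  \<comment> \<open>The ranking puts \<open>a\<close> first, \<open>b\<close> second and all other
    numbers afterwards, so a third eigenvalue \<open>c\<close> comes last.\<close>
  obtain R where R: "linear_order R"
    "\<forall>x y. (if x = a then 0 else if x = b then 1 else 2 :: nat) < (if y = a then 0 else if y = b then 1 else 2) \<longrightarrow> (x, y) \<in> R"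
    using ex_linear_order[of "\<lambda>x. if x = a then 0 else if x = b then 1 else 2"] by auto
  show "\<exists>R nas. linear_order R \<and> admissible R 1 nas \<and> diagonal [a] = jordan_matrix nas"
    by (rule exI[of _ R], rule exI[of _ "[(Suc 0, a)]"])
      (simp add: R(1) admissible_def jordan_data_small weyr_order_small jordan_matrix_small)
  show "\<exists>R nas. linear_order R \<and> admissible R 2 nas \<and> J 2 a = jordan_matrix nas"
    by (rule exI[of _ R], rule exI[of _ "[(2, a)]"])
      (simp add: R(1) admissible_def jordan_data_small weyr_order_small jordan_matrix_single)
  show "\<exists>R nas. linear_order R \<and> admissible R 3 nas \<and> J 3 a = jordan_matrix nas"
    by (rule exI[of _ R], rule exI[of _ "[(3, a)]"])
      (simp add: R(1) admissible_def jordan_data_small weyr_order_small jordan_matrix_single)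
  show "\<exists>R nas. linear_order R \<and> admissible R 2 nas \<and> diagonal [a, b] = jordan_matrix nas" if "a \<noteq> b"
    by (rule exI[of _ R], rule exI[of _ "[(Suc 0, a), (Suc 0, b)]"])
      (use that R(2)[rule_format, of a b] in \<open>simp add: R(1) admissible_def jordan_data_small weyr_order_small jordan_matrix_small\<close>)
  show "\<exists>R nas. linear_order R \<and> admissible R 3 nas \<and> block_sum (J 2 a) (diagonal [b]) = jordan_matrix nas" if "a \<noteq> b"
    by (rule exI[of _ R], rule exI[of _ "[(2, a), (Suc 0, b)]"])
      (use that in \<open>simp add: R(1) admissible_def jordan_data_small weyr_order_small jordan_matrix_small\<close>)
  show "\<exists>R nas. linear_order R \<and> admissible R 3 nas \<and> diagonal [a, b, c] = jordan_matrix nas"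
    if "a \<noteq> b" "a \<noteq> c" "b \<noteq> c"
    by (rule exI[of _ R], rule exI[of _ "[(Suc 0, a), (Suc 0, b), (Suc 0, c)]"])
      (use that R(2)[rule_format, of a b] R(2)[rule_format, of a c] R(2)[rule_format, of b c]
        in \<open>simp add: R(1) admissible_def jordan_data_small weyr_order_small jordan_matrix_small\<close>)
qed

lemma listed_form_admissible:
  "listed_form m n l S \<Longrightarrow> \<exists>R nas. linear_order R \<and> admissible R n nas \<and> fst S = jordan_matrix nas"
  by (induction rule: listed_form.induct; unfold fst_conv; rule ex_admissible; assumption)

lemma indecomposable_cong:
  "equivalent m n l S S' \<Longrightarrow> indecomposable m n l S \<Longrightarrow> indecomposable m n l S'"
  unfolding indecomposable_def using equivalent_trans by blast

text \<open>The data are already sorted by \<open>R\<close>, so admissibility amounts to distinct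
  eigenvalues, which the case lemmas deliver together with the listed form.\<close>

lemma classify_jordan:
  assumes nas: "jordan_data R nas" "sum_list (map fst nas) = n"
    and S: "(jordan_matrix nas, B, C) \<in> systems m n l" and ind: "indecomposable m n l (jordan_matrix nas, B, C)"
    and size: "n \<noteq> 0" "m \<noteq> 0 \<or> l \<noteq> 0" "m + n + l \<le> 4"
  shows "admissible R n nas \<and> classified m n l (jordan_matrix nas) B C"
proof -
  consider "n = 1" | "n = 2" | "n = 3"
    using size by linarith
  then show ?thesis
  proof cases
    case 1
    then obtain a where a: "nas = [(Suc 0, a)]"
      using jordan_data_cases(1)[OF nas] by auto
    \<comment> \<open>One state tolerates at most one input and one output, although the size bound
      would allow up to three in total.\<close>
    have "m \<noteq> 2" "m \<noteq> 3" "l \<noteq> 2" "l \<noteq> 3"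
      using one_state_inputs[of "jordan_matrix nas" B C m l] one_state_outputs[of "jordan_matrix nas" B C m l]
        S ind unfolding 1 by auto
    then consider "m = 1" "l = 0" | "m = 0" "l = 1" | "m = 1" "l = 1"
      using size 1 by linarith
    then have "classified m n l (jordan_matrix nas) B C"
      using S ind classify_110[of a B C] classify_011[of a B C] classify_111[of a B C] 1
      by cases (simp_all add: a jordan_matrix_small)
    then show ?thesis
      using nas(1) 1 by (simp add: admissible_def a weyr_order_small)
  next
    case 2
    consider "m = 1" "l = 0" | "m = 0" "l = 1" | "m = 1" "l = 1" | "m = 2" "l = 0" | "m = 0" "l = 2"
      using size 2 by linarith
    note sizes = this
    from jordan_data_cases(2)[OF nas 2] consider a where "nas = [(2, a)]" | a b where "nas = [(Suc 0, a), (Suc 0, b)]"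
      by auto
    then show ?thesis
    proof cases
      case (1 a)
      have "classified m n l (jordan_matrix nas) B C"
        using S ind classify_J_2_120[of a B C] classify_J_2_021[of a B C] classify_J_2_121[of a B C]
          classify_J_2_220[of a B C] classify_J_2_022[of a B C] 2
        by (cases rule: sizes) (simp_all add: 1 jordan_matrix_single)
      then show ?thesis
        using nas(1) 1 2 by (simp add: admissible_def weyr_order_small)
    next
      case (2 a b)
      have "a \<noteq> b \<and> classified m n l (jordan_matrix nas) B C"
        using S ind classify_diagonal_120[of a b B C] classify_diagonal_021[of a b B C] classify_diagonal_121[of a b B C]
          diagonal_220_decomposable[of a b B C] diagonal_022_decomposable[of a b B C] \<open>n = 2\<close>
        by (cases rule: sizes) (simp_all add: 2 jordan_matrix_small)
      then show ?thesis
        using nas(1) 2 \<open>n = 2\<close> by (simp add: admissible_def weyr_order_small)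
    qed
  next
    case 3
    consider "m = 1" "l = 0" | "m = 0" "l = 1"
      using size 3 by linarith
    note sizes = this
    from jordan_data_cases(3)[OF nas 3] consider a where "nas = [(3, a)]" | a b where "nas = [(2, a), (Suc 0, b)]"
      | a b c where "nas = [(Suc 0, a), (Suc 0, b), (Suc 0, c)]"
      by auto
    then show ?thesis
    proof cases
      case (1 a)
      have "classified m n l (jordan_matrix nas) B C"
        using S ind classify_J_3_130[of a B C] classify_J_3_031[of a B C] 3
        by (cases rule: sizes) (simp_all add: 1 jordan_matrix_single)
      then show ?thesis
        using nas(1) 1 3 by (simp add: admissible_def weyr_order_small)
    next
      case (2 a b)
      have "a \<noteq> b \<and> classified m n l (jordan_matrix nas) B C"
        using S ind classify_J_2_diagonal_130[of a b B C] classify_J_2_diagonal_031[of a b B C] 3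
        by (cases rule: sizes) (simp_all add: 2 jordan_matrix_small)
      then show ?thesis
        using nas(1) 2 3 by (simp add: admissible_def weyr_order_small)
    next
      case (3 a b c)
      have "distinct [a, b, c] \<and> classified m n l (jordan_matrix nas) B C"
        using S ind classify_diagonal_130[of a b c B C] classify_diagonal_031[of a b c B C] \<open>n = 3\<close>
        by (cases rule: sizes) (simp_all add: 3 jordan_matrix_small)
      then show ?thesis
        using nas(1) 3 \<open>n = 3\<close> by (simp add: admissible_def weyr_order_small)
    qed
  qed
qed

lemma classification:
  assumes R: "linear_order R" and S: "S \<in> systems m n l" and ind: "indecomposable m n l S"
    and size: "n \<noteq> 0" "m \<noteq> 0 \<or> l \<noteq> 0" "m + n + l \<le> 4"
  shows "\<exists>nas B C. listed_form m n l (jordan_matrix nas, B, C) \<and> admissible R n nas \<and>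
    equivalent m n l S (jordan_matrix nas, B, C)"
proof -
  obtain A B C where e: "S = (A, B, C)"
    by (metis prod_cases3)
  have A: "A \<in> carrier_mat n n"
    using S by (simp add: systems_def e)
  obtain nas Y where nas: "jordan_data R nas" "sum_list (map fst nas) = n" "Y \<in> GL n" "Y * A = jordan_matrix nas * Y"
    using ex_jordan_data[OF A R] by blast
  have t: "(1\<^sub>m m, Y, 1\<^sub>m l) \<in> trafos m n l"
    using nas(3) by (simp add: trafos_def GL_one)
  have J: "jordan_matrix nas \<in> carrier_mat n n"
    using jordan_matrix_carrier[of nas] nas(2) by simp
  have "fst (act (1\<^sub>m m, Y, 1\<^sub>m l) S) = jordan_matrix nas"
    unfolding e using fst_act_eq_iff[OF t S[unfolded e] J] nas(4) by simp
  then obtain B' C' where a: "act (1\<^sub>m m, Y, 1\<^sub>m l) S = (jordan_matrix nas, B', C')"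
    by (metis fst_conv prod_cases3)
  have S': "(jordan_matrix nas, B', C') \<in> systems m n l"
    using act_closed[OF t S] a by simp
  have eq: "equivalent m n l S (jordan_matrix nas, B', C')"
    unfolding equivalent_def using S S' t a by metis
  have "admissible R n nas \<and> classified m n l (jordan_matrix nas) B' C'"
    by (rule classify_jordan[OF nas(1,2) S' indecomposable_cong[OF eq ind] size])
  then show ?thesis
    unfolding classified_def using equivalent_trans[OF eq] by blast
qed

text \<open>The definite description may be evaluated at the listed form instead of
  \<open>S\<close>, and there \<open>belitskii_form\<close> has exactly one solution.\<close>

lemma canonical_form_listed:
  assumes "listed_form m n l (jordan_matrix nas, B, C)" "linear_order R" "admissible R n nas"
    and "equivalent m n l S (jordan_matrix nas, B, C)"
  shows "canonical_form m n l R S = (jordan_matrix nas, B, C)"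
  unfolding canonical_form_def belitskii_form_cong[OF assms(4)]
  using listed_form_belitskii_form[OF assms(1,2)] assms(3) by (simp add: admissible_def)

theorem theorem1:
  fixes m n l :: nat
  assumes "n \<noteq> 0"
    and "m \<noteq> 0 \<or> l \<noteq> 0"
    and "m + n + l \<le> 4"
  shows "indecomposable_canonical_forms m n l = {S. listed_form m n l S}"
proof (intro equalityI subsetI)
  fix N assume "N \<in> indecomposable_canonical_forms m n l"
  then obtain R S where N: "N = canonical_form m n l R S"
    and S: "linear_order R" "S \<in> systems m n l" "indecomposable m n l S"
    unfolding indecomposable_canonical_forms_def by blast
  obtain nas B C where "listed_form m n l (jordan_matrix nas, B, C)" "admissible R n nas"
    "equivalent m n l S (jordan_matrix nas, B, C)"
    using classification[OF S assms] by blast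
  then show "N \<in> {S. listed_form m n l S}"
    using canonical_form_listed[OF _ S(1)] N by simp
next
  fix N assume "N \<in> {S. listed_form m n l S}"
  then have listed: "listed_form m n l N"
    by simp
  obtain A B C where e: "N = (A, B, C)"
    by (metis prod_cases3)
  \<comment> \<open>The order is chosen to suit \<open>N\<close>: its eigenvalues, as listed, have
    to be increasing with respect to \<open>R\<close> within blocks of equal size.\<close>
  obtain R nas where R: "linear_order R" "admissible R n nas" "A = jordan_matrix nas"
    using listed_form_admissible[OF listed] by (auto simp: e)
  have N: "N \<in> systems m n l"
    by (rule listed_form_systems[OF listed])
  have "equivalent m n l N N"
    unfolding equivalent_def using N act_one[OF N] trafo_one_closed by metis
  then have "canonical_form m n l R N = N"
    using canonical_form_listed[OF _ R(1,2)] listed unfolding e R(3) by blast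
  then show "N \<in> indecomposable_canonical_forms m n l"
    unfolding indecomposable_canonical_forms_def
    using R(1) N listed_form_indecomposable[OF listed] by (metis (mono_tags, lifting) mem_Collect_eq)
qed

end
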